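(* For every $C^2$ closed convex surface $M\subset\mathbf{R}^3$ and every umbilical point $p\in M$, there exist an asymptotically constant $C^2$ function $f\colon\mathbf{R}^2\to\mathbf{R}$ and a diffeomorphism between $M\setminus\{p\}$ and $\operatorname{graph}(f)$ which preserves the principal directions. In particular, $\operatorname{graph}(f)$ has one fewer umbilic than $M$ has.
   Context: A closed convex surface $M\subset\mathbf{R}^3$ is the boundary of a compact convex set with interior points in $\mathbf{R}^3$. An umbilic (umbilical point) of a $C^2$ surface in $\mathbf{R}^3$ is a point where the two principal curvatures are equal. A principal direction at a point is a nonzero tangent vector that is an eigenvector of the differential of the Gauss map (shape operator) at that point; at an umbilic every nonzero tangent vector is a principal direction. A diffeomorphism $\phi$ between two $C^2$ surfaces $M_1, M_2\subset\mathbf{R}^3$ preserves the principal directions if, for every $q\in M_1$, a tangent vector $X\in T_qM_1$ is a principal direction of $M_1$ at $q$ if and only if $d\phi_q(X)$ is a principal direction of $M_2$ at $\phi(q)$. A function $f\colon\mathbf{R}^2\to\mathbf{R}$ is asymptotically constant if, in polar coordinates $(r,\theta)$, $$\lim_{r\to\infty}f(r,\theta)=\text{const.}\quad\text{and}\quad\lim_{r\to\infty}r\,\|\nabla f(r,\theta)\|=0,$$ both uniformly with respect to $\theta$ (the constant does not depend on $\theta$). $\operatorname{graph}(f)=\{(x,y,f(x,y)) : (x,y)\in\mathbf{R}^2\}\subset\mathbf{R}^3$. *)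

theory Defs
  imports "HOL-Analysis.Analysis"
begin

text \<open>Continuous differentiability of order one and two on an open set; the derivative is taken as
  a map into the normed space of bounded linear maps, so that it can be differentiated again.\<close>

definition C1_on :: "'a::real_normed_vector set \<Rightarrow> ('a \<Rightarrow> 'b::real_normed_vector) \<Rightarrow> bool" where
  "C1_on U f \<longleftrightarrow>
     (\<exists>f' :: 'a \<Rightarrow> 'a \<Rightarrow>\<^sub>L 'b.
        (\<forall>x\<in>U. (f has_derivative blinfun_apply (f' x)) (at x)) \<and> continuous_on U f')"

definition C2_on :: "'a::real_normed_vector set \<Rightarrow> ('a \<Rightarrow> 'b::real_normed_vector) \<Rightarrow> bool" where
  "C2_on U f \<longleftrightarrow>
     (\<exists>f' :: 'a \<Rightarrow> 'a \<Rightarrow>\<^sub>L 'b.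
        (\<forall>x\<in>U. (f has_derivative blinfun_apply (f' x)) (at x)) \<and> C1_on U f')"

definition C2_chart :: "(real^3) set \<Rightarrow> (real^2) set \<Rightarrow> (real^2 \<Rightarrow> real^3) \<Rightarrow> bool" where
  "C2_chart M U X \<longleftrightarrow>
     open U \<and> C2_on U X \<and> (\<forall>u\<in>U. inj (frechet_derivative X (at u))) \<and>
     openin (top_of_set M) (X ` U) \<and> (\<exists>Y. homeomorphism U (X ` U) X Y)"

definition C2_surface :: "(real^3) set \<Rightarrow> bool" where
  "C2_surface M \<longleftrightarrow> (\<forall>q\<in>M. \<exists>U X. C2_chart M U X \<and> q \<in> X ` U)"

definition closed_convex_surface :: "(real^3) set \<Rightarrow> bool" where
  "closed_convex_surface M \<longleftrightarrow>
     (\<exists>K. compact K \<and> convex K \<and> interior K \<noteq> {} \<and> M = frontier K)"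

text \<open>Velocities of curves in \<open>M\<close>. Only differentiability at time 0 is asked for; on a surface
  this yields the same plane as differentiable or continuously differentiable curves do.\<close>

definition tangent_space :: "(real^3) set \<Rightarrow> real^3 \<Rightarrow> (real^3) set" where
  "tangent_space M q =
     {v. \<exists>\<gamma> \<epsilon>. \<epsilon> > 0 \<and> (\<forall>t. \<bar>t\<bar> < \<epsilon> \<longrightarrow> \<gamma> t \<in> M) \<and> \<gamma> 0 = q \<and>
              (\<gamma> has_vector_derivative v) (at (0::real))}"

text \<open>The differential at \<open>q\<close> of a map defined on \<open>M\<close>, as a derivative within \<open>M\<close>. The library
  function picks one linear map on the whole of space; by the chain rule its value at a tangent
  vector, the velocity of a curve \<open>\<gamma>\<close> in \<open>M\<close>, is the velocity of \<open>g \<circ> \<gamma>\<close>, whichever map is picked.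
  So only the values on \<^term>\<open>tangent_space M q\<close> are meaningful.\<close>

definition differential ::
    "(real^3) set \<Rightarrow> (real^3 \<Rightarrow> real^3) \<Rightarrow> real^3 \<Rightarrow> real^3 \<Rightarrow> real^3" where
  "differential M g q = frechet_derivative g (at q within M)"

text \<open>A Gauss map near \<open>q\<close>: a continuous unit normal field on a neighbourhood of \<open>q\<close> in \<open>M\<close>. It is
  unique up to sign near \<open>q\<close>, and continuously differentiable on a \<open>C\<^sup>2\<close> surface.\<close>

definition gauss_map_near :: "(real^3) set \<Rightarrow> real^3 \<Rightarrow> (real^3 \<Rightarrow> real^3) \<Rightarrow> bool" where
  "gauss_map_near M q N \<longleftrightarrow>
     (\<exists>W. open W \<and> q \<in> W \<and> continuous_on (M \<inter> W) N \<and>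
          (\<forall>x\<in>M \<inter> W. norm (N x) = 1 \<and> (\<forall>v\<in>tangent_space M x. N x \<bullet> v = 0)))"

definition shape_operator ::
    "(real^3) set \<Rightarrow> (real^3 \<Rightarrow> real^3) \<Rightarrow> real^3 \<Rightarrow> real^3 \<Rightarrow> real^3" where
  "shape_operator M N q v = - differential M N q v"

definition principal_direction :: "(real^3) set \<Rightarrow> real^3 \<Rightarrow> real^3 \<Rightarrow> bool" where
  "principal_direction M q v \<longleftrightarrow>
     q \<in> M \<and> v \<in> tangent_space M q \<and> v \<noteq> 0 \<and>
     (\<exists>N k. gauss_map_near M q N \<and> shape_operator M N q v = k *\<^sub>R v)"

text \<open>The two eigenvalues of the shape operator, counted with multiplicity: those of an orthonormal
  eigenbasis of the tangent plane. The other choice of the normal changes the sign of both.\<close>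

definition principal_curvatures :: "(real^3) set \<Rightarrow> real^3 \<Rightarrow> real \<Rightarrow> real \<Rightarrow> bool" where
  "principal_curvatures M q k1 k2 \<longleftrightarrow>
     (\<exists>N e1 e2. gauss_map_near M q N \<and>
        norm e1 = 1 \<and> norm e2 = 1 \<and> e1 \<bullet> e2 = 0 \<and> tangent_space M q = span {e1, e2} \<and>
        shape_operator M N q e1 = k1 *\<^sub>R e1 \<and> shape_operator M N q e2 = k2 *\<^sub>R e2)"

definition umbilic :: "(real^3) set \<Rightarrow> real^3 \<Rightarrow> bool" where
  "umbilic M q \<longleftrightarrow> q \<in> M \<and> (\<exists>k1 k2. principal_curvatures M q k1 k2 \<and> k1 = k2)"

definition number_of_umbilics :: "(real^3) set \<Rightarrow> enat" where
  "number_of_umbilics M =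
     (if finite {q. umbilic M q} then enat (card {q. umbilic M q}) else \<infinity>)"

text \<open>Diffeomorphisms are of class \<open>C\<^sup>1\<close>.\<close>

definition C1_on_surface :: "(real^3) set \<Rightarrow> (real^3 \<Rightarrow> real^3) \<Rightarrow> bool" where
  "C1_on_surface M g \<longleftrightarrow> (\<forall>U X. C2_chart M U X \<longrightarrow> C1_on U (g \<circ> X))"

definition surface_diffeomorphism ::
    "(real^3) set \<Rightarrow> (real^3) set \<Rightarrow> (real^3 \<Rightarrow> real^3) \<Rightarrow> bool" where
  "surface_diffeomorphism M1 M2 \<phi> \<longleftrightarrow>
     bij_betw \<phi> M1 M2 \<and> C1_on_surface M1 \<phi> \<and> C1_on_surface M2 (inv_into M1 \<phi>)"

definition preserves_principal_directions ::
    "(real^3) set \<Rightarrow> (real^3) set \<Rightarrow> (real^3 \<Rightarrow> real^3) \<Rightarrow> bool" where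
  "preserves_principal_directions M1 M2 \<phi> \<longleftrightarrow>
     (\<forall>q\<in>M1. \<forall>v\<in>tangent_space M1 q.
        principal_direction M1 q v \<longleftrightarrow> principal_direction M2 (\<phi> q) (differential M1 \<phi> q v))"

definition graph :: "(real^2 \<Rightarrow> real) \<Rightarrow> (real^3) set" where
  "graph f = {vector [z $ 1, z $ 2, f z] | z. True}"

definition gradient :: "(real^2 \<Rightarrow> real) \<Rightarrow> real^2 \<Rightarrow> real^2" where
  "gradient f z = (THE D. GDERIV f z :> D)"

definition polar :: "real \<Rightarrow> real \<Rightarrow> real^2" where
  "polar r \<theta> = vector [r * cos \<theta>, r * sin \<theta>]"

definition asymptotically_constant :: "(real^2 \<Rightarrow> real) \<Rightarrow> bool" where
  "asymptotically_constant f \<longleftrightarrow>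
     (\<exists>c. uniform_limit UNIV (\<lambda>r \<theta>. f (polar r \<theta>)) (\<lambda>\<theta>. c) at_top) \<and>
     uniform_limit UNIV (\<lambda>r \<theta>. r * norm (gradient f (polar r \<theta>))) (\<lambda>\<theta>. 0) at_top"

end

theory Submission
  imports Defs
begin

text \<open>Inverting space in a sphere centred at the umbilic \<open>p\<close> sends \<open>M - {p}\<close> to a surface that is
  close to a plane far away, and inversions preserve principal directions. The inverted surface
  need not be a graph, however: vertical lines correspond to circles through \<open>p\<close> normal to \<open>M\<close>, and
  such a circle may meet a flat or elongated convex surface in several further points. This is
  repaired by first replacing \<open>M\<close> with its outer parallel surface at a large distance \<open>t\<close>, which also
  has the same principal directions. With \<open>n\<close> the outward unit normal, the map is
  \<open>\<phi> y = Q (x / \<parallel>x\<parallel>\<^sup>2)\<close> where \<open>x = (y - p) + t (n y - n p)\<close> and \<open>Q\<close> is an orthogonal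
  transformation that makes \<open>- n p\<close> vertical.

  The graph property comes from one inequality, \<open>reflected_normal_inner_pos\<close>: if \<open>2 t\<^sup>2\<close> bounds
  \<open>\<parallel>y - p\<parallel>\<^sup>2\<close> on the body, the normal of the image surface at \<open>\<phi> y\<close>, which is the reflection of \<open>n y\<close> in
  the plane orthogonal to \<open>x\<close>, is never horizontal. Hence, along each vertical line, the distance
  from the convex body of the corresponding point crosses the value \<open>t\<close> in one direction only, so it
  does so at most once; it does so at all by the intermediate value theorem (\<open>bij_proj_\<phi>\<close>).
  The map is only of class \<open>C\<^sup>1\<close>, because \<open>n\<close> is. But the image has a continuously
  differentiable unit normal too, and the gradient of \<open>f\<close> is a rational expression in that normal.
  This makes \<open>f\<close> twice continuously differentiable.

  Principal directions are eigenvectors \<open>v\<close> of the differential \<open>A\<close> of \<open>n\<close>. Up to the reflection and a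
  scalar factor, the differential of \<open>\<phi>\<close> is \<open>1 + t A\<close>, and that of the new normal is \<open>A - b (1 + t A)\<close>
  with a number \<open>b\<close> that depends on the point alone; so the eigenvectors correspond. Convexity enters
  through \<open>A \<ge> 0\<close>, which keeps \<open>1 + t A\<close> invertible. The correspondence of eigenvalues does not depend on
  the direction, so umbilics correspond as well, and only \<open>p\<close> is lost.

  Finally, \<open>p\<close> being an umbilic, \<open>M\<close> agrees to second order at \<open>p\<close> with a sphere or a plane of curvature
  \<open>k\<close>, whose parallel surfaces are sent to planes. Quantitatively, \<open>n y = n p + k (y - p) + o(\<parallel>y - p\<parallel>)\<close>
  and \<open>n p \<bullet> (y - p) = - k/2 \<parallel>y - p\<parallel>\<^sup>2 + o(\<parallel>y - p\<parallel>\<^sup>2)\<close>. It follows that the height of \<open>\<phi> y\<close> tends to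
  \<open>k / (2 (1 + t k))\<close> and that its normal differs from the downward vertical by \<open>o(\<parallel>y - p\<parallel>)\<close>, which is
  what asymptotic constancy asks for, as \<open>\<parallel>y - p\<parallel> \<le> 1 / \<parallel>\<phi> y\<parallel>\<close>.\<close>

section \<open>Continuously differentiable maps\<close>

text \<open>On a Euclidean domain the derivative, as a map into the bounded linear maps, is continuous as
  soon as all directional derivatives are. This reduces the calculus below to vector valued
  functions.\<close>

lemma C1_onI:
  fixes f :: "'a::euclidean_space \<Rightarrow> 'b::real_normed_vector"
  assumes "\<And>x. x \<in> U \<Longrightarrow> (f has_derivative f' x) (at x)"
    and "\<And>v. continuous_on U (\<lambda>x. f' x v)"
  shows "C1_on U f"
proof -
  have bl: "bounded_linear (f' x)" if "x \<in> U" for x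
    using assms(1)[OF that] has_derivative_bounded_linear by blast
  have eq: "blinfun_apply (Blinfun (f' x)) = f' x" if "x \<in> U" for x
    using bl[OF that] by (rule bounded_linear_Blinfun_apply)
  have "continuous_on U (\<lambda>x. Blinfun (f' x))"
  proof (rule continuous_on_blinfun_componentwise)
    fix i :: 'a
    show "continuous_on U (\<lambda>x. blinfun_apply (Blinfun (f' x)) i)"
      by (rule continuous_on_eq[OF assms(2)[of i]]) (simp add: eq)
  qed
  then show ?thesis
    unfolding C1_on_def using assms(1) by (intro exI[of _ "\<lambda>x. Blinfun (f' x)"]) (simp add: eq)
qed

lemma C1_on_has_derivative:
  assumes "C1_on U f" "x \<in> U"
  shows "(f has_derivative frechet_derivative f (at x)) (at x)"
  using assms unfolding C1_on_def
  by (metis differentiable_def frechet_derivative_works)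

lemma C1_on_continuous_frechet:
  assumes "C1_on U f"
  shows "continuous_on U (\<lambda>x. frechet_derivative f (at x) v)"
proof -
  obtain f' where f': "\<And>x. x \<in> U \<Longrightarrow> (f has_derivative blinfun_apply (f' x)) (at x)"
    and c: "continuous_on U f'"
    using assms unfolding C1_on_def by blast
  have "continuous_on U (\<lambda>x. blinfun_apply (f' x) v)"
    using c by (intro continuous_intros)
  then show ?thesis
    by (rule continuous_on_eq) (metis f' frechet_derivative_at)
qed

lemma C1_on_continuous: "C1_on U f \<Longrightarrow> continuous_on U f"
  by (meson C1_on_has_derivative continuous_at_imp_continuous_on has_derivative_continuous)

lemma C1_on_subset: "C1_on U f \<Longrightarrow> V \<subseteq> U \<Longrightarrow> C1_on V f"
  unfolding C1_on_def by (meson continuous_on_subset subsetD)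

lemma C1_on_cong:
  assumes "C1_on U f" "open U" "\<And>x. x \<in> U \<Longrightarrow> f x = g x"
  shows "C1_on U g"
proof -
  obtain f' where f': "\<And>x. x \<in> U \<Longrightarrow> (f has_derivative blinfun_apply (f' x)) (at x)"
    and c: "continuous_on U f'"
    using assms(1) unfolding C1_on_def by blast
  have "(g has_derivative blinfun_apply (f' x)) (at x)" if "x \<in> U" for x
    by (rule has_derivative_transform_within_open[OF f'[OF that] assms(2) that]) (simp add: assms(3))
  then show ?thesis unfolding C1_on_def using c by blast
qed

lemma C1_on_local:
  fixes f :: "'a::euclidean_space \<Rightarrow> 'b::real_normed_vector"
  assumes "\<And>x. x \<in> U \<Longrightarrow> \<exists>V. open V \<and> x \<in> V \<and> C1_on V f"
  shows "C1_on U f"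
proof (rule C1_onI)
  show "(f has_derivative frechet_derivative f (at x)) (at x)" if "x \<in> U" for x
    using assms[OF that] C1_on_has_derivative by blast
  show "continuous_on U (\<lambda>x. frechet_derivative f (at x) v)" for v
  proof (rule continuous_at_imp_continuous_on, rule ballI)
    fix x assume "x \<in> U"
    then obtain V where V: "open V" "x \<in> V" "C1_on V f" using assms by blast
    show "isCont (\<lambda>x. frechet_derivative f (at x) v) x"
      using C1_on_continuous_frechet[OF V(3), of v] V(1,2) continuous_on_eq_continuous_at by blast
  qed
qed

lemma C1_on_const [intro]: "C1_on U (\<lambda>x. c)"
  unfolding C1_on_def by (intro exI[of _ "\<lambda>x. 0"]) (auto intro!: continuous_intros derivative_eq_intros simp: zero_blinfun.rep_eq)

lemma C1_on_bounded_linear: "bounded_linear L \<Longrightarrow> C1_on U L"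
  unfolding C1_on_def
  by (intro exI[of _ "\<lambda>x. Blinfun L"])
    (auto intro!: continuous_intros simp: bounded_linear_Blinfun_apply bounded_linear_imp_has_derivative)

lemma C1_on_compose:
  assumes "C1_on U f" "C1_on V g" "f ` U \<subseteq> V"
  shows "C1_on U (\<lambda>x. g (f x))"
proof -
  obtain f' where f': "\<And>x. x \<in> U \<Longrightarrow> (f has_derivative blinfun_apply (f' x)) (at x)"
    and c: "continuous_on U f'"
    using assms(1) unfolding C1_on_def by blast
  obtain g' where g': "\<And>x. x \<in> V \<Longrightarrow> (g has_derivative blinfun_apply (g' x)) (at x)"
    and cg: "continuous_on V g'"
    using assms(2) unfolding C1_on_def by blast
  have "((\<lambda>x. g (f x)) has_derivative blinfun_apply (g' (f x) o\<^sub>L f' x)) (at x)" if "x \<in> U" for x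
  proof -
    have "(g has_derivative blinfun_apply (g' (f x))) (at (f x))"
      using that assms(3) g' by blast
    from has_derivative_compose[OF f'[OF that] this]
    show ?thesis by (simp add: blinfun_compose.rep_eq o_def)
  qed
  moreover have "continuous_on U (\<lambda>x. g' (f x) o\<^sub>L f' x)"
    using continuous_on_compose2[OF cg C1_on_continuous[OF assms(1)] assms(3)] c
    by (intro continuous_intros)
  ultimately show ?thesis unfolding C1_on_def by (intro exI[of _ "\<lambda>x. g' (f x) o\<^sub>L f' x"]) blast
qed

lemma C1_on_linear_compose:
  assumes "bounded_linear L" "C1_on U f"
  shows "C1_on U (\<lambda>x. L (f x))"
  using C1_on_compose[OF assms(2) C1_on_bounded_linear[OF assms(1), of UNIV]] by simp

lemma C1_on_bilinear:
  fixes f :: "'a::euclidean_space \<Rightarrow> 'b::real_normed_vector"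
    and g :: "'a \<Rightarrow> 'c::real_normed_vector"
  assumes "bounded_bilinear b" "C1_on U f" "C1_on U g"
  shows "C1_on U (\<lambda>x. b (f x) (g x))"
proof (rule C1_onI)
  show "((\<lambda>x. b (f x) (g x)) has_derivative
      (\<lambda>v. b (f x) (frechet_derivative g (at x) v) + b (frechet_derivative f (at x) v) (g x))) (at x)"
    if "x \<in> U" for x
    by (rule bounded_bilinear.FDERIV[OF assms(1)])
      (use C1_on_has_derivative assms that in blast)+
  show "continuous_on U
      (\<lambda>x. b (f x) (frechet_derivative g (at x) v) + b (frechet_derivative f (at x) v) (g x))" for v
    using C1_on_continuous_frechet[OF assms(2)] C1_on_continuous_frechet[OF assms(3)]
      C1_on_continuous[OF assms(2)] C1_on_continuous[OF assms(3)]
    by (intro continuous_on_add bounded_bilinear.continuous_on[OF assms(1)])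
qed

lemma C1_on_add:
  fixes f g :: "'a::euclidean_space \<Rightarrow> 'b::real_normed_vector"
  assumes "C1_on U f" "C1_on U g"
  shows "C1_on U (\<lambda>x. f x + g x)"
  by (rule C1_onI[where f' = "\<lambda>x v. frechet_derivative f (at x) v + frechet_derivative g (at x) v"])
    (auto intro!: has_derivative_add continuous_on_add C1_on_continuous_frechet C1_on_has_derivative assms)

lemmas C1_on_scaleR = C1_on_bilinear[OF bounded_bilinear_scaleR]
lemmas C1_on_inner = C1_on_bilinear[OF bounded_bilinear_inner]
lemmas C1_on_uminus = C1_on_linear_compose[OF bounded_linear_minus[OF bounded_linear_ident]]

lemma C1_on_diff:
  fixes f g :: "'a::euclidean_space \<Rightarrow> 'b::real_normed_vector"
  assumes "C1_on U f" "C1_on U g"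
  shows "C1_on U (\<lambda>x. f x - g x)"
  using C1_on_add[OF assms(1) C1_on_uminus[OF assms(2)]] by simp

lemma C1_on_inverse:
  fixes f :: "'a::euclidean_space \<Rightarrow> real"
  assumes "C1_on U f" "\<And>x. x \<in> U \<Longrightarrow> f x \<noteq> 0"
  shows "C1_on U (\<lambda>x. inverse (f x))"
proof (rule C1_onI)
  show "((\<lambda>x. inverse (f x)) has_derivative
      (\<lambda>v. - (inverse (f x) * frechet_derivative f (at x) v * inverse (f x)))) (at x)" if "x \<in> U" for x
    using Deriv.has_derivative_inverse[OF assms(2)[OF that] C1_on_has_derivative[OF assms(1) that]] .
  show "continuous_on U (\<lambda>x. - (inverse (f x) * frechet_derivative f (at x) v * inverse (f x)))" for v
    using assms(2)
    by (intro continuous_intros C1_on_continuous_frechet C1_on_continuous assms) auto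
qed

lemma C1_on_norm_inner:
  fixes f :: "'a::euclidean_space \<Rightarrow> 'b::real_inner"
  assumes "C1_on U f" "\<And>x. x \<in> U \<Longrightarrow> f x \<noteq> 0"
  shows "C1_on U (\<lambda>x. norm (f x))"
proof (rule C1_onI)
  show "((\<lambda>x. norm (f x)) has_derivative
      (\<lambda>v. frechet_derivative f (at x) v \<bullet> sgn (f x))) (at x)" if "x \<in> U" for x
    using has_derivative_compose[OF C1_on_has_derivative[OF assms(1) that] has_derivative_norm[OF assms(2)[OF that]]] .
  show "continuous_on U (\<lambda>x. frechet_derivative f (at x) v \<bullet> sgn (f x))" for v
    using assms(2) unfolding sgn_div_norm
    by (intro continuous_intros C1_on_continuous_frechet C1_on_continuous assms) auto
qed

lemma C2_on_imp_C1_on: "C2_on U f \<Longrightarrow> C1_on U f"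
  unfolding C2_on_def C1_on_def using C1_on_continuous C1_on_def by blast

lemma C2_on_frechet_derivative:
  assumes "C2_on U f" "open U"
  shows "C1_on U (\<lambda>x. frechet_derivative f (at x) v)"
proof -
  obtain f' where f': "\<And>x. x \<in> U \<Longrightarrow> (f has_derivative blinfun_apply (f' x)) (at x)"
    and c: "C1_on U f'"
    using assms(1) unfolding C2_on_def by blast
  have "C1_on U (\<lambda>x. blinfun_apply (f' x) v)"
    by (rule C1_on_linear_compose[OF _ c]) (rule blinfun.bounded_linear_left)
  then show ?thesis
    by (rule C1_on_cong) (use assms f' frechet_derivative_at in \<open>metis+\<close>)
qed

text \<open>The inverse of \<open>A y\<close> depends continuously on \<open>y\<close> because of the resolvent identity
  \<open>B y - B x = B y (A x - A y) B x\<close>, once \<open>B y\<close> is known to stay bounded near \<open>x\<close>. The same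
  identity, read as \<open>\<parallel>B y\<parallel> \<le> \<parallel>B x\<parallel> + \<parallel>B y\<parallel> \<parallel>A x - A y\<parallel> \<parallel>B x\<parallel>\<close>, gives that bound.\<close>

lemma continuous_on_blinfun_inverse:
  fixes A :: "'a::topological_space \<Rightarrow> 'b::real_normed_vector \<Rightarrow>\<^sub>L 'c::real_normed_vector"
    and B :: "'a \<Rightarrow> 'c \<Rightarrow>\<^sub>L 'b"
  assumes c: "continuous_on S A"
    and AB: "\<And>y v. y \<in> S \<Longrightarrow> A y (B y v) = v" and BA: "\<And>y v. y \<in> S \<Longrightarrow> B y (A y v) = v"
  shows "continuous_on S B"
  unfolding continuous_on_def
proof
  fix x assume x: "x \<in> S"
  have eq: "B y - B x = B y o\<^sub>L (A x - A y) o\<^sub>L B x" if "y \<in> S" for y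
    using AB[OF x] BA[OF that] by (intro blinfun_eqI)
      (simp add: blinfun.bilinear_simps)
  have le: "norm (B y - B x) \<le> norm (B y) * norm (A x - A y) * norm (B x)" if "y \<in> S" for y
  proof -
    have "norm (B y - B x) \<le> norm (B y o\<^sub>L (A x - A y)) * norm (B x)"
      unfolding eq[OF that] by (rule norm_blinfun_compose)
    also have "\<dots> \<le> norm (B y) * norm (A x - A y) * norm (B x)"
      by (intro mult_right_mono norm_blinfun_compose) auto
    finally show ?thesis .
  qed
  have A: "((\<lambda>y. norm (A x - A y) * norm (B x)) \<longlongrightarrow> 0) (at x within S)"
  proof -
    have "(A \<longlongrightarrow> A x) (at x within S)" using c x by (auto simp: continuous_on_def)
    then have "((\<lambda>y. norm (A x - A y) * norm (B x)) \<longlongrightarrow> norm (A x - A x) * norm (B x)) (at x within S)"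
      by (intro tendsto_intros)
    then show ?thesis by simp
  qed
  have "\<forall>\<^sub>F y in at x within S. norm (A x - A y) * norm (B x) < 1/2"
    using order_tendstoD(2)[OF A, of "1/2"] by simp
  moreover have "\<forall>\<^sub>F y in at x within S. y \<in> S" by (auto simp: eventually_at_filter)
  ultimately have ev: "\<forall>\<^sub>F y in at x within S.
      norm (B y - B x) \<le> 2 * norm (B x) * (norm (A x - A y) * norm (B x))"
  proof eventually_elim
    case (elim y)
    have "norm (B y) \<le> norm (B x) + norm (B y - B x)"
      by (metis add.commute diff_add_cancel norm_triangle_ineq)
    also have "\<dots> \<le> norm (B x) + norm (B y) * (norm (A x - A y) * norm (B x))"
      using le[OF elim(2)] by (simp add: mult.assoc)
    also have "\<dots> \<le> norm (B x) + norm (B y) * (1/2)"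
      using elim(1) by (intro add_left_mono mult_left_mono) auto
    finally have "norm (B y) \<le> 2 * norm (B x)" by simp
    then have "norm (B y) * (norm (A x - A y) * norm (B x)) \<le> 2 * norm (B x) * (norm (A x - A y) * norm (B x))"
      by (rule mult_right_mono) auto
    then show ?case using le[OF elim(2)] by (simp add: mult.assoc)
  qed
  have "((\<lambda>y. B y - B x) \<longlongrightarrow> 0) (at x within S)"
    by (rule Lim_null_comparison[OF ev]) (use tendsto_mult_right_zero[OF A] in blast)
  then show "(B \<longlongrightarrow> B x) (at x within S)" by (simp add: LIM_zero_iff)
qed

text \<open>The inverse function theorem, with the continuity of the derivative of the inverse.\<close>

lemma C1_inverse_function:
  fixes f :: "'a::euclidean_space \<Rightarrow> 'a"
  assumes "open U" "C1_on U f" "x0 \<in> U" "inj (frechet_derivative f (at x0))"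
  obtains U' V g where "open U'" "U' \<subseteq> U" "x0 \<in> U'" "open V" "homeomorphism U' V f g" "C1_on V g"
proof -
  obtain f' where f': "\<And>x. x \<in> U \<Longrightarrow> (f has_derivative blinfun_apply (f' x)) (at x)"
    and c: "continuous_on U f'"
    using assms(2) unfolding C1_on_def by blast
  have "inj (blinfun_apply (f' x0))" "linear (blinfun_apply (f' x0))"
    using assms(4) frechet_derivative_at[OF f'[OF assms(3)]]
      bounded_linear.linear[OF blinfun.bounded_linear_right] by metis+
  then obtain L where L: "linear L" "\<And>v. L (blinfun_apply (f' x0) v) = v"
    using linear_injective_left_inverse by (metis comp_apply id_apply)
  have "Blinfun L o\<^sub>L f' x0 = id_blinfun"
    using L by (intro blinfun_eqI) (simp add: bounded_linear_Blinfun_apply linear_conv_bounded_linear)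
  from inverse_function_theorem[OF assms(1) f' c assms(3) this]
  obtain U' V g g' where *: "open U'" "U' \<subseteq> U" "x0 \<in> U'" "open V" "homeomorphism U' V f g"
    and d: "\<And>y. y \<in> V \<Longrightarrow> (g has_derivative (g' y)) (at y)"
    and g': "\<And>y. y \<in> V \<Longrightarrow> g' y = inv (blinfun_apply (f'(g y)))"
    and bij: "\<And>y. y \<in> V \<Longrightarrow> bij (blinfun_apply (f'(g y)))"
    by metis
  have bl: "blinfun_apply (Blinfun (g' y)) = g' y" if "y \<in> V" for y
    using d[OF that] by (simp add: bounded_linear_Blinfun_apply has_derivative_bounded_linear)
  have cg: "continuous_on V g" "g ` V \<subseteq> U"
    using *(2,5) by (auto simp: homeomorphism_def)
  have "continuous_on V (\<lambda>y. Blinfun (g' y))"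
  proof (rule continuous_on_blinfun_inverse)
    show "continuous_on V (\<lambda>y. f' (g y))"
      by (rule continuous_on_compose2[OF c cg])
    show "f' (g y) (Blinfun (g' y) v) = v" "Blinfun (g' y) (f' (g y) v) = v" if "y \<in> V" for y v
      unfolding bl[OF that] unfolding g'[OF that]
      using bij[OF that] by (simp_all add: bij_is_surj surj_f_inv_f bij_is_inj)
  qed
  then have "C1_on V g"
    unfolding C1_on_def using d bl by (intro exI[of _ "\<lambda>y. Blinfun (g' y)"]) simp
  then show ?thesis using that * by blast
qed

section \<open>Surfaces and their tangent planes\<close>

lemma chart_C1: "C2_chart M U X \<Longrightarrow> C1_on U X"
  unfolding C2_chart_def using C2_on_imp_C1_on by blast

lemma chart_has_derivative:
  "C2_chart M U X \<Longrightarrow> u \<in> U \<Longrightarrow> (X has_derivative frechet_derivative X (at u)) (at u)"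
  using chart_C1 C1_on_has_derivative by blast

lemma chart_in_surface: "C2_chart M U X \<Longrightarrow> u \<in> U \<Longrightarrow> X u \<in> M"
  unfolding C2_chart_def using openin_imp_subset by blast

text \<open>A linear left inverse \<open>B\<close> of the derivative at \<open>u\<close> makes \<open>B \<circ> X\<close> a local diffeomorphism of the
  plane, so \<open>(B \<circ> X)\<^sup>-\<^sup>1 \<circ> B\<close> extends the inverse of the chart to a neighbourhood in space. Chain rules
  along \<open>M\<close> all come from this extension.\<close>

lemma chart_retraction:
  assumes "C2_chart M U X" "u \<in> U"
  obtains W \<rho> where "open W" "X u \<in> W" "C1_on W \<rho>"
    "\<And>x. x \<in> M \<inter> W \<Longrightarrow> \<rho> x \<in> U \<and> X (\<rho> x) = x" "\<rho> (X u) = u"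
proof -
  define D where "D = frechet_derivative X (at u)"
  have D: "(X has_derivative D) (at u)"
    unfolding D_def using chart_has_derivative[OF assms] .
  have U: "open U" and injD: "inj D" and op: "openin (top_of_set M) (X ` U)"
    using assms unfolding C2_chart_def D_def by blast+
  obtain Y where Y: "homeomorphism U (X ` U) X Y"
    using assms unfolding C2_chart_def by blast
  have linD: "linear D" using D has_derivative_linear by blast
  then obtain B where B: "linear B" "\<And>v. B (D v) = v"
    using linear_injective_left_inverse[OF linD injD] by (metis comp_apply id_apply)
  have blB: "bounded_linear B" using B(1) by (simp add: linear_conv_bounded_linear)
  have C1: "C1_on U (\<lambda>u. B (X u))"
    by (rule C1_on_linear_compose[OF blB chart_C1[OF assms(1)]])
  have "((\<lambda>u. B (X u)) has_derivative (\<lambda>v. B (D v))) (at u)"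
    by (rule bounded_linear.has_derivative[OF blB D])
  then have "frechet_derivative (\<lambda>u. B (X u)) (at u) = (\<lambda>v. v)"
    using frechet_derivative_at B(2) by force
  then have "inj (frechet_derivative (\<lambda>u. B (X u)) (at u))" by simp
  from C1_inverse_function[OF U C1 assms(2) this]
  obtain U' V g where g: "open U'" "U' \<subseteq> U" "u \<in> U'" "open V"
      "homeomorphism U' V (\<lambda>u. B (X u)) g" "C1_on V g"
    by metis
  have "openin (top_of_set U) U'" using g(1,2) by (simp add: open_subset)
  then have "openin (top_of_set (X ` U)) (X ` U')"
    by (rule homeomorphism_imp_open_map[OF Y])
  then have "openin (top_of_set M) (X ` U')" using op openin_trans by blast
  then obtain W1 where W1: "open W1" "X ` U' = M \<inter> W1" by (auto simp: openin_open)
  have contB: "continuous_on UNIV B" using blB linear_continuous_on by blast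
  define W where "W = W1 \<inter> B -` V"
  have gB: "g (B (X u')) = u'" "B (X u') \<in> V" if "u' \<in> U'" for u'
    using g(5) that by (auto simp: homeomorphism_def)
  show ?thesis
  proof (rule that[of W "\<lambda>x. g (B x)"])
    show "open W" unfolding W_def using W1(1) g(4) contB
      by (simp add: open_Int open_vimage)
    show "X u \<in> W" unfolding W_def using W1(2) g(3) gB by auto
    show "C1_on W (\<lambda>x. g (B x))"
      by (rule C1_on_compose[OF C1_on_bounded_linear[OF blB] g(6)]) (auto simp: W_def)
    show "g (B x) \<in> U \<and> X (g (B x)) = x" if "x \<in> M \<inter> W" for x
    proof -
      have "x \<in> X ` U'" using that W1(2) by (auto simp: W_def)
      then show ?thesis using gB g(2) by auto
    qed
    show "g (B (X u)) = u" using gB g(3) by simp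
  qed
qed

lemma has_derivative_within_chart:
  assumes "C2_chart M U X" "u \<in> U" "((\<lambda>u. g (X u)) has_derivative A) (at u)"
  obtains R where "linear R" "\<And>v. R (frechet_derivative X (at u) v) = v"
    "(g has_derivative (\<lambda>v. A (R v))) (at (X u) within M)"
proof -
  obtain W \<rho> where W: "open W" "X u \<in> W" "C1_on W \<rho>"
    "\<And>x. x \<in> M \<inter> W \<Longrightarrow> \<rho> x \<in> U \<and> X (\<rho> x) = x" "\<rho> (X u) = u"
    using chart_retraction[OF assms(1,2)] by metis
  define R where "R = frechet_derivative \<rho> (at (X u))"
  have R: "(\<rho> has_derivative R) (at (X u))"
    unfolding R_def using W(2,3) C1_on_has_derivative by blast
  have U: "open U" using assms(1) C2_chart_def by blast
  show ?thesis
  proof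
    show "linear R" using R has_derivative_linear by blast
    have 1: "((\<lambda>u. \<rho> (X u)) has_derivative (\<lambda>v. R (frechet_derivative X (at u) v))) (at u)"
      by (rule has_derivative_compose[OF chart_has_derivative[OF assms(1,2)] R])
    have inj: "inj_on X U" using assms(1) unfolding C2_chart_def
      by (metis homeomorphism_apply1 inj_on_inverseI)
    have "isCont X u" using chart_has_derivative[OF assms(1,2)] has_derivative_continuous by blast
    then have "\<forall>\<^sub>F u' in at u. X u' \<in> W"
      using W(1,2) unfolding isCont_def by (simp add: topological_tendstoD)
    moreover have "\<forall>\<^sub>F u' in at u. u' \<in> U"
      using U assms(2) by (simp add: eventually_at_in_open')
    ultimately have "\<forall>\<^sub>F u' in at u. \<rho> (X u') = u'"
    proof eventually_elim
      case (elim u')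
      have "X u' \<in> M \<inter> W" using elim chart_in_surface[OF assms(1)] by blast
      from W(4)[OF this] show ?case using inj elim(2) by (meson inj_onD)
    qed
    then have "((\<lambda>u. u) has_derivative (\<lambda>v. R (frechet_derivative X (at u) v))) (at u)"
      using has_derivative_transform_eventually[OF 1] W(5) by auto
    then show "R (frechet_derivative X (at u) v) = v" for v
      using has_derivative_unique has_derivative_ident by metis
    have "((\<lambda>u. g (X u)) has_derivative A) (at (\<rho> (X u)))" using assms(3) W(5) by simp
    from has_derivative_compose[OF has_derivative_at_withinI[OF R] this]
    have "((\<lambda>x. g (X (\<rho> x))) has_derivative (\<lambda>v. A (R v))) (at (X u) within M)" .
    then show "(g has_derivative (\<lambda>v. A (R v))) (at (X u) within M)"
    proof (rule has_derivative_transform_eventually)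
      have "\<forall>\<^sub>F x in at (X u) within M. x \<in> W"
        using W(1,2) by (simp add: eventually_at_topological) blast
      moreover have "\<forall>\<^sub>F x in at (X u) within M. x \<in> M"
        by (auto simp: eventually_at_filter)
      ultimately show "\<forall>\<^sub>F x in at (X u) within M. g (X (\<rho> x)) = g x"
        by eventually_elim (use W(4) in auto)
      show "g (X (\<rho> (X u))) = g (X u)" by (simp add: W(5))
      show "X u \<in> M" using chart_in_surface[OF assms(1,2)] .
    qed
  qed
qed

lemma tangent_space_curve:
  assumes "(g has_derivative L) (at q within M)" "\<epsilon> > 0" "\<And>t. \<bar>t\<bar> < \<epsilon> \<Longrightarrow> \<gamma> t \<in> M" "\<gamma> 0 = q"
    "(\<gamma> has_vector_derivative v) (at (0::real))"
  shows "((\<lambda>t. g (\<gamma> t)) has_vector_derivative L v) (at 0)"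
proof -
  have eq: "at (0::real) within ball 0 \<epsilon> = at 0" by (rule at_within_open) (use assms(2) in auto)
  have "(\<gamma> has_derivative (\<lambda>t. t *\<^sub>R v)) (at 0 within ball 0 \<epsilon>)"
    using assms(5) eq unfolding has_vector_derivative_def by simp
  moreover have "\<gamma> ` ball 0 \<epsilon> \<subseteq> M" using assms(3) by fastforce
  then have "(g has_derivative L) (at (\<gamma> 0) within \<gamma> ` ball 0 \<epsilon>)"
    using assms(1,4) has_derivative_subset by metis
  ultimately have "((\<lambda>t. g (\<gamma> t)) has_derivative (\<lambda>t. L (t *\<^sub>R v))) (at 0 within ball 0 \<epsilon>)"
    using has_derivative_in_compose by blast
  moreover have "L (t *\<^sub>R v) = t *\<^sub>R L v" for t
    using assms(1) has_derivative_linear linear_scale by blast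
  ultimately show ?thesis unfolding has_vector_derivative_def eq by simp
qed

lemma tangent_space_map:
  fixes g :: "real^3 \<Rightarrow> real^3"
  assumes "(g has_derivative L) (at q within M)" "v \<in> tangent_space M q" "g ` M \<subseteq> S"
  shows "L v \<in> tangent_space S (g q)"
proof -
  obtain \<gamma> \<epsilon> where c: "\<epsilon> > 0" "\<And>t. \<bar>t\<bar> < \<epsilon> \<Longrightarrow> \<gamma> t \<in> M" "\<gamma> 0 = q"
    "(\<gamma> has_vector_derivative v) (at (0::real))"
    using assms(2) unfolding tangent_space_def by blast
  have "((\<lambda>t. g (\<gamma> t)) has_vector_derivative L v) (at 0)"
    using tangent_space_curve[OF assms(1) c] .
  then show ?thesis unfolding tangent_space_def using c assms(3)
    by (intro CollectI exI[of _ "\<lambda>t. g (\<gamma> t)"] exI[of _ \<epsilon>]) auto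
qed

text \<open>Derivatives within a surface are determined on tangent vectors only.\<close>

lemma has_derivative_tangent_unique:
  assumes "(g has_derivative L1) (at q within M)" "(g has_derivative L2) (at q within M)"
    "v \<in> tangent_space M q"
  shows "L1 v = L2 v"
proof -
  obtain \<gamma> \<epsilon> where c: "\<epsilon> > 0" "\<And>t. \<bar>t\<bar> < \<epsilon> \<Longrightarrow> \<gamma> t \<in> M" "\<gamma> 0 = q"
    "(\<gamma> has_vector_derivative v) (at (0::real))"
    using assms(3) unfolding tangent_space_def by blast
  show ?thesis
    using tangent_space_curve[OF assms(1) c] tangent_space_curve[OF assms(2) c]
      vector_derivative_unique_at by blast
qed

lemma differential_eq:
  assumes "(g has_derivative L) (at q within M)" "v \<in> tangent_space M q"
  shows "differential M g q v = L v"
  unfolding differential_def using assms has_derivative_tangent_unique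
  by (metis differentiable_def frechet_derivative_works)

text \<open>A curve in \<open>M\<close> is the image under the chart of a curve in the plane, by the retraction; this
  gives the nontrivial inclusion.\<close>

lemma tangent_space_chart:
  assumes "C2_chart M U X" "u \<in> U"
  shows "tangent_space M (X u) = range (frechet_derivative X (at u))"
proof
  have X: "(X has_derivative frechet_derivative X (at u)) (at u)"
    using chart_has_derivative[OF assms] .
  obtain R where R: "((\<lambda>x. x) has_derivative (\<lambda>v. frechet_derivative X (at u) (R v))) (at (X u) within M)"
    using has_derivative_within_chart[OF assms, of "\<lambda>x. x"] X by metis
  show "tangent_space M (X u) \<subseteq> range (frechet_derivative X (at u))"
  proof
    fix v assume "v \<in> tangent_space M (X u)"
    then have "v = frechet_derivative X (at u) (R v)"
      using has_derivative_tangent_unique[OF R has_derivative_ident] by metis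
    then show "v \<in> range (frechet_derivative X (at u))" by blast
  qed
  have U: "open U" using assms(1) C2_chart_def by blast
  show "range (frechet_derivative X (at u)) \<subseteq> tangent_space M (X u)"
  proof clarify
    fix v :: "real^2"
    have line: "((\<lambda>t. u + t *\<^sub>R v) has_vector_derivative v) (at 0)"
      by (auto intro!: derivative_eq_intros simp: has_vector_derivative_def)
    have "((\<lambda>t. X (u + t *\<^sub>R v)) has_vector_derivative frechet_derivative X (at u) v) (at 0)"
      by (rule tangent_space_curve[OF X zero_less_one _ _ line]) simp_all
    moreover obtain e where e: "e > 0" "ball u e \<subseteq> U"
      using U assms(2) open_contains_ball by blast
    define \<epsilon> where "\<epsilon> = e / (norm v + 1)"
    have \<epsilon>: "\<epsilon> > 0" "u + t *\<^sub>R v \<in> U" if "\<bar>t\<bar> < \<epsilon>" for t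
    proof -
      have pos: "0 < norm v + 1" by (simp add: add_nonneg_pos)
      show "\<epsilon> > 0" unfolding \<epsilon>_def using e(1) pos by simp
      have "\<bar>t\<bar> * norm v \<le> \<bar>t\<bar> * (norm v + 1)" by (simp add: mult_left_mono)
      also have "\<dots> < e" using that pos unfolding \<epsilon>_def by (simp add: pos_less_divide_eq)
      finally show "u + t *\<^sub>R v \<in> U" using e(2) by (auto simp: dist_norm)
    qed
    moreover have "\<epsilon> > 0" using e(1) \<epsilon>_def by (simp add: add_nonneg_pos)
    ultimately show "frechet_derivative X (at u) v \<in> tangent_space M (X u)"
      unfolding tangent_space_def using chart_in_surface[OF assms(1)]
      by (intro CollectI exI[of _ "\<lambda>t. X (u + t *\<^sub>R v)"] exI[of _ \<epsilon>]) auto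
  qed
qed

lemma tangent_space_subspace:
  assumes "C2_surface M" "q \<in> M"
  shows "subspace (tangent_space M q)" and "dim (tangent_space M q) = 2"
proof -
  obtain U X u where c: "C2_chart M U X" "u \<in> U" "q = X u"
    using assms unfolding C2_surface_def by blast
  have T: "tangent_space M q = range (frechet_derivative X (at u))"
    using tangent_space_chart[OF c(1,2)] c(3) by simp
  have lin: "linear (frechet_derivative X (at u))"
    using chart_has_derivative[OF c(1,2)] has_derivative_linear by blast
  then show "subspace (tangent_space M q)" unfolding T
    by (simp add: linear_subspace_image)
  have "inj (frechet_derivative X (at u))" using c unfolding C2_chart_def by blast
  then show "dim (tangent_space M q) = 2" unfolding T
    using dim_image_eq[OF lin, of UNIV] by simp
qed

lemma C2_surface_delete_point:
  assumes "C2_surface M"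
  shows "C2_surface (M - {p})"
  unfolding C2_surface_def
proof
  fix q assume q: "q \<in> M - {p}"
  then obtain U X where c: "C2_chart M U X" "q \<in> X ` U"
    using assms unfolding C2_surface_def by blast
  define U' where "U' = U \<inter> X -` (- {p})"
  obtain Y where Y: "homeomorphism U (X ` U) X Y" using c(1) unfolding C2_chart_def by blast
  have U: "open U" "C2_on U X" "openin (top_of_set M) (X ` U)"
    "\<And>u. u \<in> U \<Longrightarrow> inj (frechet_derivative X (at u))"
    using c(1) unfolding C2_chart_def by blast+
  have "open U'" unfolding U'_def
    using C1_on_continuous[OF chart_C1[OF c(1)]] U(1)
    by (intro continuous_open_preimage) auto
  moreover have "C2_on U' X"
    using U(2) unfolding C2_on_def U'_def by (meson C1_on_subset IntD1 Int_lower1)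
  moreover have im: "X ` U' = X ` U \<inter> (M - {p})"
    unfolding U'_def using chart_in_surface[OF c(1)] by auto
  moreover have "openin (top_of_set (M - {p})) (X ` U')"
    unfolding im using U(3) by (auto simp: openin_open)
  moreover have "homeomorphism U' (X ` U') X Y"
    by (rule homeomorphism_of_subsets[OF Y]) (auto simp: U'_def)
  ultimately have "C2_chart (M - {p}) U' X"
    unfolding C2_chart_def using U(4) by (auto simp: U'_def)
  moreover have "q \<in> X ` U'" using im c(2) q by blast
  ultimately show "\<exists>U X. C2_chart (M - {p}) U X \<and> q \<in> X ` U" by blast
qed

lemma C2_chart_delete_point:
  assumes "C2_chart (M - {p}) U X"
  shows "C2_chart M U X"
proof -
  have "openin (top_of_set M) (M - {p})" by (metis Diff_eq open_Compl closed_singleton openin_open_Int)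
  then show ?thesis using assms openin_trans unfolding C2_chart_def by blast
qed

lemma at_within_delete_point: "q \<noteq> p \<Longrightarrow> at q within (M - {p}) = at (q::real^3) within M"
  by (rule at_within_nhd[of _ "- {p}"]) auto

lemma tangent_space_delete_point:
  assumes "C2_surface M" "q \<in> M" "q \<noteq> p"
  shows "tangent_space (M - {p}) q = tangent_space M q"
proof -
  obtain U X u where c: "C2_chart (M - {p}) U X" "u \<in> U" "q = X u"
    using assms C2_surface_delete_point[OF assms(1), of p] unfolding C2_surface_def by blast
  show ?thesis
    using tangent_space_chart[OF c(1,2)] tangent_space_chart[OF C2_chart_delete_point[OF c(1)] c(2)] c(3)
    by simp
qed

section \<open>Gauss maps, principal directions and umbilics\<close>

lemma unit_normal_cross:
  fixes a t1 t2 :: "real^3"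
  assumes "cross3 t1 t2 \<noteq> 0" "norm a = 1" "a \<bullet> t1 = 0" "a \<bullet> t2 = 0"
  shows "a = sgn (cross3 t1 t2) \<or> a = - sgn (cross3 t1 t2)"
proof -
  have "cross3 a (cross3 t1 t2) = (a \<bullet> t2) *\<^sub>R t1 - (a \<bullet> t1) *\<^sub>R t2"
    by (rule Lagrange)
  then have "collinear {0, a, cross3 t1 t2}" using assms(3,4) by (simp add: cross_eq_0)
  then obtain k where k: "cross3 t1 t2 = k *\<^sub>R a"
    using assms(1,2) by (auto simp: collinear_lemma)
  then have "k \<noteq> 0" using assms(1) by auto
  moreover have "sgn (cross3 t1 t2) = sgn k *\<^sub>R a"
    unfolding k using assms(2) by (simp add: sgn_div_norm sgn_real_def)
  ultimately show ?thesis by (auto simp: sgn_real_def)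
qed

lemma cross_chart_tangents_nonzero:
  assumes "C2_chart M U X" "u \<in> U"
  shows "cross3 (frechet_derivative X (at u) (axis 1 1)) (frechet_derivative X (at u) (axis 2 1)) \<noteq> 0"
proof
  define D where "D = frechet_derivative X (at u)"
  have lin: "linear D" unfolding D_def
    using chart_has_derivative[OF assms] has_derivative_linear by blast
  have inj: "inj D" using assms unfolding C2_chart_def D_def by blast
  have ker: "v = 0" if "D v = 0" for v
    using inj linear_injective_0[OF lin] that by blast
  assume "cross3 (frechet_derivative X (at u) (axis 1 1)) (frechet_derivative X (at u) (axis 2 1)) = 0"
  then have "collinear {0, D (axis 1 1), D (axis 2 1)}" by (simp add: cross_eq_0 D_def)
  moreover have "D (axis 1 1) \<noteq> 0" "D (axis 2 1) \<noteq> 0"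
    using ker by (metis axis_eq_0_iff zero_neq_one)+
  ultimately obtain k where "D (axis 2 1) = k *\<^sub>R D (axis 1 1)"
    by (auto simp: collinear_lemma)
  then have "D (axis 2 1 - k *\<^sub>R axis 1 1) = 0"
    using lin by (simp add: linear_diff linear_scale)
  then have "axis 2 1 - k *\<^sub>R axis 1 1 = (0::real^2)" by (rule ker)
  then have "(axis 2 1 - k *\<^sub>R axis 1 1 :: real^2) $ 2 = 0" by simp
  then show False by (simp add: axis_def)
qed

lemma unit_normal_chart:
  assumes "C2_chart M U X" "u \<in> U" "norm a = 1" "\<And>v. v \<in> tangent_space M (X u) \<Longrightarrow> a \<bullet> v = 0"
  defines "c \<equiv> sgn (cross3 (frechet_derivative X (at u) (axis 1 1)) (frechet_derivative X (at u) (axis 2 1)))"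
  shows "a = c \<or> a = - c"
  unfolding c_def using assms(4) tangent_space_chart[OF assms(1,2)]
  by (intro unit_normal_cross cross_chart_tangents_nonzero[OF assms(1,2)] assms(3)) auto

lemma unit_normals_agree_up_to_sign:
  assumes "C2_surface M" "q \<in> M"
    and "norm a = 1" "\<And>v. v \<in> tangent_space M q \<Longrightarrow> a \<bullet> v = 0"
    and "norm b = 1" "\<And>v. v \<in> tangent_space M q \<Longrightarrow> b \<bullet> v = 0"
  shows "a = b \<or> a = - b"
proof -
  obtain U X u where c: "C2_chart M U X" "u \<in> U" "q = X u"
    using assms(1,2) unfolding C2_surface_def by blast
  show ?thesis
    using unit_normal_chart[OF c(1,2) assms(3)] unit_normal_chart[OF c(1,2) assms(5)] assms(4,6) c(3)
    by force
qed

text \<open>Two unit normals at the same point differ by the sign of their inner product, which varies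
  continuously and is therefore constant near \<open>q\<close>.\<close>

lemma gauss_map_unique_up_to_sign:
  assumes "C2_surface M" "q \<in> M" "gauss_map_near M q N0" "gauss_map_near M q N"
  obtains s W where "s = 1 \<or> s = (-1::real)" "open W" "q \<in> W"
    "\<And>x. x \<in> M \<inter> W \<Longrightarrow> N x = s *\<^sub>R N0 x"
proof -
  obtain W0 where W0: "open W0" "q \<in> W0" "continuous_on (M \<inter> W0) N0"
      "\<And>x. x \<in> M \<inter> W0 \<Longrightarrow> norm (N0 x) = 1 \<and> (\<forall>v\<in>tangent_space M x. N0 x \<bullet> v = 0)"
    using assms(3) unfolding gauss_map_near_def by blast
  obtain W1 where W1: "open W1" "q \<in> W1" "continuous_on (M \<inter> W1) N"
      "\<And>x. x \<in> M \<inter> W1 \<Longrightarrow> norm (N x) = 1 \<and> (\<forall>v\<in>tangent_space M x. N x \<bullet> v = 0)"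
    using assms(4) unfolding gauss_map_near_def by blast
  define A where "A = M \<inter> (W0 \<inter> W1)"
  define g where "g x = N x \<bullet> N0 x" for x
  have N: "N x = g x *\<^sub>R N0 x \<and> (g x = 1 \<or> g x = -1)" if "x \<in> A" for x
  proof -
    have "N x = N0 x \<or> N x = - N0 x" "N0 x \<bullet> N0 x = 1"
      using that W0(4)[of x] W1(4)[of x] unit_normals_agree_up_to_sign[OF assms(1), of x "N x" "N0 x"]
      by (auto simp: A_def dot_square_norm)
    then show ?thesis unfolding g_def by auto
  qed
  have "continuous_on A g" unfolding g_def A_def
    by (intro continuous_on_inner continuous_on_subset[OF W0(3)] continuous_on_subset[OF W1(3)]) auto
  moreover have q: "q \<in> A" unfolding A_def using assms(2) W0(2) W1(2) by blast
  ultimately obtain V where V: "open V" "q \<in> V" "\<And>y. y \<in> A \<Longrightarrow> y \<in> V \<Longrightarrow> g y \<in> ball (g q) 1"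
    unfolding continuous_on_topological by (metis centre_in_ball open_ball zero_less_one)
  show ?thesis
  proof
    show "g q = 1 \<or> g q = -1" using N[OF q] by blast
    show "open (V \<inter> (W0 \<inter> W1))" "q \<in> V \<inter> (W0 \<inter> W1)"
      using V W0 W1 by auto
    show "N x = g q *\<^sub>R N0 x" if "x \<in> M \<inter> (V \<inter> (W0 \<inter> W1))" for x
    proof -
      have "x \<in> A" "x \<in> V" using that by (auto simp: A_def)
      then have "g x = g q" using V(3)[of x] N[of x] N[OF q] by (auto simp: dist_real_def)
      then show ?thesis using N[OF \<open>x \<in> A\<close>] by simp
    qed
  qed
qed

lemma differential_gauss_map:
  assumes "C2_surface M" "q \<in> M" "gauss_map_near M q N0" "gauss_map_near M q N"
    "(N0 has_derivative L) (at q within M)"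
  obtains s where "s = 1 \<or> s = (-1::real)"
    "\<And>v. v \<in> tangent_space M q \<Longrightarrow> shape_operator M N q v = s *\<^sub>R L v"
proof -
  obtain s W where s: "s = 1 \<or> s = (-1::real)" "open W" "q \<in> W"
    "\<And>x. x \<in> M \<inter> W \<Longrightarrow> N x = s *\<^sub>R N0 x"
    using gauss_map_unique_up_to_sign[OF assms(1-4)] by metis
  have "((\<lambda>x. s *\<^sub>R N0 x) has_derivative (\<lambda>v. s *\<^sub>R L v)) (at q within M)"
    using assms(5) by (rule has_derivative_scaleR_right)
  then have "(N has_derivative (\<lambda>v. s *\<^sub>R L v)) (at q within M)"
  proof (rule has_derivative_transform_eventually)
    have "\<forall>\<^sub>F x in at q within M. x \<in> W"
      using s(2,3) by (simp add: eventually_at_topological) blast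
    moreover have "\<forall>\<^sub>F x in at q within M. x \<in> M"
      by (auto simp: eventually_at_filter)
    ultimately show "\<forall>\<^sub>F x in at q within M. s *\<^sub>R N0 x = N x"
      by eventually_elim (use s(4) in auto)
  qed (use s assms(2) in auto)
  then have "shape_operator M N q v = (- s) *\<^sub>R L v" if "v \<in> tangent_space M q" for v
    unfolding shape_operator_def using differential_eq that by force
  then show ?thesis using that[of "- s"] s(1) by auto
qed

text \<open>Since Gauss maps agree up to sign near \<open>q\<close>, principal directions and umbilics can be read off from
  one differentiable Gauss map.\<close>

lemma principal_direction_iff:
  assumes "C2_surface M" "q \<in> M" "gauss_map_near M q N" "(N has_derivative L) (at q within M)"
  shows "principal_direction M q v \<longleftrightarrow>
    v \<in> tangent_space M q \<and> v \<noteq> 0 \<and> (\<exists>k. L v = k *\<^sub>R v)"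
proof
  assume "principal_direction M q v"
  then obtain N' k where v: "v \<in> tangent_space M q" "v \<noteq> 0" and N': "gauss_map_near M q N'"
    and k: "shape_operator M N' q v = k *\<^sub>R v"
    unfolding principal_direction_def by blast
  obtain s where s: "s = 1 \<or> s = (-1::real)"
    "\<And>v. v \<in> tangent_space M q \<Longrightarrow> shape_operator M N' q v = s *\<^sub>R L v"
    using differential_gauss_map[OF assms(1-3) N' assms(4)] by metis
  have "s *\<^sub>R L v = k *\<^sub>R v" using s(2)[OF v(1)] k by simp
  then have "s *\<^sub>R (s *\<^sub>R L v) = s *\<^sub>R (k *\<^sub>R v)" by metis
  then have "L v = (s * k) *\<^sub>R v" using s(1) by auto
  then show "v \<in> tangent_space M q \<and> v \<noteq> 0 \<and> (\<exists>k. L v = k *\<^sub>R v)" using v by blast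
next
  assume v: "v \<in> tangent_space M q \<and> v \<noteq> 0 \<and> (\<exists>k. L v = k *\<^sub>R v)"
  then obtain k where k: "L v = k *\<^sub>R v" by blast
  have "shape_operator M N q v = (- k) *\<^sub>R v"
    unfolding shape_operator_def using differential_eq[OF assms(4)] v k by simp
  then show "principal_direction M q v"
    unfolding principal_direction_def using v assms(2,3) by blast
qed

lemma umbilic_iff:
  assumes "C2_surface M" "q \<in> M" "gauss_map_near M q N" "(N has_derivative L) (at q within M)"
  shows "umbilic M q \<longleftrightarrow> (\<exists>k. \<forall>v\<in>tangent_space M q. L v = k *\<^sub>R v)"
proof
  assume "umbilic M q"
  then obtain N' k e1 e2 where e: "gauss_map_near M q N'"
    "tangent_space M q = span {e1, e2}"
    "shape_operator M N' q e1 = k *\<^sub>R e1" "shape_operator M N' q e2 = k *\<^sub>R e2"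
    unfolding umbilic_def principal_curvatures_def by blast
  obtain s where s: "s = 1 \<or> s = (-1::real)"
    "\<And>v. v \<in> tangent_space M q \<Longrightarrow> shape_operator M N' q v = s *\<^sub>R L v"
    using differential_gauss_map[OF assms(1-3) e(1) assms(4)] by metis
  have L: "linear L" using assms(4) has_derivative_linear by blast
  have eig: "L x = (s * k) *\<^sub>R x" if "x \<in> {e1, e2}" for x
  proof -
    have "x \<in> tangent_space M q" unfolding e(2) using that by (rule span_base)
    then have "s *\<^sub>R L x = k *\<^sub>R x" using s(2)[of x] e(3,4) that by auto
    then have "s *\<^sub>R (s *\<^sub>R L x) = s *\<^sub>R (k *\<^sub>R x)" by metis
    then show ?thesis using s(1) by auto
  qed
  have "L v = (s * k) *\<^sub>R v" if "v \<in> span {e1, e2}" for v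
    by (rule linear_eq_on_span[OF L _ _ that]) (auto simp: eig)
  then show "\<exists>k. \<forall>v\<in>tangent_space M q. L v = k *\<^sub>R v" using e(2) by metis
next
  assume "\<exists>k. \<forall>v\<in>tangent_space M q. L v = k *\<^sub>R v"
  then obtain k where k: "\<And>v. v \<in> tangent_space M q \<Longrightarrow> L v = k *\<^sub>R v" by blast
  obtain B where B: "B \<subseteq> tangent_space M q" "pairwise orthogonal B" "\<And>x. x \<in> B \<Longrightarrow> norm x = 1"
    "card B = dim (tangent_space M q)" "span B = tangent_space M q"
    using orthonormal_basis_subspace[OF tangent_space_subspace(1)[OF assms(1,2)]] by metis
  then obtain e1 e2 where e: "B = {e1, e2}" "e1 \<noteq> e2"
    using tangent_space_subspace(2)[OF assms(1,2)] card_2_iff by metis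
  have S: "shape_operator M N q v = (- k) *\<^sub>R v" if "v \<in> tangent_space M q" for v
    unfolding shape_operator_def using differential_eq[OF assms(4) that] k that by simp
  have "e1 \<in> tangent_space M q" "e2 \<in> tangent_space M q" using B(1) e(1) by auto
  moreover have "e1 \<bullet> e2 = 0" using B(2) e by (auto simp: pairwise_def orthogonal_def)
  ultimately have "principal_curvatures M q (- k) (- k)"
    unfolding principal_curvatures_def using assms(3) S B(3,5) e by blast
  then show "umbilic M q" unfolding umbilic_def using assms(2) by blast
qed

lemma gauss_map_near_delete_point:
  assumes "C2_surface M" "q \<in> M" "q \<noteq> p" "gauss_map_near M q N"
  shows "gauss_map_near (M - {p}) q N"
proof -
  obtain W where W: "open W" "q \<in> W" "continuous_on (M \<inter> W) N"
      "\<forall>x\<in>M \<inter> W. norm (N x) = 1 \<and> (\<forall>v\<in>tangent_space M x. N x \<bullet> v = 0)"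
    using assms(4) unfolding gauss_map_near_def by blast
  have "continuous_on ((M - {p}) \<inter> W) N"
    by (rule continuous_on_subset[OF W(3)]) auto
  then show ?thesis
    unfolding gauss_map_near_def using W tangent_space_delete_point[OF assms(1)]
    by (intro exI[of _ W]) auto
qed

section \<open>The outward normal of a convex surface\<close>

definition supporting_normal :: "'a::euclidean_space set \<Rightarrow> 'a \<Rightarrow> 'a \<Rightarrow> bool" where
  "supporting_normal K y m \<longleftrightarrow> norm m = 1 \<and> (\<forall>z\<in>K. m \<bullet> (z - y) \<le> 0)"

lemma has_vector_derivative_limit:
  assumes "(f has_vector_derivative v) (at (0::real))"
  shows "((\<lambda>t. (f t - f 0) /\<^sub>R t) \<longlongrightarrow> v) (at 0)"
proof -
  have "((\<lambda>t. norm (f (0 + t) - f 0 - t *\<^sub>R v) / norm t) \<longlongrightarrow> 0) (at 0)"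
    using assms unfolding has_vector_derivative_def has_derivative_at by blast
  moreover have "\<forall>\<^sub>F t in at 0. norm (f (0 + t) - f 0 - t *\<^sub>R v) / norm t = norm ((f t - f 0) /\<^sub>R t - v)"
  proof (rule eventually_at_filter[THEN iffD2], rule always_eventually, intro allI impI)
    fix t :: real assume "t \<noteq> 0"
    then have "(f t - f 0) /\<^sub>R t - v = (f (0 + t) - f 0 - t *\<^sub>R v) /\<^sub>R t"
      by (simp add: scaleR_diff_right)
    then show "norm (f (0 + t) - f 0 - t *\<^sub>R v) / norm t = norm ((f t - f 0) /\<^sub>R t - v)"
      by (simp add: divide_inverse mult.commute)
  qed
  ultimately have "((\<lambda>t. norm ((f t - f 0) /\<^sub>R t - v)) \<longlongrightarrow> 0) (at 0)"
    by (rule Lim_transform_eventually)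
  then show ?thesis by (simp add: tendsto_norm_zero_iff LIM_zero_iff)
qed

locale convex_surface =
  fixes K M :: "(real^3) set"
  assumes compact_K: "compact K" and convex_K: "convex K" and interior_K: "interior K \<noteq> {}"
    and M_frontier: "M = frontier K" and M_C2: "C2_surface M"
begin

lemma closed_K: "closed K"
  using compact_K compact_imp_closed by blast

lemma M_subset_K: "M \<subseteq> K"
  unfolding M_frontier using closed_K by (simp add: frontier_subset_closed)

lemma compact_M: "compact M"
  unfolding M_frontier using compact_K compact_frontier by blast

lemma nonempty_K: "K \<noteq> {}"
  using interior_K interior_subset by blast

lemma supporting_normal_in_frontier:
  assumes "y \<in> K" "supporting_normal K y m"
  shows "y \<in> M"
proof (rule ccontr)
  assume "y \<notin> M"
  then have "y \<in> interior K"
    using assms(1) closed_K unfolding M_frontier frontier_def by simp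
  then obtain e where e: "e > 0" "cball y e \<subseteq> K" by (metis mem_interior_cball)
  then have "y + e *\<^sub>R m \<in> K"
    using assms(2) by (auto simp: supporting_normal_def dist_norm)
  then have "m \<bullet> (e *\<^sub>R m) \<le> 0" using assms(2) by (force simp: supporting_normal_def)
  then show False using assms(2) e(1) by (simp add: supporting_normal_def dot_square_norm)
qed

lemma supporting_normal_exists:
  assumes "y \<in> M"
  shows "\<exists>m. supporting_normal K y m"
proof -
  have "y \<in> closure K" "y \<notin> rel_interior K"
    using assms interior_K unfolding M_frontier frontier_def
    by (auto simp: interior_rel_interior_gen rel_interior_nonempty_interior)
  then obtain a where a: "a \<noteq> 0" "\<And>z. z \<in> closure K \<Longrightarrow> a \<bullet> y \<le> a \<bullet> z"
    using supporting_hyperplane_relative_frontier[OF convex_K] by metis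
  have "supporting_normal K y (- sgn a)"
    unfolding supporting_normal_def sgn_div_norm
    using a closure_subset[of K] by (auto simp: inner_diff_right mult_left_mono)
  then show ?thesis by blast
qed

text \<open>The linear function \<open>m\<close> is maximal at \<open>y\<close> along every curve in \<open>M\<close> through \<open>y\<close>.\<close>

lemma supporting_normal_orthogonal:
  assumes "supporting_normal K y m" "v \<in> tangent_space M y"
  shows "m \<bullet> v = 0"
proof -
  obtain \<gamma> \<epsilon> where c: "\<epsilon> > 0" "\<And>t. \<bar>t\<bar> < \<epsilon> \<Longrightarrow> \<gamma> t \<in> M" "\<gamma> 0 = y"
    "(\<gamma> has_vector_derivative v) (at (0::real))"
    using assms(2) unfolding tangent_space_def by blast
  have "((\<lambda>t. m \<bullet> \<gamma> t) has_vector_derivative m \<bullet> v) (at 0)"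
    by (rule bounded_linear.has_vector_derivative[OF bounded_linear_inner_right c(4)])
  then have "DERIV (\<lambda>t. m \<bullet> \<gamma> t) 0 :> m \<bullet> v"
    by (simp add: has_real_derivative_iff_has_vector_derivative)
  moreover have "\<forall>t. \<bar>0 - t\<bar> < \<epsilon> \<longrightarrow> m \<bullet> \<gamma> t \<le> m \<bullet> \<gamma> 0"
    using assms(1) c(2,3) M_subset_K by (force simp: supporting_normal_def inner_diff_right)
  ultimately show ?thesis using DERIV_local_max c(1) by blast
qed

text \<open>The body lies on one side of its tangent plane only, as it has interior points.\<close>

lemma supporting_normal_unique:
  assumes "y \<in> M" "supporting_normal K y m" "supporting_normal K y m'"
  shows "m = m'"
proof -
  have "m = m' \<or> m = - m'"
    using assms supporting_normal_orthogonal
    by (intro unit_normals_agree_up_to_sign[OF M_C2 assms(1)]) (auto simp: supporting_normal_def)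
  moreover have False if "m = - m'"
  proof -
    obtain z where "z \<in> interior K" using interior_K by blast
    then obtain e where e: "e > 0" "cball z e \<subseteq> K" using mem_interior_cball by metis
    have zero: "m \<bullet> (z - y) = 0" if "z \<in> K" for z
      using assms(2,3) that \<open>m = - m'\<close> by (force simp: supporting_normal_def)
    have "z \<in> K" "z + e *\<^sub>R m \<in> K"
      using e assms(2) by (auto simp: supporting_normal_def dist_norm)
    then have "m \<bullet> (e *\<^sub>R m) = 0"
      using zero[of z] zero[of "z + e *\<^sub>R m"] by (simp add: inner_diff_right inner_add_right)
    then show False using assms(2) e(1) by (simp add: supporting_normal_def dot_square_norm)
  qed
  ultimately show ?thesis by blast
qed

definition n :: "real^3 \<Rightarrow> real^3" where
  "n y = (THE m. supporting_normal K y m)"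

lemma n_eqI: "y \<in> M \<Longrightarrow> supporting_normal K y m \<Longrightarrow> n y = m"
  unfolding n_def using supporting_normal_unique by blast

lemma n_supporting: "y \<in> M \<Longrightarrow> supporting_normal K y (n y)"
  using supporting_normal_exists n_eqI by metis

lemma norm_n [simp]: "y \<in> M \<Longrightarrow> norm (n y) = 1"
  using n_supporting supporting_normal_def by blast

lemma n_inner_self [simp]: "y \<in> M \<Longrightarrow> n y \<bullet> n y = 1"
  by (simp add: dot_square_norm)

lemma n_le: "y \<in> M \<Longrightarrow> z \<in> K \<Longrightarrow> n y \<bullet> (z - y) \<le> 0"
  using n_supporting supporting_normal_def by blast

lemma n_orthogonal: "y \<in> M \<Longrightarrow> v \<in> tangent_space M y \<Longrightarrow> n y \<bullet> v = 0"
  using n_supporting supporting_normal_orthogonal by blast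

text \<open>The outward normals form a closed set of pairs, being cut out by the supporting inequalities;
  as the sphere is compact, a map with closed graph into it is continuous.\<close>

lemma continuous_n: "continuous_on M n"
proof (rule continuous_from_closed_graph[of "sphere 0 1"])
  show "compact (sphere (0::real^3) 1)" by simp
  show "n \<in> M \<rightarrow> sphere 0 1" by simp
  have eq: "(\<lambda>x. (x, n x)) ` M = (M \<times> sphere 0 1) \<inter> (\<Inter>z\<in>K. {x. snd x \<bullet> (z - fst x) \<le> 0})"
    (is "?L = ?R")
  proof (rule set_eqI, rule iffI)
    fix x assume "x \<in> ?R"
    then have "fst x \<in> M" "supporting_normal K (fst x) (snd x)"
      by (auto simp: supporting_normal_def)
    then have "x = (fst x, n (fst x))" using n_eqI by (metis prod.collapse)
    then show "x \<in> ?L" using \<open>fst x \<in> M\<close> by blast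
  qed (auto simp: n_le)
  have "closed (\<Inter>z\<in>K. {x::(real^3) \<times> (real^3). snd x \<bullet> (z - fst x) \<le> 0})"
    by (intro closed_INT ballI closed_Collect_le continuous_intros)
  then show "closed ((\<lambda>x. (x, n x)) ` M)"
    unfolding eq
    by (rule closed_Int[OF closed_Times[OF compact_imp_closed[OF compact_M] closed_sphere]])
qed

lemma gauss_map_n: "gauss_map_near M q n"
  unfolding gauss_map_near_def
  by (intro exI[of _ UNIV]) (auto simp: continuous_n n_orthogonal)

text \<open>In a chart the outward normal is plus or minus the normalized cross product of the coordinate
  fields, and the sign is locally constant by continuity.\<close>

lemma C1_n_chart:
  assumes "C2_chart M U X"
  shows "C1_on U (\<lambda>u. n (X u))"
proof (rule C1_on_local)
  fix u assume u: "u \<in> U"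
  define c where "c u = cross3 (frechet_derivative X (at u) (axis 1 1)) (frechet_derivative X (at u) (axis 2 1))" for u
  define \<sigma> where "\<sigma> u = n (X u) \<bullet> sgn (c u)" for u
  have U: "open U" "C2_on U X" using assms unfolding C2_chart_def by blast+
  have c0: "c u \<noteq> 0" if "u \<in> U" for u
    unfolding c_def using cross_chart_tangents_nonzero[OF assms that] .
  have C1c: "C1_on U c" unfolding c_def
    by (intro C1_on_bilinear[OF bilinear_cross[unfolded bilinear_conv_bounded_bilinear]]
        C2_on_frechet_derivative U)
  have C1s: "C1_on U (\<lambda>u. sgn (c u))"
    unfolding sgn_div_norm using c0
    by (intro C1_on_scaleR C1_on_inverse C1_on_norm_inner C1c) auto
  have eq: "n (X u) = \<sigma> u *\<^sub>R sgn (c u) \<and> (\<sigma> u = 1 \<or> \<sigma> u = -1)" if "u \<in> U" for u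
  proof -
    have M: "X u \<in> M" using chart_in_surface[OF assms that] .
    have "n (X u) = sgn (c u) \<or> n (X u) = - sgn (c u)"
      using unit_normal_chart[OF assms that norm_n[OF M]] n_orthogonal[OF M] unfolding c_def by blast
    moreover have "sgn (c u) \<bullet> sgn (c u) = 1" using c0[OF that] by (simp add: dot_square_norm norm_sgn)
    ultimately show ?thesis unfolding \<sigma>_def by auto
  qed
  have "continuous_on U (\<lambda>u. n (X u))"
    by (rule continuous_on_compose2[OF continuous_n C1_on_continuous[OF chart_C1[OF assms]]])
      (use chart_in_surface[OF assms] in blast)
  then have "continuous_on U \<sigma>"
    unfolding \<sigma>_def by (intro continuous_on_inner C1_on_continuous[OF C1s])
  then obtain V where V: "open V" "u \<in> V" "\<And>y. y \<in> U \<Longrightarrow> y \<in> V \<Longrightarrow> \<sigma> y \<in> ball (\<sigma> u) 1"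
    unfolding continuous_on_topological using u by (metis centre_in_ball open_ball zero_less_one)
  have "\<sigma> y = \<sigma> u" if "y \<in> U \<inter> V" for y
    using V(3)[of y] eq[of y] eq[OF u] that by (auto simp: dist_real_def)
  then have eq': "\<sigma> u *\<^sub>R sgn (c y) = n (X y)" if "y \<in> U \<inter> V" for y
    using eq[of y] that by simp
  have "C1_on (U \<inter> V) (\<lambda>y. \<sigma> u *\<^sub>R sgn (c y))"
    using C1_on_subset[OF C1s, of "U \<inter> V"] by (intro C1_on_scaleR C1_on_const) simp
  then have "C1_on (U \<inter> V) (\<lambda>u. n (X u))"
    by (rule C1_on_cong[OF _ open_Int[OF U(1) V(1)] eq'])
  then show "\<exists>V. open V \<and> u \<in> V \<and> C1_on V (\<lambda>u. n (X u))"
    using open_Int[OF U(1) V(1)] V(2) u by blast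
qed

lemma n_differentiable:
  assumes "q \<in> M"
  shows "\<exists>A. (n has_derivative A) (at q within M)"
proof -
  obtain U X u where c: "C2_chart M U X" "u \<in> U" "q = X u"
    using assms M_C2 unfolding C2_surface_def by blast
  show ?thesis
    using has_derivative_within_chart[OF c(1,2) C1_on_has_derivative[OF C1_n_chart[OF c(1)] c(2)]] c(3)
    by metis
qed

text \<open>The two facts express that \<open>n\<close> takes unit values and that, by the supporting inequalities at
  both of two points \<open>x\<close> and \<open>y\<close>, one has \<open>(n x - n y) \<bullet> (x - y) \<ge> 0\<close>: the outward normal of a
  convex surface is a monotone map.\<close>

lemma n_derivative:
  assumes "q \<in> M" "(n has_derivative A) (at q within M)" "v \<in> tangent_space M q"
  shows "n q \<bullet> A v = 0" and "A v \<bullet> v \<ge> 0"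
proof -
  obtain \<gamma> \<epsilon> where c: "\<epsilon> > 0" "\<And>t. \<bar>t\<bar> < \<epsilon> \<Longrightarrow> \<gamma> t \<in> M" "\<gamma> 0 = q"
    "(\<gamma> has_vector_derivative v) (at (0::real))"
    using assms(3) unfolding tangent_space_def by blast
  have d: "((\<lambda>t. n (\<gamma> t)) has_vector_derivative A v) (at 0)"
    using tangent_space_curve[OF assms(2) c] .
  have ev: "\<forall>\<^sub>F t in at 0. \<gamma> t \<in> M"
    unfolding eventually_at using c(1,2) by (intro exI[of _ \<epsilon>]) auto
  have l1: "((\<lambda>t. (n (\<gamma> t) - n q) /\<^sub>R t) \<longlongrightarrow> A v) (at 0)"
    using has_vector_derivative_limit[OF d] c(3) by simp
  have l2: "((\<lambda>t. (\<gamma> t - q) /\<^sub>R t) \<longlongrightarrow> v) (at 0)"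
    using has_vector_derivative_limit[OF c(4)] c(3) by simp
  show "A v \<bullet> v \<ge> 0"
  proof (rule tendsto_lowerbound[OF tendsto_inner[OF l1 l2]])
    show "\<forall>\<^sub>F t in at 0. 0 \<le> ((n (\<gamma> t) - n q) /\<^sub>R t) \<bullet> ((\<gamma> t - q) /\<^sub>R t)"
      using ev
    proof eventually_elim
      case (elim t)
      have "n (\<gamma> t) \<bullet> (q - \<gamma> t) \<le> 0" "n q \<bullet> (\<gamma> t - q) \<le> 0"
        using elim assms(1) M_subset_K by (auto intro!: n_le)
      then have "(n (\<gamma> t) - n q) \<bullet> (\<gamma> t - q) \<ge> 0"
        by (simp add: inner_diff_left inner_diff_right)
      then have "inverse t * inverse t * ((n (\<gamma> t) - n q) \<bullet> (\<gamma> t - q)) \<ge> 0" by simp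
      then show ?case by (simp add: mult.assoc)
    qed
  qed simp
  have "((\<lambda>t. n (\<gamma> t) \<bullet> n (\<gamma> t)) has_derivative (\<lambda>t. n (\<gamma> 0) \<bullet> (t *\<^sub>R A v) + (t *\<^sub>R A v) \<bullet> n (\<gamma> 0))) (at 0)"
    using d unfolding has_vector_derivative_def by (intro has_derivative_inner)
  moreover have "((\<lambda>t. n (\<gamma> t) \<bullet> n (\<gamma> t)) has_derivative (\<lambda>t. 0)) (at 0)"
  proof (rule has_derivative_transform_eventually[OF has_derivative_const[of 1]])
    show "\<forall>\<^sub>F t in at 0. 1 = n (\<gamma> t) \<bullet> n (\<gamma> t)"
      using ev by eventually_elim simp
  qed (use c(3) assms(1) in auto)
  ultimately have "(\<lambda>t::real. n (\<gamma> 0) \<bullet> (t *\<^sub>R A v) + (t *\<^sub>R A v) \<bullet> n (\<gamma> 0)) = (\<lambda>t. 0)"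
    by (rule has_derivative_unique)
  from fun_cong[OF this, of 1] show "n q \<bullet> A v = 0" using c(3) by (simp add: inner_commute)
qed

section \<open>The distance to the convex body\<close>

text \<open>The level set at \<open>t > 0\<close> of the distance is the outer parallel surface, and the projection to the
  closest point inverts \<open>y \<mapsto> y + t n y\<close>.\<close>

definition \<delta> :: "real^3 \<Rightarrow> real" where
  "\<delta> x = norm (x - closest_point K x)"

lemma closest_point_offset:
  assumes "y \<in> M" "t \<ge> 0"
  shows "closest_point K (y + t *\<^sub>R n y) = y" and "\<delta> (y + t *\<^sub>R n y) = t"
proof -
  have "dist (y + t *\<^sub>R n y) y \<le> dist (y + t *\<^sub>R n y) z" if "z \<in> K" for z
  proof -
    have "t = n y \<bullet> (t *\<^sub>R n y)" using assms(1) by simp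
    also have "\<dots> \<le> n y \<bullet> (y + t *\<^sub>R n y - z)"
      using n_le[OF assms(1) that] by (simp add: inner_diff_right inner_add_right)
    also have "\<dots> \<le> norm (y + t *\<^sub>R n y - z)"
      using norm_cauchy_schwarz[of "n y" "y + t *\<^sub>R n y - z"] assms(1) by simp
    finally show ?thesis using assms by (simp add: dist_norm)
  qed
  then show cp: "closest_point K (y + t *\<^sub>R n y) = y"
    using closest_point_unique[OF convex_K closed_K, of y] assms(1) M_subset_K by force
  show "\<delta> (y + t *\<^sub>R n y) = t" unfolding \<delta>_def cp using assms by simp
qed

lemma offset_closest_point:
  assumes "\<delta> x = t" "t > 0"
  shows "closest_point K x \<in> M" and "x = closest_point K x + t *\<^sub>R n (closest_point K x)"
proof -
  define y where "y = closest_point K x"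
  have yK: "y \<in> K" unfolding y_def using closed_K nonempty_K closest_point_in_set by blast
  have "supporting_normal K y ((x - y) /\<^sub>R t)"
    unfolding supporting_normal_def
    using assms closest_point_dot[OF convex_K closed_K, of _ x]
    by (auto simp: y_def[symmetric] \<delta>_def mult_nonneg_nonpos)
  moreover from this show "closest_point K x \<in> M"
    using supporting_normal_in_frontier yK y_def by blast
  ultimately have "n y = (x - y) /\<^sub>R t" using n_eqI y_def by blast
  then show "x = closest_point K x + t *\<^sub>R n (closest_point K x)"
    using assms(2) y_def by simp
qed

text \<open>The body lies in the half space that supports it at \<open>y\<close>.\<close>

lemma \<delta>_lower:
  assumes "y \<in> M"
  shows "n y \<bullet> (z - y) \<le> \<delta> z"
proof -
  have "n y \<bullet> (z - y) = n y \<bullet> (z - closest_point K z) + n y \<bullet> (closest_point K z - y)"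
    by (simp add: inner_diff_right)
  also have "\<dots> \<le> n y \<bullet> (z - closest_point K z)"
    using n_le[OF assms] closest_point_in_set[OF closed_K nonempty_K] by simp
  also have "\<dots> \<le> \<delta> z"
    unfolding \<delta>_def using norm_cauchy_schwarz[of "n y" "z - closest_point K z"] assms by simp
  finally show ?thesis .
qed

text \<open>Near an exterior point \<open>x\<close> the distance is squeezed between the distance to the supporting
  half space at the closest point and the distance to the closest point itself; both have
  gradient \<open>n\<close> at \<open>x\<close>.\<close>

lemma \<delta>_has_derivative:
  assumes "\<delta> x = t" "t > 0"
  shows "(\<delta> has_derivative (\<lambda>h. n (closest_point K x) \<bullet> h)) (at x)"
proof -
  define y where "y = closest_point K x"
  have y: "y \<in> M" "x = y + t *\<^sub>R n y"
    using offset_closest_point[OF assms] unfolding y_def by blast+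
  have up: "\<delta> z \<le> norm (z - y)" for z
    unfolding \<delta>_def using closest_point_le[OF closed_K, of y z] y(1) M_subset_K by (auto simp: dist_norm)
  have xy: "x - y = t *\<^sub>R n y" using y(2) by (simp add: algebra_simps)
  have "x - y \<noteq> 0" using xy assms(2) y(1) by (metis norm_n norm_zero scaleR_eq_0_iff less_irrefl zero_neq_one)
  then have "((\<lambda>z. norm (z - y)) has_derivative (\<lambda>h. h \<bullet> sgn (x - y))) (at x)"
    by (intro has_derivative_compose[where g = norm and f = "\<lambda>z. z - y" and f' = "\<lambda>h. h", simplified]
        has_derivative_norm) (auto intro!: derivative_eq_intros)
  moreover have "sgn (x - y) = n y"
    unfolding xy using assms(2) y(1) by (simp add: sgn_scaleR sgn_div_norm)
  ultimately have d: "((\<lambda>z. norm (z - y)) has_derivative (\<lambda>h. n y \<bullet> h)) (at x)"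
    by (simp add: inner_commute)
  have tx: "norm (x - y) = t" unfolding xy using assms(2) y(1) by simp
  have lim0: "((\<lambda>h. norm (norm (x + h - y) - norm (x - y) - n y \<bullet> h) / norm h) \<longlongrightarrow> 0) (at 0)"
    using d unfolding has_derivative_at by blast
  have le: "norm (norm (\<delta> (x + h) - \<delta> x - n y \<bullet> h) / norm h)
      \<le> norm (norm (x + h - y) - norm (x - y) - n y \<bullet> h) / norm h" for h
  proof -
    have "n y \<bullet> (x + h - y) = t + n y \<bullet> h"
    proof -
      have "n y \<bullet> (x + h - y) = n y \<bullet> (x - y) + n y \<bullet> h" by (simp add: inner_diff_right inner_add_right)
      then show ?thesis unfolding xy using y(1) by simp
    qed
    then have "\<bar>\<delta> (x + h) - \<delta> x - n y \<bullet> h\<bar> \<le> \<bar>norm (x + h - y) - norm (x - y) - n y \<bullet> h\<bar>"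
      using up[of "x + h"] \<delta>_lower[OF y(1), of "x + h"] tx assms(1) by linarith
    then show ?thesis by (simp add: divide_right_mono)
  qed
  have "((\<lambda>h. norm (\<delta> (x + h) - \<delta> x - n y \<bullet> h) / norm h) \<longlongrightarrow> 0) (at 0)"
    by (rule Lim_null_comparison[OF always_eventually lim0]) (intro allI le)
  then show ?thesis
    unfolding has_derivative_at y_def[symmetric] using bounded_linear_inner_right by blast
qed

lemma continuous_\<delta>: "continuous_on UNIV \<delta>"
  unfolding \<delta>_def
  by (intro continuous_intros continuous_on_closest_point convex_K closed_K nonempty_K)

end

section \<open>The second order expansion at an umbilic\<close>

lemma C1_on_local_bound:
  assumes "C1_on U f" "open U" "x0 \<in> U"
  obtains C e where "C > 0" "e > 0" "ball x0 e \<subseteq> U"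
    "\<And>x v. x \<in> ball x0 e \<Longrightarrow> norm (frechet_derivative f (at x) v) \<le> C * norm v"
    "\<And>x. x \<in> ball x0 e \<Longrightarrow> norm (f x - f x0) \<le> C * norm (x - x0)"
proof -
  obtain f' where f': "\<And>x. x \<in> U \<Longrightarrow> (f has_derivative blinfun_apply (f' x)) (at x)"
    and c: "continuous_on U f'"
    using assms(1) unfolding C1_on_def by blast
  define C where "C = norm (f' x0) + 1"
  have "isCont f' x0" using c assms(2,3) continuous_on_eq_continuous_at by blast
  then have "\<forall>\<^sub>F x in nhds x0. norm (f' x) < C"
    unfolding C_def using order_tendstoD(2)[of "\<lambda>x. norm (f' x)" "norm (f' x0)" "nhds x0"]
    by (simp add: tendsto_norm continuous_at_imp_continuous_at_within isCont_def tendsto_at_iff_tendsto_nhds)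
  moreover have "\<forall>\<^sub>F x in nhds x0. x \<in> U" using assms(2,3) by (simp add: eventually_nhds_in_open)
  ultimately have "\<forall>\<^sub>F x in nhds x0. x \<in> U \<and> norm (f' x) < C" by eventually_elim simp
  then obtain e where e: "e > 0" "\<And>x. dist x x0 < e \<Longrightarrow> x \<in> U \<and> norm (f' x) < C"
    unfolding eventually_nhds_metric by blast
  have b: "x \<in> U" "norm (f' x) \<le> C" if "x \<in> ball x0 e" for x
    using e(2)[of x] that by (auto simp: dist_commute)
  show ?thesis
  proof (rule that[of C e])
    show "C > 0" unfolding C_def by (simp add: add_nonneg_pos)
    show "e > 0" "ball x0 e \<subseteq> U" using e(1) b(1) by auto
    show "norm (frechet_derivative f (at x) v) \<le> C * norm v" if x: "x \<in> ball x0 e" for x v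
    proof -
      have "frechet_derivative f (at x) = blinfun_apply (f' x)"
        using frechet_derivative_at[OF f'[OF b(1)[OF x]]] by simp
      then have "norm (frechet_derivative f (at x) v) \<le> norm (f' x) * norm v"
        using norm_blinfun[of "f' x" v] by simp
      also have "\<dots> \<le> C * norm v" using b(2)[OF x] by (rule mult_right_mono) simp
      finally show ?thesis .
    qed
    show "norm (f x - f x0) \<le> C * norm (x - x0)" if x: "x \<in> ball x0 e" for x
    proof (rule differentiable_bound[OF convex_ball[of x0 e], where f' = "\<lambda>x. blinfun_apply (f' x)"])
      show "onorm (blinfun_apply (f' x)) \<le> C" if "x \<in> ball x0 e" for x
        using b(2)[OF that] by (simp add: norm_blinfun.rep_eq)
      show "(f has_derivative blinfun_apply (f' x)) (at x within ball x0 e)" if "x \<in> ball x0 e" for x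
        using f'[OF b(1)[OF that]] by (rule has_derivative_at_withinI)
    qed (use x e(1) in auto)
  qed
qed

context convex_surface
begin

text \<open>At an umbilic the principal curvatures are both \<open>k\<close> (measured with the outward normal and
  the sign for which a sphere has \<open>k > 0\<close>), so \<open>n\<close> agrees to first order with \<open>k\<close> times the position
  vector, along \<open>M\<close>.\<close>

lemma umbilic_normal_expansion:
  assumes "umbilic M p"
  obtains k where "k \<ge> 0" "((\<lambda>y. n y - k *\<^sub>R y) has_derivative (\<lambda>_. 0)) (at p within M)"
proof -
  have p: "p \<in> M" using assms umbilic_def by blast
  obtain A where A: "(n has_derivative A) (at p within M)" using n_differentiable[OF p] by blast
  obtain k where k: "\<And>v. v \<in> tangent_space M p \<Longrightarrow> A v = k *\<^sub>R v"
    using umbilic_iff[OF M_C2 p gauss_map_n A] assms by blast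
  have "\<not> tangent_space M p \<subseteq> {0}"
    using tangent_space_subspace(2)[OF M_C2 p] dim_eq_0 by (metis zero_neq_numeral)
  then obtain v where v: "v \<in> tangent_space M p" "v \<noteq> 0" by blast
  have "k * (v \<bullet> v) \<ge> 0" using n_derivative(2)[OF p A v(1)] k[OF v(1)] by simp
  then have k0: "k \<ge> 0" using v(2) by (metis inner_gt_zero_iff mult.commute zero_le_mult_iff not_le)
  obtain U X u where c: "C2_chart M U X" "u \<in> U" "p = X u"
    using p M_C2 unfolding C2_surface_def by blast
  define D where "D = frechet_derivative X (at u)"
  have X: "(X has_derivative D) (at u)" unfolding D_def using chart_has_derivative[OF c(1,2)] .
  obtain B where B: "((\<lambda>u. n (X u)) has_derivative B) (at u)"
    using C1_on_has_derivative[OF C1_n_chart[OF c(1)] c(2)] by blast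
  obtain R where R: "\<And>v. R (D v) = v" "(n has_derivative (\<lambda>v. B (R v))) (at p within M)"
    using has_derivative_within_chart[OF c(1,2) B] c(3) D_def by metis
  have "B v = k *\<^sub>R D v" for v
  proof -
    have T: "D v \<in> tangent_space M p" unfolding c(3) D_def tangent_space_chart[OF c(1,2)] by blast
    have "B v = B (R (D v))" by (simp add: R(1))
    also have "\<dots> = A (D v)" by (rule has_derivative_tangent_unique[OF R(2) A T])
    finally show ?thesis using k[OF T] by simp
  qed
  then have "((\<lambda>u. n (X u) - k *\<^sub>R X u) has_derivative (\<lambda>_. 0)) (at u)"
    using has_derivative_diff[OF B has_derivative_scaleR_right[OF X, of k]] by simp
  then have "((\<lambda>y. n y - k *\<^sub>R y) has_derivative (\<lambda>_. 0)) (at p within M)"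
    unfolding c(3) using has_derivative_within_chart[OF c(1,2), of "\<lambda>y. n y - k *\<^sub>R y" "\<lambda>_. 0"] by metis
  then show ?thesis using that k0 by blast
qed

text \<open>Integrating the expansion of the normal gives that of the height. In a chart \<open>X\<close> with
  \<open>X u0 = p\<close>, the function \<open>n p \<bullet> (X u - p) + k/2 \<parallel>X u - p\<parallel>\<^sup>2\<close> has derivative
  \<open>v \<mapsto> (n p + k (X u - p) - n (X u)) \<bullet> DX v\<close>, because \<open>n (X u)\<close> is normal to \<open>DX v\<close>. Hence its
  derivative is \<open>o(\<parallel>u - u0\<parallel>)\<close>, and the mean value inequality applies.\<close>

lemma umbilic_height_expansion:
  assumes "p \<in> M" "((\<lambda>y. n y - k *\<^sub>R y) has_derivative (\<lambda>_. 0)) (at p within M)"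
  shows "((\<lambda>y. (n p \<bullet> (y - p) + k / 2 * (norm (y - p))\<^sup>2) / (norm (y - p))\<^sup>2) \<longlongrightarrow> 0) (at p within M)"
proof (rule tendstoI)
  fix \<epsilon> :: real assume \<epsilon>: "\<epsilon> > 0"
  obtain U X u0 where c: "C2_chart M U X" "u0 \<in> U" "p = X u0"
    using assms(1) M_C2 unfolding C2_surface_def by blast
  have U: "open U" using c(1) C2_chart_def by blast
  obtain C e where C: "C > 0" "e > 0" "ball u0 e \<subseteq> U"
    "\<And>u v. u \<in> ball u0 e \<Longrightarrow> norm (frechet_derivative X (at u) v) \<le> C * norm v"
    "\<And>u. u \<in> ball u0 e \<Longrightarrow> norm (X u - X u0) \<le> C * norm (u - u0)"
    using C1_on_local_bound[OF chart_C1[OF c(1)] U c(2)] by metis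
  obtain W \<rho> where W: "open W" "X u0 \<in> W" "C1_on W \<rho>"
    "\<And>x. x \<in> M \<inter> W \<Longrightarrow> \<rho> x \<in> U \<and> X (\<rho> x) = x" "\<rho> (X u0) = u0"
    using chart_retraction[OF c(1,2)] by metis
  obtain C' e' where C': "C' > 0" "e' > 0" "ball p e' \<subseteq> W"
    "\<And>y. y \<in> ball p e' \<Longrightarrow> norm (\<rho> y - \<rho> p) \<le> C' * norm (y - p)"
    using C1_on_local_bound[OF W(3,1,2)] c(3) by metis
  \<comment> \<open>The constants \<open>C\<close> and \<open>C'\<close> compare \<open>\<parallel>X u - p\<parallel>\<close> with \<open>\<parallel>u - u0\<parallel>\<close> in both directions; each enters
    twice in a bound that is quadratic in the distance.\<close>
  define \<eta> where "\<eta> = \<epsilon> / 2 / (C\<^sup>2 * C'\<^sup>2)"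
  have \<eta>: "\<eta> > 0" "\<eta> * C\<^sup>2 * C'\<^sup>2 = \<epsilon> / 2" unfolding \<eta>_def using \<epsilon> C(1) C'(1) by auto
  obtain d where d: "d > 0"
    "\<And>y. y \<in> M \<Longrightarrow> norm (y - p) < d \<Longrightarrow> norm (n y - n p - k *\<^sub>R (y - p)) \<le> \<eta> * norm (y - p)"
  proof -
    have "\<exists>d>0. \<forall>y\<in>M. norm (y - p) < d \<longrightarrow>
        norm ((n y - k *\<^sub>R y) - (n p - k *\<^sub>R p) - 0) \<le> \<eta> * norm (y - p)"
      using assms(2) \<eta>(1) unfolding has_derivative_within_alt by blast
    moreover have "(n y - k *\<^sub>R y) - (n p - k *\<^sub>R p) - 0 = n y - n p - k *\<^sub>R (y - p)" for y
      by (simp add: algebra_simps)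
    ultimately show ?thesis using that by metis
  qed
  define G where "G u = n p \<bullet> (X u - p) + k / 2 * ((X u - p) \<bullet> (X u - p))" for u
  define r where "r = min e (d / C)"
  have r: "r > 0" "r \<le> e" "C * r \<le> d"
    unfolding r_def using C(1,2) d(1) by (auto simp: min_def field_simps)
  have G: "(G has_derivative (\<lambda>v. (n p + k *\<^sub>R (X u - p) - n (X u)) \<bullet> frechet_derivative X (at u) v)) (at u)"
    if "u \<in> ball u0 e" for u
  proof -
    have uU: "u \<in> U" using that C(3) by blast
    note X = chart_has_derivative[OF c(1) uU]
    have "(G has_derivative (\<lambda>v. n p \<bullet> frechet_derivative X (at u) v + k / 2 *
       ((X u - p) \<bullet> frechet_derivative X (at u) v + frechet_derivative X (at u) v \<bullet> (X u - p)))) (at u)"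
      unfolding G_def by (auto intro!: derivative_eq_intros X)
    moreover have "n (X u) \<bullet> frechet_derivative X (at u) v = 0" for v
      using n_orthogonal[OF chart_in_surface[OF c(1) uU]] tangent_space_chart[OF c(1) uU] by blast
    then have "n p \<bullet> frechet_derivative X (at u) v + k / 2 *
       ((X u - p) \<bullet> frechet_derivative X (at u) v + frechet_derivative X (at u) v \<bullet> (X u - p))
      = (n p + k *\<^sub>R (X u - p) - n (X u)) \<bullet> frechet_derivative X (at u) v" for v
      by (simp add: inner_add_left inner_diff_left inner_commute[of "frechet_derivative X (at u) v"])
    ultimately show ?thesis by simp
  qed
  have main: "\<bar>G u1\<bar> \<le> \<eta> * C\<^sup>2 * (norm (u1 - u0))\<^sup>2" if u1: "u1 \<in> ball u0 r" for u1
  proof -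
    define s where "s = norm (u1 - u0)"
    have s: "s < r" using u1 by (simp add: s_def dist_norm norm_minus_commute)
    have in_ball: "u \<in> ball u0 e" "norm (u - u0) \<le> s" if "u \<in> cball u0 s" for u
      using that s r(2) by (auto simp: dist_norm norm_minus_commute)
    have "norm (G u1 - G u0) \<le> (\<eta> * C\<^sup>2 * s) * norm (u1 - u0)"
    proof (rule differentiable_bound[OF convex_cball[of u0 s]])
      fix u assume u: "u \<in> cball u0 s"
      show "(G has_derivative (\<lambda>v. (n p + k *\<^sub>R (X u - p) - n (X u)) \<bullet> frechet_derivative X (at u) v)) (at u within cball u0 s)"
        using G[OF in_ball(1)[OF u]] has_derivative_at_withinI by blast
      have XM: "X u \<in> M" using chart_in_surface[OF c(1)] C(3) in_ball(1)[OF u] by blast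
      have Xs: "norm (X u - p) \<le> C * s"
        unfolding c(3)
        using C(5)[OF in_ball(1)[OF u]] mult_left_mono[OF in_ball(2)[OF u], of C] C(1) by linarith
      also have "\<dots> < C * r" using s C(1) by simp
      finally have Xd: "norm (X u - p) < d" using r(3) by linarith
      show "onorm (\<lambda>v. (n p + k *\<^sub>R (X u - p) - n (X u)) \<bullet> frechet_derivative X (at u) v) \<le> \<eta> * C\<^sup>2 * s"
      proof (rule onorm_bound)
        show "0 \<le> \<eta> * C\<^sup>2 * s" using \<eta>(1) by (simp add: s_def)
        fix v
        have "norm (n p + k *\<^sub>R (X u - p) - n (X u)) = norm (n (X u) - n p - k *\<^sub>R (X u - p))"
          using norm_minus_cancel[of "n (X u) - n p - k *\<^sub>R (X u - p)"] by (simp add: algebra_simps)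
        also have "\<dots> \<le> \<eta> * norm (X u - p)" by (rule d(2)[OF XM Xd])
        also have "\<dots> \<le> \<eta> * (C * s)" using Xs \<eta>(1) by simp
        finally have "norm (n p + k *\<^sub>R (X u - p) - n (X u)) \<le> \<eta> * (C * s)" .
        then have "norm (n p + k *\<^sub>R (X u - p) - n (X u)) * norm (frechet_derivative X (at u) v)
            \<le> (\<eta> * (C * s)) * (C * norm v)"
          by (rule mult_mono[OF _ C(4)[OF in_ball(1)[OF u]]]) (use \<eta>(1) C(1) in \<open>auto simp: s_def\<close>)
        also have "\<dots> = \<eta> * C\<^sup>2 * s * norm v" by (simp add: power2_eq_square)
        finally show "norm ((n p + k *\<^sub>R (X u - p) - n (X u)) \<bullet> frechet_derivative X (at u) v) \<le> \<eta> * C\<^sup>2 * s * norm v"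
          using Cauchy_Schwarz_ineq2[of "n p + k *\<^sub>R (X u - p) - n (X u)" "frechet_derivative X (at u) v"]
          by simp
      qed
    qed (auto simp: s_def dist_norm norm_minus_commute)
    moreover have "G u0 = 0" unfolding G_def c(3) by simp
    ultimately show ?thesis by (simp add: s_def power2_eq_square)
  qed
  define d' where "d' = min e' (r / C')"
  have d': "d' > 0" "d' \<le> e'" "C' * d' \<le> r"
    unfolding d'_def using C'(1,2) r(1) by (auto simp: min_def field_simps)
  have "dist ((n p \<bullet> (y - p) + k / 2 * (norm (y - p))\<^sup>2) / (norm (y - p))\<^sup>2) 0 < \<epsilon>"
    if y: "y \<in> M" "y \<noteq> p" "dist y p < d'" for y
  proof -
    have yb: "y \<in> ball p e'" using y(3) d'(2) by (simp add: dist_commute)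
    then have yW: "y \<in> M \<inter> W" using C'(3) y(1) by blast
    have \<rho>: "norm (\<rho> y - u0) \<le> C' * norm (y - p)" using C'(4)[OF yb] W(5) c(3) by simp
    also have "\<dots> < C' * d'" using y(3) C'(1) by (simp add: dist_norm)
    finally have "\<rho> y \<in> ball u0 r" using d'(3) by (simp add: dist_norm norm_minus_commute)
    from main[OF this] have "\<bar>G (\<rho> y)\<bar> \<le> \<eta> * C\<^sup>2 * (norm (\<rho> y - u0))\<^sup>2" .
    also have "\<dots> \<le> \<eta> * C\<^sup>2 * (C' * norm (y - p))\<^sup>2"
      using \<rho> \<eta>(1) by (intro mult_left_mono power_mono) auto
    also have "\<dots> = \<epsilon> / 2 * (norm (y - p))\<^sup>2" using \<eta>(2) by (simp add: power_mult_distrib mult.assoc[symmetric])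
    finally have "\<bar>n p \<bullet> (y - p) + k / 2 * (norm (y - p))\<^sup>2\<bar> \<le> \<epsilon> / 2 * (norm (y - p))\<^sup>2"
      using W(4)[OF yW] by (simp add: G_def power2_norm_eq_inner)
    moreover have "(norm (y - p))\<^sup>2 > 0" using y(2) by simp
    ultimately have "\<bar>(n p \<bullet> (y - p) + k / 2 * (norm (y - p))\<^sup>2)\<bar> / (norm (y - p))\<^sup>2 \<le> \<epsilon> / 2"
      by (simp add: pos_divide_le_eq)
    moreover have "dist ((n p \<bullet> (y - p) + k / 2 * (norm (y - p))\<^sup>2) / (norm (y - p))\<^sup>2) 0
        = \<bar>(n p \<bullet> (y - p) + k / 2 * (norm (y - p))\<^sup>2)\<bar> / (norm (y - p))\<^sup>2"
      by (simp only: dist_real_def diff_zero abs_divide abs_of_nonneg[OF zero_le_power2])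
    ultimately show ?thesis using \<epsilon> by linarith
  qed
  then show "\<forall>\<^sub>F y in at p within M. dist ((n p \<bullet> (y - p) + k / 2 * (norm (y - p))\<^sup>2) / (norm (y - p))\<^sup>2) 0 < \<epsilon>"
    unfolding eventually_at using d'(1) by blast
qed

end

section \<open>Inversion in the unit sphere\<close>

definition inversion :: "'a::real_inner \<Rightarrow> 'a" where
  "inversion x = x /\<^sub>R (x \<bullet> x)"

text \<open>The reflection in the hyperplane orthogonal to \<open>x\<close>, which is the differential of the inversion at
  \<open>x\<close> up to the factor \<open>1 / \<parallel>x\<parallel>\<^sup>2\<close>.\<close>

definition reflect :: "'a::real_inner \<Rightarrow> 'a \<Rightarrow> 'a" where
  "reflect x v = v - (2 * (v \<bullet> x) / (x \<bullet> x)) *\<^sub>R x"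

lemma inversion_inner_self: "inversion x \<bullet> inversion x = inverse (x \<bullet> x)"
  unfolding inversion_def by (cases "x = 0") simp_all

lemma inversion_inversion [simp]: "inversion (inversion x) = x"
  by (cases "x = 0") (simp_all add: inversion_def)

lemma norm_inversion: "norm (inversion x) = inverse (norm x)"
  using inversion_inner_self[of x] by (simp add: norm_eq_sqrt_inner real_sqrt_inverse)

lemma bounded_linear_reflect: "bounded_linear (reflect x)"
  unfolding reflect_def divide_inverse
  by (auto intro!: bounded_linear_intros bounded_linear_sub bounded_linear_ident
      bounded_linear_scaleR_left[THEN bounded_linear_compose] bounded_linear_inner_left
      bounded_linear_mult_right[THEN bounded_linear_compose] bounded_linear_mult_left[THEN bounded_linear_compose])

lemma reflect_inner_reflect [simp]: "reflect x v \<bullet> reflect x w = v \<bullet> w"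
proof (cases "x = 0")
  case False
  then show ?thesis unfolding reflect_def
    by (simp add: inner_diff_left inner_diff_right inner_commute field_simps)
qed (simp add: reflect_def)

lemma reflect_inner_commute: "reflect x v \<bullet> w = v \<bullet> reflect x w"
  unfolding reflect_def by (simp add: inner_diff_left inner_diff_right inner_commute)

lemma norm_reflect [simp]: "norm (reflect x v) = norm v"
  by (simp add: norm_eq_sqrt_inner)

lemma reflect_eq_0_iff [simp]: "reflect x v = 0 \<longleftrightarrow> v = 0"
  by (metis norm_eq_zero norm_reflect)

lemma reflect_scaleR_left: "c \<noteq> 0 \<Longrightarrow> reflect (c *\<^sub>R x) v = reflect x v"
  unfolding reflect_def by (cases "x = 0") (simp_all add: field_simps)

lemma reflect_inversion: "reflect (inversion x) v = reflect x v"
  by (cases "x = 0") (simp_all add: inversion_def reflect_scaleR_left)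

lemma has_derivative_inversion:
  assumes "x \<noteq> 0"
  shows "(inversion has_derivative (\<lambda>v. reflect x v /\<^sub>R (x \<bullet> x))) (at x)"
proof -
  have "((\<lambda>x. x /\<^sub>R (x \<bullet> x)) has_derivative
     (\<lambda>v. inverse (x \<bullet> x) *\<^sub>R v + (- (inverse (x \<bullet> x) * (x \<bullet> v + v \<bullet> x) * inverse (x \<bullet> x))) *\<^sub>R x)) (at x)"
    using assms by (auto intro!: derivative_eq_intros)
  moreover have "inverse (x \<bullet> x) *\<^sub>R v + (- (inverse (x \<bullet> x) * (x \<bullet> v + v \<bullet> x) * inverse (x \<bullet> x))) *\<^sub>R x
      = reflect x v /\<^sub>R (x \<bullet> x)" for v
    unfolding reflect_def by (simp add: scaleR_diff_right inner_commute divide_inverse)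
  ultimately show ?thesis unfolding inversion_def by simp
qed

text \<open>This is why an inversion preserves principal directions. If \<open>m\<close> is a unit normal along the
  surface parametrized by \<open>x\<close>, then \<open>reflect x m\<close> is a normal of the inverted surface, and its
  derivative is the reflection of \<open>m'\<close> up to a multiple of the reflection of \<open>x'\<close>.\<close>

lemma has_derivative_reflect:
  assumes "(x has_derivative x') (at q within S)" "(m has_derivative m') (at q within S)" "x q \<noteq> 0"
  obtains D where "((\<lambda>y. reflect (x y) (m y)) has_derivative D) (at q within S)"
    "\<And>v. m q \<bullet> x' v = 0 \<Longrightarrow> D v = reflect (x q) (m' v - (2 * (m q \<bullet> x q) / (x q \<bullet> x q)) *\<^sub>R x' v)"
proof -
  define s where "s v = 2 * (m q \<bullet> x' v + m' v \<bullet> x q) * inverse (x q \<bullet> x q)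
     + (2 * (m q \<bullet> x q)) * - (inverse (x q \<bullet> x q) * (x q \<bullet> x' v + x' v \<bullet> x q) * inverse (x q \<bullet> x q))" for v
  have s: "((\<lambda>y. 2 * (m y \<bullet> x y) * inverse (x y \<bullet> x y)) has_derivative s) (at q within S)"
    unfolding s_def using assms(3)
    by (auto intro!: derivative_eq_intros assms(1,2) simp: algebra_simps)
  have "((\<lambda>y. m y - (2 * (m y \<bullet> x y) * inverse (x y \<bullet> x y)) *\<^sub>R x y) has_derivative
      (\<lambda>v. m' v - ((2 * (m q \<bullet> x q) * inverse (x q \<bullet> x q)) *\<^sub>R x' v + s v *\<^sub>R x q))) (at q within S)"
    by (intro has_derivative_diff has_derivative_scaleR s assms(1,2))
  then have "((\<lambda>y. reflect (x y) (m y)) has_derivative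
      (\<lambda>v. m' v - ((2 * (m q \<bullet> x q) * inverse (x q \<bullet> x q)) *\<^sub>R x' v + s v *\<^sub>R x q))) (at q within S)"
    unfolding reflect_def divide_inverse .
  then show ?thesis
  proof (rule that)
    fix v assume "m q \<bullet> x' v = 0"
    then show "m' v - ((2 * (m q \<bullet> x q) * inverse (x q \<bullet> x q)) *\<^sub>R x' v + s v *\<^sub>R x q)
        = reflect (x q) (m' v - (2 * (m q \<bullet> x q) / (x q \<bullet> x q)) *\<^sub>R x' v)"
      unfolding reflect_def s_def using assms(3)
      by (simp add: inner_diff_left divide_inverse algebra_simps inner_commute)
  qed
qed

lemma C1_on_inversion:
  fixes x :: "'a::euclidean_space \<Rightarrow> 'b::euclidean_space"
  assumes "C1_on U x" "\<And>u. u \<in> U \<Longrightarrow> x u \<noteq> 0"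
  shows "C1_on U (\<lambda>u. inversion (x u))"
  unfolding inversion_def using assms by (intro C1_on_scaleR C1_on_inverse C1_on_inner) auto

lemma C1_on_reflect:
  fixes x m :: "'a::euclidean_space \<Rightarrow> 'b::euclidean_space"
  assumes "C1_on U x" "C1_on U m" "\<And>u. u \<in> U \<Longrightarrow> x u \<noteq> 0"
  shows "C1_on U (\<lambda>u. reflect (x u) (m u))"
  unfolding reflect_def divide_inverse using assms
  by (intro C1_on_diff C1_on_scaleR C1_on_inverse C1_on_inner C1_on_const
      C1_on_bilinear[OF bounded_bilinear_mult]) auto

section \<open>The graph obtained by inverting an outer parallel surface\<close>

text \<open>Two consecutive downward crossings would need an upward one in between: the first point after \<open>a\<close>
  at which \<open>g\<close> is nonnegative again.\<close>

lemma decreasing_zeros_unique: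
  fixes g :: "real \<Rightarrow> real"
  assumes "a < b" "continuous_on {a..b} g" "g a = 0" "g b = 0"
    and D: "\<And>s. s \<in> {a..b} \<Longrightarrow> g s = 0 \<Longrightarrow> \<exists>d<0. (g has_real_derivative d) (at s)"
  shows False
proof -
  obtain d1 where "(g has_real_derivative d1) (at a)" "d1 < 0"
    using D[of a] assms(1,3) by auto
  then obtain e1 where e1: "e1 > 0" "\<And>h. 0 < h \<Longrightarrow> h < e1 \<Longrightarrow> g (a + h) < 0"
    using DERIV_neg_dec_right assms(3) by metis
  obtain d2 where "(g has_real_derivative d2) (at b)" "d2 < 0"
    using D[of b] assms(1,4) by auto
  then obtain e2 where e2: "e2 > 0" "\<And>h. 0 < h \<Longrightarrow> h < e2 \<Longrightarrow> 0 < g (b - h)"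
    using DERIV_neg_dec_left assms(4) by metis
  define a' b' where "a' = a + min (e1 / 2) ((b - a) / 3)" and "b' = b - min (e2 / 2) ((b - a) / 3)"
  have ab: "a < a'" "a' < b'" "b' < b"
    using assms(1) e1(1) e2(1) unfolding a'_def b'_def by (auto simp: min_def field_simps)
  have ga: "g a' < 0" unfolding a'_def using e1 assms(1) by (intro e1(2)) auto
  have gb: "0 < g b'" unfolding b'_def using e2 assms(1) by (intro e2(2)) auto
  define A where "A = {s \<in> {a'..b'}. 0 \<le> g s}"
  have cont: "continuous_on {a'..b'} g"
    by (rule continuous_on_subset[OF assms(2)]) (use ab in auto)
  have "closed A" unfolding A_def
    using continuous_closed_preimage[OF cont closed_atLeastAtMost, of "{0..}"]
    by (simp add: vimage_def Int_def)
  moreover have "bounded A" unfolding A_def by (rule bounded_subset[of "{a'..b'}"]) auto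
  ultimately have "compact A" by (simp add: compact_eq_bounded_closed)
  moreover have "b' \<in> A" unfolding A_def using ab gb by auto
  ultimately obtain c where c: "c \<in> A" "\<And>s. s \<in> A \<Longrightarrow> c \<le> s"
    using compact_attains_inf[of A] by blast
  have c': "a' < c" "c \<le> b'" "0 \<le> g c" using c(1) ga unfolding A_def by (auto simp: order_le_less)
  have "g c = 0"
  proof (rule ccontr)
    assume "g c \<noteq> 0"
    have "continuous_on {a'..c} g" by (rule continuous_on_subset[OF cont]) (use c' in auto)
    then obtain s where s: "a' \<le> s" "s \<le> c" "g s = 0" using IVT'[of g a' 0 c] c' ga by auto
    then have "s \<in> A" using c' unfolding A_def by auto
    then show False using c(2)[of s] s \<open>g c \<noteq> 0\<close> by auto
  qed
  then obtain d3 where "(g has_real_derivative d3) (at c)" "d3 < 0"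
    using D[of c] c' ab by auto
  then obtain e3 where e3: "e3 > 0" "\<And>h. 0 < h \<Longrightarrow> h < e3 \<Longrightarrow> 0 < g (c - h)"
    using DERIV_neg_dec_left \<open>g c = 0\<close> by metis
  define h where "h = min (e3 / 2) (c - a')"
  have h: "0 < h" "h < e3" "h \<le> c - a'" using e3(1) c' unfolding h_def by auto
  then have "c - h \<in> A" using e3(2)[of h] c' unfolding A_def by auto
  then show False using c(2)[of "c - h"] h(1) by auto
qed

definition proj :: "real^3 \<Rightarrow> real^2" where
  "proj v = vector [v $ 1, v $ 2]"

definition lift :: "real^2 \<Rightarrow> real \<Rightarrow> real^3" where
  "lift z s = vector [z $ 1, z $ 2, s]"

lemma proj_nth [simp]: "proj v $ 1 = v $ 1" "proj v $ 2 = v $ 2"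
  unfolding proj_def by simp_all

lemma lift_nth [simp]: "lift z s $ 1 = z $ 1" "lift z s $ 2 = z $ 2" "lift z s $ 3 = s"
  unfolding lift_def by simp_all

lemma proj_lift [simp]: "proj (lift z s) = z"
  by (simp add: vec_eq_iff forall_2)

lemma lift_proj [simp]: "lift (proj v) (v $ 3) = v"
  by (simp add: vec_eq_iff forall_3)

lemma lift_eq_0_iff [simp]: "lift z s = 0 \<longleftrightarrow> z = 0 \<and> s = 0"
  by (auto simp: vec_eq_iff forall_3 forall_2)

lemma bounded_linear_proj: "bounded_linear proj"
  unfolding linear_conv_bounded_linear[symmetric]
  by (auto intro!: linearI simp: vec_eq_iff forall_2)

lemma bounded_linear_lift: "bounded_linear (\<lambda>z. lift z 0)"
  unfolding linear_conv_bounded_linear[symmetric]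
  by (auto intro!: linearI simp: vec_eq_iff forall_3)

lemma lift_eq: "lift z s = lift z 0 + s *\<^sub>R axis 3 1"
  by (simp add: vec_eq_iff forall_3 axis_def)

lemma inner_real3: "(v::real^3) \<bullet> w = v $ 1 * w $ 1 + v $ 2 * w $ 2 + v $ 3 * w $ 3"
  by (simp add: inner_vec_def sum_3)

lemma inner_real2: "(v::real^2) \<bullet> w = v $ 1 * w $ 1 + v $ 2 * w $ 2"
  by (simp add: inner_vec_def sum_2)

lemma norm_proj_le: "norm (proj v) \<le> norm v"
  by (simp add: norm_eq_sqrt_inner inner_real2 inner_real3)

lemma nth_3_eq: "(v::real^3) $ 3 = v \<bullet> axis 3 1"
  by (simp add: inner_axis)

lemma graph_eq: "graph f = range (\<lambda>z. lift z (f z))"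
  unfolding graph_def lift_def by auto

text \<open>The orthogonal transformation \<open>Q\<close> makes the inner normal at \<open>p\<close> vertical. The lower bound on \<open>t\<close> is
  the one that \<open>reflected_normal_inner_pos\<close> needs.\<close>

locale umbilic_surface = convex_surface +
  fixes p :: "real^3" and t :: real and Q :: "real^3 \<Rightarrow> real^3"
  assumes umbilic_p: "umbilic M p" and t_pos: "t > 0"
    and t_large: "\<And>y. y \<in> K \<Longrightarrow> (y - p) \<bullet> (y - p) \<le> 2 * t\<^sup>2"
    and Q_orth: "orthogonal_transformation Q" and Q_np: "Q (- n p) = axis 3 1"
begin

lemma p_in_M: "p \<in> M"
  using umbilic_p umbilic_def by blast

lemma bounded_linear_Q: "bounded_linear Q"
  using Q_orth orthogonal_transformation_linear linear_conv_bounded_linear by blast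

lemma Q_inner [simp]: "Q v \<bullet> Q w = v \<bullet> w"
  using Q_orth orthogonal_transformation_def by blast

lemma norm_Q [simp]: "norm (Q v) = norm v"
  by (simp add: norm_eq_sqrt_inner)

lemma Q_inv [simp]: "Q (inv Q v) = v" "inv Q (Q v) = v"
  using orthogonal_transformation_bij[OF Q_orth] by (simp_all add: bij_is_surj surj_f_inv_f bij_is_inj)

lemma inv_Q_axis: "inv Q (axis 3 1) = - n p"
  unfolding Q_np[symmetric] by simp

lemma bounded_linear_inv_Q: "bounded_linear (inv Q)"
  using orthogonal_transformation_inv[OF Q_orth] orthogonal_transformation_linear linear_conv_bounded_linear by blast

lemma inv_Q_inner [simp]: "inv Q v \<bullet> inv Q w = v \<bullet> w"
  using Q_inner[of "inv Q v" "inv Q w"] by simp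

lemma inv_Q_eq_0_iff [simp]: "inv Q v = 0 \<longleftrightarrow> v = 0"
  by (metis inv_Q_inner inner_eq_zero_iff)

lemma Q_nth_3: "Q v $ 3 = - (v \<bullet> n p)"
  by (simp add: nth_3_eq Q_np[symmetric])

text \<open>The point of the parallel surface that lies over \<open>y\<close>, relative to the point over \<open>p\<close>, which is the
  centre of the inversion.\<close>

definition pt :: "real^3 \<Rightarrow> real^3" where
  "pt y = (y - p) + t *\<^sub>R (n y - n p)"

definition \<phi> :: "real^3 \<Rightarrow> real^3" where
  "\<phi> y = Q (inversion (pt y))"

text \<open>A unit normal of the image of \<open>\<phi>\<close>.\<close>

definition \<nu> :: "real^3 \<Rightarrow> real^3" where
  "\<nu> y = Q (reflect (pt y) (n y))"

lemma pt_p [simp]: "pt p = 0"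
  unfolding pt_def by simp

lemma inner_normals_le_1: "y \<in> M \<Longrightarrow> n y \<bullet> n p \<le> 1"
  using norm_cauchy_schwarz[of "n y" "n p"] p_in_M by simp

lemma offset_signs:
  assumes "y \<in> M"
  shows "n y \<bullet> (y - p) \<ge> 0" "n p \<bullet> (y - p) \<le> 0"
  using n_le[OF assms, of p] n_le[OF p_in_M, of y] assms p_in_M M_subset_K
  by (auto simp: inner_diff_right)

lemma pt_inner_self:
  assumes "y \<in> M"
  shows "pt y \<bullet> pt y = (y - p) \<bullet> (y - p) + 2 * t * (n y \<bullet> (y - p) - n p \<bullet> (y - p)) + 2 * t\<^sup>2 * (1 - n y \<bullet> n p)"
  unfolding pt_def using assms p_in_M
  by (simp add: inner_add_left inner_add_right inner_diff_left inner_diff_right inner_commute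
      power2_eq_square algebra_simps)

lemma pt_inner_ge:
  assumes "y \<in> M"
  shows "(y - p) \<bullet> (y - p) \<le> pt y \<bullet> pt y"
  unfolding pt_inner_self[OF assms]
  using offset_signs[OF assms] inner_normals_le_1[OF assms] t_pos by simp

lemma norm_pt_ge: "y \<in> M \<Longrightarrow> norm (y - p) \<le> norm (pt y)"
  using pt_inner_ge by (simp add: norm_le)

lemma pt_nonzero: "y \<in> M \<Longrightarrow> y \<noteq> p \<Longrightarrow> pt y \<noteq> 0"
  using norm_pt_ge[of y] by auto

lemma pt_inner_np: "y \<in> M \<Longrightarrow> pt y \<bullet> n p = n p \<bullet> (y - p) - t * (1 - n y \<bullet> n p)"
  unfolding pt_def using p_in_M
  by (simp add: inner_add_left inner_diff_left inner_diff_right inner_commute algebra_simps)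

lemma n_inner_pt: "y \<in> M \<Longrightarrow> n y \<bullet> pt y = n y \<bullet> (y - p) + t * (1 - n y \<bullet> n p)"
  unfolding pt_def by (simp add: inner_add_right inner_diff_right)

text \<open>Put \<open>\<alpha> = n y \<bullet> (y - p)\<close>, \<open>\<beta> = - n p \<bullet> (y - p)\<close> and \<open>c = n y \<bullet> n p\<close>. Then \<open>\<alpha>\<close>, \<open>\<beta>\<close> and \<open>1 - c\<close> are
  nonnegative, the first two by convexity. Multiplied by \<open>\<parallel>pt y\<parallel>\<^sup>2\<close>, the inner product in question
  becomes \<open>c \<parallel>y - p\<parallel>\<^sup>2 + 2 t (\<alpha> + \<beta>) + 2 t\<^sup>2 (1 - c) + 2 \<alpha> \<beta>\<close>. Since \<open>2 t\<^sup>2 \<ge> \<parallel>y - p\<parallel>\<^sup>2\<close>, this is at least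
  \<open>\<parallel>y - p\<parallel>\<^sup>2\<close>.\<close>

lemma reflected_normal_inner_pos:
  assumes "y \<in> M" "y \<noteq> p"
  shows "reflect (pt y) (n y) \<bullet> n p > 0"
proof -
  define \<alpha> \<beta> c where "\<alpha> = n y \<bullet> (y - p)" and "\<beta> = - (n p \<bullet> (y - p))" and "c = n y \<bullet> n p"
  define w where "w = (y - p) \<bullet> (y - p)"
  have s: "\<alpha> \<ge> 0" "\<beta> \<ge> 0" "1 - c \<ge> 0"
    using offset_signs[OF assms(1)] inner_normals_le_1[OF assms(1)] unfolding \<alpha>_def \<beta>_def c_def by simp_all
  have w: "w > 0" "w \<le> 2 * t\<^sup>2"
    unfolding w_def using assms t_large M_subset_K by auto
  have x: "pt y \<bullet> pt y = w + 2 * t * (\<alpha> + \<beta>) + 2 * t\<^sup>2 * (1 - c)"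
    unfolding pt_inner_self[OF assms(1)] \<alpha>_def \<beta>_def c_def w_def by simp
  have xp: "pt y \<bullet> n p = - (\<beta> + t * (1 - c))" "n y \<bullet> pt y = \<alpha> + t * (1 - c)"
    unfolding pt_inner_np[OF assms(1)] n_inner_pt[OF assms(1)] \<alpha>_def \<beta>_def c_def by simp_all
  have pos: "pt y \<bullet> pt y > 0" using pt_nonzero[OF assms] by simp
  have "w * (1 - c) \<le> 2 * t\<^sup>2 * (1 - c)" using w(2) s(3) by (rule mult_right_mono)
  moreover have "t * (\<alpha> + \<beta>) \<ge> 0" "\<alpha> * \<beta> \<ge> 0" using s t_pos by simp_all
  moreover have "(pt y \<bullet> pt y) * c - 2 * (n y \<bullet> pt y) * (pt y \<bullet> n p)
     = c * w + 2 * (t * (\<alpha> + \<beta>)) + 2 * t\<^sup>2 * (1 - c) + 2 * (\<alpha> * \<beta>)"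
    unfolding x xp by (simp add: algebra_simps power2_eq_square)
  ultimately have "(pt y \<bullet> pt y) * c - 2 * (n y \<bullet> pt y) * (pt y \<bullet> n p) > 0"
    using w(1) by (simp add: algebra_simps)
  also have "(pt y \<bullet> pt y) * c - 2 * (n y \<bullet> pt y) * (pt y \<bullet> n p)
      = (pt y \<bullet> pt y) * (reflect (pt y) (n y) \<bullet> n p)"
    unfolding reflect_def c_def using pos by (simp add: inner_diff_left field_simps)
  finally show ?thesis using pos by (simp add: zero_less_mult_iff)
qed

lemma \<nu>_nth_3: "\<nu> y $ 3 = - (reflect (pt y) (n y) \<bullet> n p)"
  unfolding \<nu>_def by (rule Q_nth_3)

lemma \<nu>_nth_3_nonzero: "y \<in> M - {p} \<Longrightarrow> \<nu> y $ 3 \<noteq> 0"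
  using reflected_normal_inner_pos[of y] by (simp add: \<nu>_nth_3)

lemma \<phi>_nth_3: "\<phi> y $ 3 = - (pt y \<bullet> n p) / (pt y \<bullet> pt y)"
  unfolding \<phi>_def Q_nth_3 by (simp add: inversion_def divide_inverse)

lemma \<phi>_nth_3_nonneg: "y \<in> M \<Longrightarrow> \<phi> y $ 3 \<ge> 0"
  unfolding \<phi>_nth_3
proof (intro divide_nonneg_nonneg)
  assume y: "y \<in> M"
  have "t * (1 - n y \<bullet> n p) \<ge> 0" using inner_normals_le_1[OF y] t_pos by simp
  then show "0 \<le> - (pt y \<bullet> n p)" using offset_signs(2)[OF y] pt_inner_np[OF y] by linarith
qed simp

text \<open>The centre \<open>p + t n p\<close> of the inversion lies on the outer parallel surface. The point
  \<open>line_point z s\<close> is the preimage, under inversion and rotation, of the point at height \<open>s\<close> over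
  \<open>z\<close>; for \<open>z \<noteq> 0\<close> it runs through a circle that meets the parallel surface orthogonally at
  the centre, for \<open>z = 0\<close> through the normal line.\<close>

definition line_point :: "real^2 \<Rightarrow> real \<Rightarrow> real^3" where
  "line_point z s = p + t *\<^sub>R n p + inversion (inv Q (lift z s))"

lemma \<phi>_eq_lift_iff:
  assumes "lift z s \<noteq> 0"
  shows "\<phi> y = lift z s \<longleftrightarrow> y + t *\<^sub>R n y = line_point z s"
proof -
  have "\<phi> y = lift z s \<longleftrightarrow> inversion (pt y) = inv Q (lift z s)"
    unfolding \<phi>_def by (metis Q_inv)
  also have "\<dots> \<longleftrightarrow> pt y = inversion (inv Q (lift z s))"
    by (metis inversion_inversion)
  also have "\<dots> \<longleftrightarrow> y + t *\<^sub>R n y = line_point z s"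
    unfolding pt_def line_point_def by (auto simp: algebra_simps)
  finally show ?thesis .
qed

lemma \<phi>_p [simp]: "\<phi> p = 0"
  unfolding \<phi>_def by (simp add: inversion_def linear_simps(3)[OF bounded_linear_Q])

lemma norm_\<phi>: "norm (\<phi> y) = inverse (norm (pt y))"
  unfolding \<phi>_def by (simp add: norm_inversion)

lemma \<phi>_nonzero: "y \<in> M \<Longrightarrow> y \<noteq> p \<Longrightarrow> \<phi> y \<noteq> 0"
  using norm_\<phi>[of y] pt_nonzero[of y] by auto

text \<open>The velocity of \<open>line_point z\<close> is a positive multiple of the reflection of \<open>- n p\<close>, and the gradient
  of the distance is \<open>n y\<close>. As reflections are symmetric, the derivative has the sign opposite to that
  of the inner product in \<open>reflected_normal_inner_pos\<close>.\<close>

lemma line_point_derivative: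
  assumes "lift z s \<noteq> 0" "\<delta> (line_point z s) = t"
  shows "\<exists>d<0. ((\<lambda>s. \<delta> (line_point z s)) has_real_derivative d) (at s)"
proof -
  define L where "L = inv Q (lift z s)"
  have L: "L \<noteq> 0" unfolding L_def using assms(1) by simp
  define y where "y = closest_point K (line_point z s)"
  have y: "y \<in> M" "y + t *\<^sub>R n y = line_point z s"
    using offset_closest_point[OF assms(2) t_pos] unfolding y_def by simp_all
  have \<phi>y: "\<phi> y = lift z s" using y(2) \<phi>_eq_lift_iff[OF assms(1)] by simp
  then have yp: "y \<noteq> p" using assms(1) by auto
  have LL: "L = inversion (pt y)" unfolding L_def \<phi>y[symmetric] \<phi>_def by simp
  define V where "V = reflect L (- n p) /\<^sub>R (L \<bullet> L)"
  have "((\<lambda>s. lift z 0 + s *\<^sub>R axis 3 1) has_derivative (\<lambda>h. h *\<^sub>R axis 3 1)) (at s)"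
    by (auto intro!: derivative_eq_intros)
  then have "((\<lambda>s. lift z s) has_derivative (\<lambda>h. h *\<^sub>R axis 3 1)) (at s)"
    by (simp only: lift_eq[symmetric])
  from bounded_linear.has_derivative[OF bounded_linear_inv_Q this]
  have "((\<lambda>s. inv Q (lift z s)) has_derivative (\<lambda>h. h *\<^sub>R (- n p))) (at s)"
    by (simp add: linear_simps(5)[OF bounded_linear_inv_Q] inv_Q_axis)
  from has_derivative_compose[OF this has_derivative_inversion[OF L[unfolded L_def]], folded L_def]
  have "((\<lambda>s. inversion (inv Q (lift z s))) has_derivative (\<lambda>h. h *\<^sub>R V)) (at s)"
    unfolding V_def by (simp add: linear_simps(5)[OF bounded_linear_reflect] linear_simps(4)[OF bounded_linear_reflect]
        mult.commute)
  then have "((\<lambda>s. line_point z s) has_derivative (\<lambda>h. h *\<^sub>R V)) (at s)"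
    unfolding line_point_def by (auto intro!: derivative_eq_intros)
  from has_derivative_compose[OF this \<delta>_has_derivative[OF assms(2) t_pos]]
  have "((\<lambda>s. \<delta> (line_point z s)) has_derivative (\<lambda>h. n y \<bullet> (h *\<^sub>R V))) (at s)"
    unfolding y_def .
  then have "((\<lambda>s. \<delta> (line_point z s)) has_real_derivative (n y \<bullet> V)) (at s)"
    unfolding has_field_derivative_def inner_scaleR_right by (simp only: mult_commute_abs)
  moreover have "n y \<bullet> V < 0"
  proof -
    have "n y \<bullet> reflect L (- n p) = - (reflect (pt y) (n y) \<bullet> n p)"
      unfolding LL reflect_inversion reflect_inner_commute[symmetric] by simp
    then have "n y \<bullet> reflect L (- n p) < 0" using reflected_normal_inner_pos[OF y(1) yp] by simp
    then show ?thesis unfolding V_def using L by (simp add: mult_pos_neg)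
  qed
  ultimately show ?thesis by blast
qed

lemma continuous_line_point:
  assumes "\<And>s. s \<in> I \<Longrightarrow> lift z s \<noteq> 0"
  shows "continuous_on I (\<lambda>s. \<delta> (line_point z s))"
proof (rule continuous_on_compose2[OF continuous_\<delta> _ subset_UNIV])
  have "continuous_on I (\<lambda>s. inv Q (lift z s))"
    by (subst lift_eq) (intro bounded_linear.continuous_on[OF bounded_linear_inv_Q] continuous_intros)
  then show "continuous_on I (line_point z)"
    unfolding line_point_def inversion_def using assms by (intro continuous_intros) auto
qed

text \<open>Heights of image points are nonnegative, so the segment between the heights of two points over the
  same \<open>z\<close> avoids the origin, where \<open>line_point\<close> breaks down.\<close>

lemma \<phi>_inj:
  assumes "y1 \<in> M - {p}" "y2 \<in> M - {p}" "proj (\<phi> y1) = proj (\<phi> y2)" "\<phi> y1 $ 3 \<le> \<phi> y2 $ 3"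
  shows "y1 = y2"
proof -
  define z a b where "z = proj (\<phi> y1)" and "a = \<phi> y1 $ 3" and "b = \<phi> y2 $ 3"
  have eq: "\<phi> y1 = lift z a" "\<phi> y2 = lift z b"
    unfolding z_def a_def b_def using assms(3) lift_proj by metis+
  have nz: "\<phi> y \<noteq> 0" if "y \<in> M - {p}" for y
    using \<phi>_nonzero that by blast
  have a0: "0 \<le> a" unfolding a_def using \<phi>_nth_3_nonneg assms(1) by blast
  have L0: "lift z s \<noteq> 0" if "s \<in> {a..b}" for s
    using that nz[OF assms(1)] a0 unfolding eq(1) by (auto simp: order_le_less)
  have ab: "a \<le> b" unfolding a_def b_def using assms(4) .
  have pts: "y1 + t *\<^sub>R n y1 = line_point z a" "y2 + t *\<^sub>R n y2 = line_point z b"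
    using \<phi>_eq_lift_iff[OF L0[of a], of y1] \<phi>_eq_lift_iff[OF L0[of b], of y2] eq ab by simp_all
  have y12: "y1 \<in> M" "y2 \<in> M" using assms by auto
  have "\<not> a < b"
  proof
    assume "a < b"
    then show False
    proof (rule decreasing_zeros_unique[where g = "\<lambda>s. \<delta> (line_point z s) - t"])
      show "continuous_on {a..b} (\<lambda>s. \<delta> (line_point z s) - t)"
        by (intro continuous_intros continuous_line_point L0)
      show "\<delta> (line_point z a) - t = 0" "\<delta> (line_point z b) - t = 0"
        unfolding pts[symmetric] using closest_point_offset(2) y12 t_pos by simp_all
      show "\<exists>d<0. ((\<lambda>s. \<delta> (line_point z s) - t) has_real_derivative d) (at s)"
        if s: "s \<in> {a..b}" "\<delta> (line_point z s) - t = 0" for s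
      proof -
        obtain d where d: "d < 0" "((\<lambda>s. \<delta> (line_point z s)) has_real_derivative d) (at s)"
          using line_point_derivative[OF L0[OF s(1)]] s(2) by auto
        then have "((\<lambda>s. \<delta> (line_point z s) - t) has_real_derivative d) (at s)"
          using DERIV_diff[OF d(2) DERIV_const] by simp
        then show ?thesis using d(1) by blast
      qed
    qed
  qed
  then have "line_point z a = line_point z b" using ab by simp
  then show ?thesis using pts closest_point_offset(1) y12 t_pos by (metis less_imp_le)
qed

text \<open>Surjectivity is the intermediate value theorem. At height \<open>b = 1/(2t)\<close> the circle crosses the sphere of
  radius \<open>t\<close> about \<open>p\<close>, so the distance to the body is at most \<open>t\<close> there. At the lower height \<open>a\<close> it
  is at least \<open>t\<close>: for \<open>z \<noteq> 0\<close> the point at height \<open>0\<close> lies in the tangent plane of the parallel surface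
  at the centre.\<close>

lemma bij_proj_\<phi>: "bij_betw (\<lambda>y. proj (\<phi> y)) (M - {p}) UNIV"
proof (rule bij_betw_imageI)
  show "inj_on (\<lambda>y. proj (\<phi> y)) (M - {p})"
    by (rule inj_onI) (metis \<phi>_inj linear)
  have ex: "\<exists>y \<in> M - {p}. proj (\<phi> y) = z" for z
  proof -
    \<comment> \<open>For \<open>z = 0\<close> the height \<open>0\<close> is the point at infinity of the circle, and the starting height
      \<open>1/(4t)\<close> belongs to a point at distance \<open>4t\<close> from the centre, hence not in the interior of the parallel
      body.\<close>
    define a where "a = (if z = 0 then 1 / (4 * t) else 0)"
    define b where "b = 1 / (2 * t)"
    have ab: "0 \<le> a" "a \<le> b" unfolding a_def b_def using t_pos by (auto simp: field_simps)
    have L0: "lift z s \<noteq> 0" if "s \<in> {a..b}" for s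
      using that t_pos by (auto simp: a_def split: if_splits)
    have inner: "inversion (inv Q (lift z s)) \<bullet> n p = - s * inverse (lift z s \<bullet> lift z s)" for s
    proof -
      have "inv Q (lift z s) \<bullet> inv Q (axis 3 1) = s"
        unfolding inv_Q_inner by (simp add: nth_3_eq[symmetric])
      then have "inv Q (lift z s) \<bullet> n p = - s" unfolding inv_Q_axis by simp
      then show ?thesis unfolding inversion_def by (simp add: mult.commute)
    qed
    have ga: "t \<le> \<delta> (line_point z a)"
    proof (cases "z = 0")
      case False
      have "n p \<bullet> (line_point z a - p) \<le> \<delta> (line_point z a)" by (rule \<delta>_lower[OF p_in_M])
      moreover have "n p \<bullet> (line_point z a - p) = t"
        unfolding line_point_def using inner[of a] False p_in_M
        by (simp add: a_def inner_add_right inner_commute)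
      ultimately show ?thesis by simp
    next
      case True
      define q where "q = closest_point K (line_point z a)"
      have "q \<in> K" unfolding q_def using closest_point_in_set[OF closed_K nonempty_K] .
      then have "(norm (q - p))\<^sup>2 \<le> (2 * t)\<^sup>2"
        using order_trans[OF t_large[of q], of "4 * t\<^sup>2"] zero_le_power2[of t]
        by (simp add: power2_norm_eq_inner power_mult_distrib)
      then have q: "norm (q - p) \<le> 2 * t" by (rule power2_le_imp_le) (use t_pos in simp)
      have "lift z a \<bullet> lift z a = a * a" using True by (simp add: inner_real3)
      then have "norm (lift z a) = a" using ab(1) by (simp add: norm_eq_sqrt_inner)
      moreover have "norm (inv Q (lift z a)) = norm (lift z a)" by (simp add: norm_eq_sqrt_inner)
      ultimately have "norm (inversion (inv Q (lift z a))) = 4 * t"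
        using True by (simp add: norm_inversion a_def)
      moreover have "inversion (inv Q (lift z a)) = (line_point z a - q) + ((q - p) - t *\<^sub>R n p)"
        unfolding line_point_def by simp
      ultimately have "4 * t = norm ((line_point z a - q) + ((q - p) - t *\<^sub>R n p))" by simp
      also have "\<dots> \<le> norm (line_point z a - q) + norm ((q - p) - t *\<^sub>R n p)"
        by (rule norm_triangle_ineq)
      also have "\<dots> \<le> norm (line_point z a - q) + (norm (q - p) + norm (t *\<^sub>R n p))"
        by (intro add_left_mono norm_triangle_ineq4)
      finally show ?thesis using q t_pos p_in_M unfolding \<delta>_def q_def by simp
    qed
    have gb: "\<delta> (line_point z b) \<le> t"
    proof -
      have Lb: "lift z b \<bullet> lift z b > 0" using L0[of b] ab by simp
      define c where "c = inversion (inv Q (lift z b))"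
      have "\<delta> (line_point z b) \<le> norm (line_point z b - p)"
        using closest_point_le[OF closed_K, of p "line_point z b"] p_in_M M_subset_K
        by (auto simp: \<delta>_def dist_norm)
      also have "line_point z b - p = c + t *\<^sub>R n p" unfolding line_point_def c_def by simp
      also have "norm (c + t *\<^sub>R n p) = sqrt ((c + t *\<^sub>R n p) \<bullet> (c + t *\<^sub>R n p))"
        by (rule norm_eq_sqrt_inner)
      also have "(c + t *\<^sub>R n p) \<bullet> (c + t *\<^sub>R n p) = c \<bullet> c + 2 * t * (c \<bullet> n p) + t\<^sup>2"
        using p_in_M by (simp add: inner_add_left inner_add_right inner_commute power2_eq_square)
      also have "\<dots> = t\<^sup>2"
        using inner[of b] t_pos unfolding c_def inversion_inner_self inv_Q_inner
        by (simp add: b_def)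
      finally show ?thesis using t_pos by simp
    qed
    obtain s where s: "a \<le> s" "s \<le> b" "\<delta> (line_point z s) = t"
      using IVT2'[OF gb ga ab(2) continuous_line_point[OF L0]] by blast
    define y where "y = closest_point K (line_point z s)"
    have y: "y \<in> M" "y + t *\<^sub>R n y = line_point z s"
      using offset_closest_point[OF s(3) t_pos] unfolding y_def by simp_all
    have "lift z s \<noteq> 0" using L0[of s] s by simp
    moreover from this have "\<phi> y = lift z s" using y(2) \<phi>_eq_lift_iff by blast
    ultimately show ?thesis using y(1) by (intro bexI[of _ y]) auto
  qed
  have "z \<in> (\<lambda>y. proj (\<phi> y)) ` (M - {p})" for z
    using ex[of z] by blast
  then show "(\<lambda>y. proj (\<phi> y)) ` (M - {p}) = UNIV" by blast
qed

end

context umbilic_surface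
begin

section \<open>The graph is twice continuously differentiable\<close>

lemma punctured_C2: "C2_surface (M - {p})"
  using C2_surface_delete_point[OF M_C2] .

lemma punctured_tangent_facts:
  assumes "y \<in> M - {p}" "(n has_derivative A) (at y within (M - {p}))" "v \<in> tangent_space (M - {p}) y"
  shows "n y \<bullet> v = 0" "n y \<bullet> A v = 0" "A v \<bullet> v \<ge> 0"
proof -
  have y: "y \<in> M" "y \<noteq> p" using assms(1) by auto
  have T: "v \<in> tangent_space M y" using assms(3) tangent_space_delete_point[OF M_C2 y] by simp
  have A: "(n has_derivative A) (at y within M)" using assms(2) at_within_delete_point[OF y(2)] by simp
  show "n y \<bullet> v = 0" "n y \<bullet> A v = 0" "A v \<bullet> v \<ge> 0"
    using n_orthogonal[OF y(1) T] n_derivative[OF y(1) A T] by auto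
qed

lemma n_differentiable_punctured:
  "y \<in> M - {p} \<Longrightarrow> \<exists>A. (n has_derivative A) (at y within (M - {p}))"
  using n_differentiable[of y] at_within_delete_point[of y p M] by auto

lemma pt_derivative:
  assumes "(n has_derivative A) (at y within S)"
  shows "(pt has_derivative (\<lambda>v. v + t *\<^sub>R A v)) (at y within S)"
  unfolding pt_def by (auto intro!: derivative_eq_intros assms)

text \<open>The differentials of \<open>\<phi>\<close> and, on tangent vectors, of \<open>\<nu>\<close>, expressed by the differential \<open>A\<close> of \<open>n\<close>.\<close>

definition d\<phi> :: "(real^3 \<Rightarrow> real^3) \<Rightarrow> real^3 \<Rightarrow> real^3 \<Rightarrow> real^3" where
  "d\<phi> A y v = Q (reflect (pt y) (v + t *\<^sub>R A v) /\<^sub>R (pt y \<bullet> pt y))"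

definition d\<nu> :: "(real^3 \<Rightarrow> real^3) \<Rightarrow> real^3 \<Rightarrow> real^3 \<Rightarrow> real^3" where
  "d\<nu> A y v = Q (reflect (pt y) (A v - (2 * (n y \<bullet> pt y) / (pt y \<bullet> pt y)) *\<^sub>R (v + t *\<^sub>R A v)))"

lemma \<phi>_derivative:
  assumes "(n has_derivative A) (at y within S)" "y \<in> M - {p}"
  shows "(\<phi> has_derivative d\<phi> A y) (at y within S)"
proof -
  have "pt y \<noteq> 0" using pt_nonzero assms(2) by blast
  from has_derivative_compose[OF pt_derivative[OF assms(1)] has_derivative_inversion[OF this]]
  show ?thesis unfolding \<phi>_def d\<phi>_def by (rule bounded_linear.has_derivative[OF bounded_linear_Q])
qed

lemma \<nu>_derivative:
  assumes "(n has_derivative A) (at y within (M - {p}))" "y \<in> M - {p}"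
  obtains D where "(\<nu> has_derivative D) (at y within (M - {p}))"
    "\<And>v. v \<in> tangent_space (M - {p}) y \<Longrightarrow> D v = d\<nu> A y v"
proof -
  have x: "pt y \<noteq> 0" using pt_nonzero assms(2) by blast
  obtain D where D: "((\<lambda>y. reflect (pt y) (n y)) has_derivative D) (at y within (M - {p}))"
    "\<And>v. n y \<bullet> (v + t *\<^sub>R A v) = 0 \<Longrightarrow> D v =
      reflect (pt y) (A v - (2 * (n y \<bullet> pt y) / (pt y \<bullet> pt y)) *\<^sub>R (v + t *\<^sub>R A v))"
    by (rule has_derivative_reflect[OF pt_derivative[OF assms(1)] assms(1) x]) blast
  show ?thesis
  proof
    show "(\<nu> has_derivative (\<lambda>v. Q (D v))) (at y within (M - {p}))"
      unfolding \<nu>_def by (rule bounded_linear.has_derivative[OF bounded_linear_Q D(1)])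
    show "Q (D v) = d\<nu> A y v"
      if "v \<in> tangent_space (M - {p}) y" for v
      unfolding d\<nu>_def
      using D(2)[of v] punctured_tangent_facts[OF assms(2,1) that] by (simp add: inner_add_right)
  qed
qed

text \<open>As \<open>A v \<bullet> v \<ge> 0\<close>, outer parallel surfaces of a convex surface are immersed.\<close>

lemma parallel_injective:
  assumes "y \<in> M - {p}" "(n has_derivative A) (at y within (M - {p}))" "v \<in> tangent_space (M - {p}) y"
    "v + t *\<^sub>R A v = 0"
  shows "v = 0"
proof -
  have "v \<bullet> v + t * (A v \<bullet> v) = 0"
    using arg_cong[OF assms(4), of "\<lambda>w. w \<bullet> v"] by (simp add: inner_add_left)
  moreover have "t * (A v \<bullet> v) \<ge> 0" using punctured_tangent_facts(3)[OF assms(1-3)] t_pos by simp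
  ultimately have "v \<bullet> v \<le> 0" by linarith
  then show ?thesis by (metis inner_gt_zero_iff not_le)
qed

lemma d\<phi>_eq_0D:
  assumes "y \<in> M - {p}" "(n has_derivative A) (at y within (M - {p}))" "v \<in> tangent_space (M - {p}) y"
    "d\<phi> A y v = 0"
  shows "v = 0"
proof -
  have "norm (reflect (pt y) (v + t *\<^sub>R A v) /\<^sub>R (pt y \<bullet> pt y)) = 0"
    using arg_cong[OF assms(4), of norm] unfolding d\<phi>_def norm_Q by simp
  then have "v + t *\<^sub>R A v = 0" using pt_nonzero[of y] assms(1) by simp
  then show ?thesis by (rule parallel_injective[OF assms(1-3)])
qed

lemma \<nu>_orthogonal:
  assumes "y \<in> M - {p}" "(n has_derivative A) (at y within (M - {p}))" "v \<in> tangent_space (M - {p}) y"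
  shows "d\<phi> A y v \<bullet> \<nu> y = 0"
  unfolding \<nu>_def d\<phi>_def using punctured_tangent_facts[OF assms]
  by (simp add: inner_add_right inner_commute[of _ "n y"])

lemma norm_\<nu>: "y \<in> M \<Longrightarrow> norm (\<nu> y) = 1"
  unfolding \<nu>_def by simp

lemma C1_pt_chart: "C2_chart (M - {p}) U X \<Longrightarrow> C1_on U (\<lambda>u. pt (X u))"
  unfolding pt_def
  using C1_n_chart[OF C2_chart_delete_point] chart_C1
  by (intro C1_on_add C1_on_diff C1_on_scaleR C1_on_const) auto

lemma C1_\<phi>_chart:
  assumes "C2_chart (M - {p}) U X"
  shows "C1_on U (\<lambda>u. \<phi> (X u))"
  unfolding \<phi>_def using chart_in_surface[OF assms] pt_nonzero
  by (intro C1_on_linear_compose[OF bounded_linear_Q] C1_on_inversion C1_pt_chart[OF assms]) auto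

lemma C1_\<nu>_chart:
  assumes "C2_chart (M - {p}) U X"
  shows "C1_on U (\<lambda>u. \<nu> (X u))"
  unfolding \<nu>_def using chart_in_surface[OF assms] pt_nonzero
  by (intro C1_on_linear_compose[OF bounded_linear_Q] C1_on_reflect C1_pt_chart[OF assms]
      C1_n_chart[OF C2_chart_delete_point[OF assms]]) auto

definition h :: "real^2 \<Rightarrow> real^3" where
  "h = inv_into (M - {p}) (\<lambda>y. proj (\<phi> y))"

definition f :: "real^2 \<Rightarrow> real" where
  "f z = \<phi> (h z) $ 3"

lemma h_in: "h z \<in> M - {p}"
  unfolding h_def using bij_proj_\<phi> by (metis UNIV_I bij_betw_def inv_into_into)

lemma proj_\<phi>_h [simp]: "proj (\<phi> (h z)) = z"
  unfolding h_def using bij_betw_inv_into_right[OF bij_proj_\<phi>, of z] by simp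

lemma h_proj_\<phi>: "y \<in> M - {p} \<Longrightarrow> h (proj (\<phi> y)) = y"
  unfolding h_def using bij_betw_inv_into_left[OF bij_proj_\<phi>, of y] by simp

lemma \<phi>_h: "\<phi> (h z) = lift z (f z)"
  using lift_proj[of "\<phi> (h z)"] unfolding f_def by simp

lemma graph_f: "graph f = \<phi> ` (M - {p})"
proof -
  have "range h = M - {p}"
    using h_in h_proj_\<phi> by (metis (no_types) image_subsetI rangeI subsetI subset_antisym)
  then have "range (\<lambda>z. \<phi> (h z)) = \<phi> ` (M - {p})" by (metis image_image)
  then show ?thesis unfolding graph_eq \<phi>_h .
qed

text \<open>A vector in the kernel would have a vertical image under \<open>d\<phi>\<close>, but the normal \<open>\<nu>\<close>, to which that image is
  orthogonal, is not horizontal.\<close>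

lemma inj_proj_\<phi>_chart:
  assumes "C2_chart (M - {p}) U X" "u \<in> U"
  shows "inj (frechet_derivative (\<lambda>u. proj (\<phi> (X u))) (at u))"
proof -
  define y where "y = X u"
  have y: "y \<in> M - {p}" unfolding y_def using chart_in_surface[OF assms] .
  obtain A where A: "(n has_derivative A) (at y within (M - {p}))"
    using n_differentiable_punctured[OF y] by blast
  define DX where "DX = frechet_derivative X (at u)"
  have X: "(X has_derivative DX) (at u)" unfolding DX_def using chart_has_derivative[OF assms] .
  define E where "E = d\<phi> A y"
  have U: "open U" using assms(1) C2_chart_def by blast
  have "(\<phi> has_derivative E) (at y within X ` U)"
    unfolding E_def
    by (rule has_derivative_subset[OF \<phi>_derivative[OF A y]]) (use chart_in_surface[OF assms(1)] in blast)
  then have "((\<lambda>u. \<phi> (X u)) has_derivative (\<lambda>v. E (DX v))) (at u within U)"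
    unfolding y_def by (rule has_derivative_in_compose[OF has_derivative_at_withinI[OF X]])
  then have "((\<lambda>u. \<phi> (X u)) has_derivative (\<lambda>v. E (DX v))) (at u)"
    using at_within_open[OF assms(2) U] by simp
  then have d: "((\<lambda>u. proj (\<phi> (X u))) has_derivative (\<lambda>v. proj (E (DX v)))) (at u)"
    by (rule bounded_linear.has_derivative[OF bounded_linear_proj])
  have lin: "linear (\<lambda>v. proj (E (DX v)))" using d has_derivative_linear by blast
  have "inj (\<lambda>v. proj (E (DX v)))"
    unfolding linear_injective_0[OF lin]
  proof (intro allI impI)
    fix x assume x: "proj (E (DX x)) = 0"
    define v where "v = DX x"
    have T: "v \<in> tangent_space (M - {p}) y"
      unfolding y_def tangent_space_chart[OF assms] v_def DX_def by blast
    have E12: "E v $ 1 = 0" "E v $ 2 = 0"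
      using x proj_nth unfolding v_def by (metis zero_index)+
    have "E v \<bullet> \<nu> y = 0" unfolding E_def by (rule \<nu>_orthogonal[OF y A T])
    then have "E v $ 3 = 0" using E12 \<nu>_nth_3_nonzero[OF y] by (simp add: inner_real3)
    then have "E v = 0" using E12 by (simp add: vec_eq_iff forall_3)
    then have "v = 0" unfolding E_def by (rule d\<phi>_eq_0D[OF y A T])
    moreover have "inj DX" using assms unfolding C2_chart_def DX_def by blast
    ultimately show "x = 0"
      using linear_injective_0[OF has_derivative_linear[OF X]] unfolding v_def by blast
  qed
  moreover have "frechet_derivative (\<lambda>u. proj (\<phi> (X u))) (at u) = (\<lambda>v. proj (E (DX v)))"
    using frechet_derivative_at[OF d] by simp
  ultimately show ?thesis by simp
qed

text \<open>Locally \<open>h\<close> is a chart of \<open>M\<close> composed with a local inverse of \<open>proj \<circ> \<phi>\<close> in that chart.\<close>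

lemma C1_h_compose:
  fixes F :: "real^3 \<Rightarrow> 'b::real_normed_vector"
  assumes F: "\<And>U X. C2_chart (M - {p}) U X \<Longrightarrow> C1_on U (\<lambda>u. F (X u))"
  shows "C1_on UNIV (\<lambda>z. F (h z))"
proof (rule C1_on_local)
  fix z :: "real^2"
  obtain U X u where c: "C2_chart (M - {p}) U X" "u \<in> U" "h z = X u"
    using punctured_C2 h_in[of z] unfolding C2_surface_def by blast
  have U: "open U" using c(1) C2_chart_def by blast
  have C1: "C1_on U (\<lambda>u. proj (\<phi> (X u)))"
    by (rule C1_on_linear_compose[OF bounded_linear_proj C1_\<phi>_chart[OF c(1)]])
  obtain U' V g where g: "open U'" "U' \<subseteq> U" "u \<in> U'" "open V"
      "homeomorphism U' V (\<lambda>u. proj (\<phi> (X u))) g" "C1_on V g"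
    using C1_inverse_function[OF U C1 c(2) inj_proj_\<phi>_chart[OF c(1,2)]] by metis
  have gV: "g z' \<in> U" "proj (\<phi> (X (g z'))) = z'" if "z' \<in> V" for z'
    using g(2,5) that by (auto simp: homeomorphism_def)
  have eq: "F (X (g z')) = F (h z')" if "z' \<in> V" for z'
    using h_proj_\<phi>[OF chart_in_surface[OF c(1) gV(1)[OF that]]] gV(2)[OF that] by simp
  have "C1_on V (\<lambda>z. F (X (g z)))"
    by (rule C1_on_compose[OF g(6) F[OF c(1)]]) (use gV in blast)
  then have "C1_on V (\<lambda>z. F (h z))" by (rule C1_on_cong[OF _ g(4) eq])
  moreover have "z \<in> V"
  proof -
    have "proj (\<phi> (X u)) \<in> V" using g(3,5) by (auto simp: homeomorphism_def)
    then show ?thesis by (simp add: c(3)[symmetric])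
  qed
  ultimately show "\<exists>V. open V \<and> z \<in> V \<and> C1_on V (\<lambda>z. F (h z))" using g(4) by blast
qed

lemma C1_h: "C1_on UNIV h"
  using C1_h_compose[of "\<lambda>x. x"] chart_C1 by simp

lemma C1_\<nu>_h: "C1_on UNIV (\<lambda>z. \<nu> (h z))"
  using C1_h_compose C1_\<nu>_chart by blast

lemma h_tangent:
  assumes "(h has_derivative H) (at z)"
  shows "H v \<in> tangent_space (M - {p}) (h z)"
proof -
  have "((\<lambda>t. z + t *\<^sub>R v) has_vector_derivative v) (at 0)"
    by (auto intro!: derivative_eq_intros simp: has_vector_derivative_def)
  then have "((\<lambda>t. h (z + t *\<^sub>R v)) has_vector_derivative H v) (at 0)"
    by (rule tangent_space_curve[OF assms zero_less_one, rotated -1]) simp_all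
  then show ?thesis unfolding tangent_space_def using h_in
    by (intro CollectI exI[of _ "\<lambda>t. h (z + t *\<^sub>R v)"] exI[of _ 1]) auto
qed

definition grad_f :: "real^2 \<Rightarrow> real^2" where
  "grad_f z = - inverse (\<nu> (h z) $ 3) *\<^sub>R proj (\<nu> (h z))"

text \<open>The vector \<open>(v, Df v)\<close> is tangent to the graph, hence orthogonal to \<open>\<nu>\<close>; solving for \<open>Df v\<close> yields
  the gradient.\<close>

lemma f_derivative: "(f has_derivative (\<lambda>v. grad_f z \<bullet> v)) (at z)"
proof -
  have y: "h z \<in> M - {p}" by (rule h_in)
  obtain A where A: "(n has_derivative A) (at (h z) within (M - {p}))"
    using n_differentiable_punctured[OF y] by blast
  obtain H where H: "(h has_derivative H) (at z)"
    using C1_on_has_derivative[OF C1_h, of z] by blast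
  define E where "E = d\<phi> A (h z)"
  have "(\<phi> has_derivative E) (at (h z) within h ` UNIV)"
    unfolding E_def by (rule has_derivative_subset[OF \<phi>_derivative[OF A y]]) (rule image_subsetI, rule h_in)
  then have d: "((\<lambda>z. \<phi> (h z)) has_derivative (\<lambda>v. E (H v))) (at z)"
    by (rule has_derivative_in_compose[OF H])
  have "((\<lambda>z. z) has_derivative (\<lambda>v. proj (E (H v)))) (at z)"
    using bounded_linear.has_derivative[OF bounded_linear_proj d] by simp
  from fun_cong[OF has_derivative_unique[OF this has_derivative_ident]]
  have pr: "proj (E (H v)) = v" for v .
  have "E (H v) $ 3 = grad_f z \<bullet> v" for v
  proof -
    have "E (H v) \<bullet> \<nu> (h z) = 0"
      unfolding E_def by (rule \<nu>_orthogonal[OF y A h_tangent[OF H]])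
    moreover have "E (H v) $ 1 = v $ 1" "E (H v) $ 2 = v $ 2" using proj_nth pr by metis+
    ultimately have "v $ 1 * \<nu> (h z) $ 1 + v $ 2 * \<nu> (h z) $ 2 + E (H v) $ 3 * \<nu> (h z) $ 3 = 0"
      by (simp add: inner_real3)
    then have "E (H v) $ 3 = - (v $ 1 * \<nu> (h z) $ 1 + v $ 2 * \<nu> (h z) $ 2) / \<nu> (h z) $ 3"
      using \<nu>_nth_3_nonzero[OF y] by (simp add: field_simps)
    then show ?thesis unfolding grad_f_def by (simp add: inner_real2 divide_inverse algebra_simps)
  qed
  moreover have "(f has_derivative (\<lambda>v. E (H v) $ 3)) (at z)"
    unfolding f_def by (rule bounded_linear.has_derivative[OF bounded_linear_vec_nth d])
  ultimately show ?thesis by simp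
qed

lemma C1_grad_f: "C1_on UNIV grad_f"
  unfolding grad_f_def
  using \<nu>_nth_3_nonzero[OF h_in]
  by (intro C1_on_scaleR C1_on_uminus C1_on_inverse C1_on_linear_compose[OF bounded_linear_proj]
     C1_on_linear_compose[OF bounded_linear_vec_nth] C1_\<nu>_h) auto

lemma C2_f: "C2_on UNIV f"
  unfolding C2_on_def
  using f_derivative C1_on_linear_compose[OF bounded_linear_blinfun_inner_right C1_grad_f]
  by (intro exI[of _ "\<lambda>z. blinfun_inner_right (grad_f z)"]) auto

lemma gradient_f: "gradient f z = grad_f z"
  unfolding gradient_def gderiv_def
proof (rule the_equality)
  show "(f has_derivative (\<lambda>v. v \<bullet> grad_f z)) (at z)"
    using f_derivative[of z] by (simp add: inner_commute)
  fix D assume "(f has_derivative (\<lambda>v. v \<bullet> D)) (at z)"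
  then have "(\<lambda>v. v \<bullet> D) = (\<lambda>v. grad_f z \<bullet> v)"
    using f_derivative[of z] has_derivative_unique by blast
  then show "D = grad_f z" by (metis inner_commute vector_eq_ldot)
qed

section \<open>Principal directions and umbilics correspond\<close>

lemma graph_chart: "C2_chart (graph f) UNIV (\<lambda>z. lift z (f z))"
proof -
  have d: "((\<lambda>z. lift z (f z)) has_derivative (\<lambda>v. lift v (grad_f z \<bullet> v))) (at z)" for z
  proof -
    have "((\<lambda>z. lift z 0 + f z *\<^sub>R axis 3 1) has_derivative (\<lambda>v. lift v 0 + (grad_f z \<bullet> v) *\<^sub>R axis 3 1)) (at z)"
      by (intro has_derivative_add bounded_linear_imp_has_derivative bounded_linear_lift
          has_derivative_scaleR_left f_derivative)
    then show ?thesis by (simp only: lift_eq[symmetric])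
  qed
  define B where "B z = Blinfun (\<lambda>v. lift v 0) + (blinfun_scaleR_left (axis 3 1 :: real^3) o\<^sub>L blinfun_inner_right (grad_f z))" for z
  have B: "blinfun_apply (B z) = (\<lambda>v. lift v (grad_f z \<bullet> v))" for z
    unfolding B_def
    by (rule ext) (simp add: plus_blinfun.rep_eq bounded_linear_Blinfun_apply bounded_linear_lift
        blinfun_compose.rep_eq lift_eq[of _ "grad_f z \<bullet> _"])
  have "C1_on UNIV B"
    unfolding B_def
    by (intro C1_on_add C1_on_const C1_on_linear_compose[OF
        bounded_bilinear.bounded_linear_right[OF bounded_bilinear_blinfun_compose]]
        C1_on_linear_compose[OF bounded_linear_blinfun_inner_right C1_grad_f])
  then have "C2_on UNIV (\<lambda>z. lift z (f z))"
    unfolding C2_on_def using d B by (intro exI[of _ B]) simp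
  moreover have "inj (frechet_derivative (\<lambda>z. lift z (f z)) (at z))" for z
    unfolding frechet_derivative_at[OF d, symmetric]
    by (rule inj_on_inverseI[where g = proj]) simp
  moreover have "homeomorphism UNIV (range (\<lambda>z. lift z (f z))) (\<lambda>z. lift z (f z)) proj"
  proof (rule homeomorphismI)
    show "continuous_on UNIV (\<lambda>z. lift z (f z))"
      using d by (meson continuous_at_imp_continuous_on has_derivative_continuous)
    show "continuous_on (range (\<lambda>z. lift z (f z))) proj"
      by (rule linear_continuous_on[OF bounded_linear_proj])
  qed auto
  ultimately show ?thesis
    unfolding C2_chart_def graph_eq by auto
qed

lemma graph_C2: "C2_surface (graph f)"
  unfolding C2_surface_def using graph_chart graph_eq by blast

lemma \<phi>_diffeomorphism: "surface_diffeomorphism (M - {p}) (graph f) \<phi>"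
  unfolding surface_diffeomorphism_def
proof (intro conjI)
  have inj: "inj_on \<phi> (M - {p})"
    by (rule inj_on_inverseI[where g = "\<lambda>x. h (proj x)"]) (rule h_proj_\<phi>)
  then show "bij_betw \<phi> (M - {p}) (graph f)"
    unfolding graph_f by (rule inj_on_imp_bij_betw)
  show "C1_on_surface (M - {p}) \<phi>"
    unfolding C1_on_surface_def o_def using C1_\<phi>_chart by blast
  show "C1_on_surface (graph f) (inv_into (M - {p}) \<phi>)"
    unfolding C1_on_surface_def o_def
  proof (intro allI impI)
    fix U X assume c: "C2_chart (graph f) U X"
    have "C1_on U (\<lambda>u. h (proj (X u)))"
      by (rule C1_on_compose[OF C1_on_linear_compose[OF bounded_linear_proj chart_C1[OF c]] C1_h]) simp
    then show "C1_on U (\<lambda>u. inv_into (M - {p}) \<phi> (X u))"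
    proof (rule C1_on_cong)
      show "open U" using c C2_chart_def by blast
      fix u assume "u \<in> U"
      then obtain y where y: "y \<in> M - {p}" "X u = \<phi> y"
        using chart_in_surface[OF c] graph_f by blast
      then show "h (proj (X u)) = inv_into (M - {p}) \<phi> (X u)"
        using h_proj_\<phi>[OF y(1)] inv_into_f_f[OF inj y(1)] by simp
    qed
  qed
qed


text \<open>Curves in the graph are carried back to \<open>M\<close> by \<open>h \<circ> proj\<close>.\<close>

lemma graph_tangent_preimage:
  assumes y: "y \<in> M - {p}" and A: "(n has_derivative A) (at y within (M - {p}))"
    and u: "u \<in> tangent_space (graph f) (\<phi> y)"
  shows "\<exists>v \<in> tangent_space (M - {p}) y. u = d\<phi> A y v"
proof -
  have k\<phi>: "(\<lambda>x. h (proj x)) ` graph f \<subseteq> M - {p}"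
    by (rule image_subsetI) (rule h_in)
  obtain H where H: "(h has_derivative H) (at (proj (\<phi> y)))"
    using C1_on_has_derivative[OF C1_h] by blast
  from has_derivative_compose[OF bounded_linear_imp_has_derivative[OF bounded_linear_proj] H]
  have k: "((\<lambda>x. h (proj x)) has_derivative (\<lambda>u. H (proj u))) (at (\<phi> y) within graph f)" .
  have T: "H (proj u) \<in> tangent_space (M - {p}) y"
    using tangent_space_map[OF k u k\<phi>] h_proj_\<phi>[OF y] by simp
  have "(\<phi> has_derivative d\<phi> A y) (at (h (proj (\<phi> y))) within (\<lambda>x. h (proj x)) ` graph f)"
    using has_derivative_subset[OF \<phi>_derivative[OF A y] k\<phi>] h_proj_\<phi>[OF y] by simp
  from has_derivative_in_compose[OF k this]
  have c: "((\<lambda>x. \<phi> (h (proj x))) has_derivative (\<lambda>u. d\<phi> A y (H (proj u)))) (at (\<phi> y) within graph f)" .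
  have "\<phi> y \<in> graph f" using y graph_f by blast
  moreover have "x = \<phi> (h (proj x))" if x: "x \<in> graph f" for x
  proof -
    obtain y' where "y' \<in> M - {p}" "x = \<phi> y'" using x unfolding graph_f by blast
    then show ?thesis using h_proj_\<phi>[of y'] by simp
  qed
  ultimately have "((\<lambda>x. x) has_derivative (\<lambda>u. d\<phi> A y (H (proj u)))) (at (\<phi> y) within graph f)"
    by (rule has_derivative_transform[OF _ _ c])
  from has_derivative_tangent_unique[OF has_derivative_ident this u]
  show ?thesis using T by blast
qed

lemma graph_gauss_map:
  "gauss_map_near (graph f) q (\<lambda>x. \<nu> (h (proj x)))"
  unfolding gauss_map_near_def
proof (intro exI[of _ UNIV] conjI ballI)
  show "continuous_on (graph f \<inter> UNIV) (\<lambda>x. \<nu> (h (proj x)))"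
    by (rule continuous_on_compose2[OF C1_on_continuous[OF C1_\<nu>_h] linear_continuous_on[OF bounded_linear_proj]])
      simp
  fix x assume "x \<in> graph f \<inter> UNIV"
  then obtain y where y: "y \<in> M - {p}" "x = \<phi> y" unfolding graph_f by blast
  obtain A where A: "(n has_derivative A) (at y within (M - {p}))"
    using n_differentiable_punctured[OF y(1)] by blast
  show "norm (\<nu> (h (proj x))) = 1" using norm_\<nu> h_in by blast
  fix u assume "u \<in> tangent_space (graph f) x"
  then obtain v where "v \<in> tangent_space (M - {p}) y" "u = d\<phi> A y v"
    using graph_tangent_preimage[OF y(1) A] y(2) by blast
  then have "u \<bullet> \<nu> y = 0" using \<nu>_orthogonal[OF y(1) A] by simp
  then show "\<nu> (h (proj x)) \<bullet> u = 0" using h_proj_\<phi>[OF y(1)] y(2) by (simp add: inner_commute)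
qed simp_all

lemma graph_differentials:
  assumes y: "y \<in> M - {p}" and A: "(n has_derivative A) (at y within (M - {p}))"
  obtains L where
    "((\<lambda>x. \<nu> (h (proj x))) has_derivative L) (at (\<phi> y) within graph f)"
    "d\<phi> A y ` tangent_space (M - {p}) y = tangent_space (graph f) (\<phi> y)"
    "\<And>v. v \<in> tangent_space (M - {p}) y \<Longrightarrow> L (d\<phi> A y v) = d\<nu> A y v"
proof -
  note E = \<phi>_derivative[OF A y]
  have ET: "d\<phi> A y v \<in> tangent_space (graph f) (\<phi> y)" if "v \<in> tangent_space (M - {p}) y" for v
    using tangent_space_map[OF E that] graph_f by simp
  obtain L' where L': "((\<lambda>z. \<nu> (h z)) has_derivative L') (at (proj (\<phi> y)))"
    using C1_on_has_derivative[OF C1_\<nu>_h] by blast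
  from has_derivative_compose[OF bounded_linear_imp_has_derivative[OF bounded_linear_proj] L']
  have L: "((\<lambda>x. \<nu> (h (proj x))) has_derivative (\<lambda>u. L' (proj u))) (at (\<phi> y) within graph f)" .
  obtain D where D: "(\<nu> has_derivative D) (at y within (M - {p}))"
    "\<And>v. v \<in> tangent_space (M - {p}) y \<Longrightarrow> D v = d\<nu> A y v"
    using \<nu>_derivative[OF A y] by blast
  have "((\<lambda>x. \<nu> (h (proj x))) has_derivative (\<lambda>u. L' (proj u))) (at (\<phi> y) within \<phi> ` (M - {p}))"
    using L graph_f by simp
  from has_derivative_in_compose[OF E this]
  have c: "((\<lambda>y. \<nu> (h (proj (\<phi> y)))) has_derivative (\<lambda>v. L' (proj (d\<phi> A y v)))) (at y within (M - {p}))" .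
  have "(\<nu> has_derivative (\<lambda>v. L' (proj (d\<phi> A y v)))) (at y within (M - {p}))"
    by (rule has_derivative_transform[OF y _ c]) (simp add: h_proj_\<phi>)
  from has_derivative_tangent_unique[OF this D(1)]
  have LE: "L' (proj (d\<phi> A y v)) = d\<nu> A y v" if "v \<in> tangent_space (M - {p}) y" for v
    using that D(2) by simp
  have "d\<phi> A y ` tangent_space (M - {p}) y = tangent_space (graph f) (\<phi> y)"
    using ET graph_tangent_preimage[OF y A] by blast
  from that[OF L this LE] show ?thesis .
qed

text \<open>Both inversion and passage to a parallel surface act on curvatures by a Moebius
  transformation, here \<open>k \<mapsto> k / (1 + t k)\<close> followed by an affine map, which depends on the point
  but not on the direction. Monotonicity of \<open>n\<close> keeps \<open>1 + t k\<close> away from \<open>0\<close>.\<close>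

lemma eigenvector_iff:
  assumes "x \<noteq> 0"
  shows "Q (reflect x (a - b *\<^sub>R w)) = \<kappa> *\<^sub>R Q (reflect x w /\<^sub>R (x \<bullet> x))
    \<longleftrightarrow> a = (b + \<kappa> / (x \<bullet> x)) *\<^sub>R w"
proof -
  have "\<kappa> *\<^sub>R Q (reflect x w /\<^sub>R (x \<bullet> x)) = Q (reflect x ((\<kappa> / (x \<bullet> x)) *\<^sub>R w))"
    by (simp add: linear_simps(5)[OF bounded_linear_Q] linear_simps(5)[OF bounded_linear_reflect] divide_inverse)
  moreover have "Q (reflect x v) = Q (reflect x v') \<longleftrightarrow> v = v'" for v v'
  proof -
    have "Q (reflect x v) = Q (reflect x v') \<longleftrightarrow> reflect x v - reflect x v' = 0"
      by (metis Q_inv(2) right_minus_eq)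
    also have "\<dots> \<longleftrightarrow> v = v'"
      by (simp add: linear_simps(2)[OF bounded_linear_reflect, symmetric])
    finally show ?thesis .
  qed
  ultimately show ?thesis by (simp add: algebra_simps)
qed

lemma curvature_forward:
  fixes a v :: "real^3"
  assumes "a = k *\<^sub>R v" "k \<ge> 0"
  shows "a = (k / (1 + t * k)) *\<^sub>R (v + t *\<^sub>R a)"
proof -
  have "1 + t * k > 0" using assms(2) t_pos by (simp add: add_pos_nonneg)
  moreover have "v + t *\<^sub>R a = (1 + t * k) *\<^sub>R v" unfolding assms(1) by (simp add: scaleR_left_distrib)
  ultimately show ?thesis using assms(1) by simp
qed

lemma curvature_backward:
  fixes a v :: "real^3"
  assumes "a = m *\<^sub>R (v + t *\<^sub>R a)" "v \<noteq> 0"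
  shows "a = (m / (1 - t * m)) *\<^sub>R v"
proof -
  have e: "(1 - t * m) *\<^sub>R a = m *\<^sub>R v"
  proof -
    have "a = m *\<^sub>R v + (t * m) *\<^sub>R a"
      using assms(1) by (simp add: scaleR_right_distrib mult.commute)
    then have "a - (t * m) *\<^sub>R a = m *\<^sub>R v" by (metis add_diff_cancel_right')
    then show ?thesis by (simp add: scaleR_left_diff_distrib)
  qed
  have "1 - t * m \<noteq> 0"
  proof
    assume "1 - t * m = 0"
    then have "m = 0" using e assms(2) by simp
    then show False using \<open>1 - t * m = 0\<close> by simp
  qed
  then have "a = inverse (1 - t * m) *\<^sub>R ((1 - t * m) *\<^sub>R a)" by simp
  then show ?thesis unfolding e by (simp add: divide_inverse mult.commute)
qed

lemma \<phi>_preserves_principal_directions: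
  "preserves_principal_directions (M - {p}) (graph f) \<phi>"
  unfolding preserves_principal_directions_def
proof (intro ballI)
  fix y v assume y: "y \<in> M - {p}" and v: "v \<in> tangent_space (M - {p}) y"
  obtain A where A: "(n has_derivative A) (at y within (M - {p}))"
    using n_differentiable_punctured[OF y] by blast
  define E where "E = d\<phi> A y"
  define b where "b = 2 * (n y \<bullet> pt y) / (pt y \<bullet> pt y)"
  obtain L where L: "((\<lambda>x. \<nu> (h (proj x))) has_derivative L) (at (\<phi> y) within graph f)"
    "E ` tangent_space (M - {p}) y = tangent_space (graph f) (\<phi> y)"
    "\<And>v. v \<in> tangent_space (M - {p}) y \<Longrightarrow> L (E v) = d\<nu> A y v"
    using graph_differentials[OF y A] unfolding E_def by blast
  have x: "pt y \<noteq> 0" using pt_nonzero y by blast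
  have eig: "L (E v) = \<kappa> *\<^sub>R E v \<longleftrightarrow> A v = (b + \<kappa> / (pt y \<bullet> pt y)) *\<^sub>R (v + t *\<^sub>R A v)" for \<kappa>
    unfolding L(3)[OF v] unfolding E_def d\<phi>_def d\<nu>_def b_def by (rule eigenvector_iff[OF x])
  have dE: "differential (M - {p}) \<phi> y v = E v"
    unfolding E_def by (rule differential_eq[OF \<phi>_derivative[OF A y] v])
  have gauss: "gauss_map_near (M - {p}) y n"
    using gauss_map_near_delete_point[OF M_C2 _ _ gauss_map_n] y by blast
  have "principal_direction (graph f) (\<phi> y) (E v) \<longleftrightarrow> E v \<noteq> 0 \<and> (\<exists>\<kappa>. L (E v) = \<kappa> *\<^sub>R E v)"
    using principal_direction_iff[OF graph_C2 _ graph_gauss_map L(1)] y graph_f L(2) v by blast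
  moreover have "principal_direction (M - {p}) y v \<longleftrightarrow> v \<noteq> 0 \<and> (\<exists>k. A v = k *\<^sub>R v)"
    using principal_direction_iff[OF punctured_C2 y gauss A] v by blast
  moreover have "E v = 0 \<longleftrightarrow> v = 0"
  proof
    assume "E v = 0"
    then show "v = 0" unfolding E_def by (rule d\<phi>_eq_0D[OF y A v])
  next
    assume "v = 0"
    then show "E v = 0" using \<phi>_derivative[OF A y] has_derivative_linear linear_0 unfolding E_def by blast
  qed
  moreover have "(\<exists>k. A v = k *\<^sub>R v) \<longleftrightarrow> (\<exists>\<kappa>. L (E v) = \<kappa> *\<^sub>R E v)" if "v \<noteq> 0"
  proof
    assume "\<exists>k. A v = k *\<^sub>R v"
    then obtain k where k: "A v = k *\<^sub>R v" by blast
    have "k * (v \<bullet> v) \<ge> 0" using punctured_tangent_facts(3)[OF y A v] k by simp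
    then have "k \<ge> 0" using that by (metis inner_gt_zero_iff mult.commute zero_le_mult_iff not_le)
    from curvature_forward[OF k this]
    have "L (E v) = ((pt y \<bullet> pt y) * (k / (1 + t * k) - b)) *\<^sub>R E v" unfolding eig using x by simp
    then show "\<exists>\<kappa>. L (E v) = \<kappa> *\<^sub>R E v" by blast
  next
    assume "\<exists>\<kappa>. L (E v) = \<kappa> *\<^sub>R E v"
    then show "\<exists>k. A v = k *\<^sub>R v" unfolding eig using curvature_backward[OF _ that] by blast
  qed
  ultimately show "principal_direction (M - {p}) y v \<longleftrightarrow>
      principal_direction (graph f) (\<phi> y) (differential (M - {p}) \<phi> y v)"
    unfolding dE by blast
qed

lemma umbilic_graph_iff:
  assumes y: "y \<in> M - {p}"
  shows "umbilic (graph f) (\<phi> y) \<longleftrightarrow> umbilic M y"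
proof -
  obtain A where A: "(n has_derivative A) (at y within (M - {p}))"
    using n_differentiable_punctured[OF y] by blast
  define E where "E = d\<phi> A y"
  define b where "b = 2 * (n y \<bullet> pt y) / (pt y \<bullet> pt y)"
  define T where "T = tangent_space (M - {p}) y"
  obtain L where L: "((\<lambda>x. \<nu> (h (proj x))) has_derivative L) (at (\<phi> y) within graph f)"
    "E ` T = tangent_space (graph f) (\<phi> y)"
    "\<And>v. v \<in> T \<Longrightarrow> L (E v) = d\<nu> A y v"
    using graph_differentials[OF y A] unfolding E_def T_def by blast
  have x: "pt y \<noteq> 0" using pt_nonzero y by blast
  have eig: "L (E v) = \<kappa> *\<^sub>R E v \<longleftrightarrow> A v = (b + \<kappa> / (pt y \<bullet> pt y)) *\<^sub>R (v + t *\<^sub>R A v)" if "v \<in> T" for \<kappa> v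
    unfolding L(3)[OF that] unfolding E_def d\<phi>_def d\<nu>_def b_def by (rule eigenvector_iff[OF x])
  have yM: "y \<in> M" "y \<noteq> p" using y by auto
  have TM: "T = tangent_space M y" unfolding T_def using tangent_space_delete_point[OF M_C2 yM] .
  have "(n has_derivative A) (at y within M)" using A at_within_delete_point[OF yM(2)] by simp
  then have 1: "umbilic M y \<longleftrightarrow> (\<exists>k. \<forall>v\<in>T. A v = k *\<^sub>R v)"
    unfolding TM by (rule umbilic_iff[OF M_C2 yM(1) gauss_map_n])
  have "\<phi> y \<in> graph f" using y graph_f by blast
  from umbilic_iff[OF graph_C2 this graph_gauss_map L(1)]
  have 2: "umbilic (graph f) (\<phi> y) \<longleftrightarrow> (\<exists>\<kappa>. \<forall>v\<in>T. L (E v) = \<kappa> *\<^sub>R E v)"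
    unfolding L(2)[symmetric] by simp
  show ?thesis unfolding 1 2
  proof
    assume "\<exists>k. \<forall>v\<in>T. A v = k *\<^sub>R v"
    then obtain k where k: "\<And>v. v \<in> T \<Longrightarrow> A v = k *\<^sub>R v" by blast
    have "L (E v) = ((pt y \<bullet> pt y) * (k / (1 + t * k) - b)) *\<^sub>R E v" if v: "v \<in> T" for v
    proof (cases "v = 0")
      case True
      then have "A v = 0" using k[OF v] by simp
      then show ?thesis unfolding eig[OF v] using True by simp
    next
      case False
      have "k * (v \<bullet> v) \<ge> 0" using punctured_tangent_facts(3)[OF y A v[unfolded T_def]] k[OF v] by simp
      then have "k \<ge> 0" using False by (metis inner_gt_zero_iff mult.commute zero_le_mult_iff not_le)
      from curvature_forward[OF k[OF v] this] show ?thesis unfolding eig[OF v] using x by simp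
    qed
    then show "\<exists>\<kappa>. \<forall>v\<in>T. L (E v) = \<kappa> *\<^sub>R E v" by blast
  next
    assume "\<exists>\<kappa>. \<forall>v\<in>T. L (E v) = \<kappa> *\<^sub>R E v"
    then obtain \<kappa> where \<kappa>: "\<And>v. v \<in> T \<Longrightarrow> L (E v) = \<kappa> *\<^sub>R E v" by blast
    define m where "m = b + \<kappa> / (pt y \<bullet> pt y)"
    have "A v = (m / (1 - t * m)) *\<^sub>R v" if v: "v \<in> T" for v
    proof (cases "v = 0")
      case True
      then show ?thesis using A has_derivative_linear linear_0 by fastforce
    next
      case False
      have "A v = m *\<^sub>R (v + t *\<^sub>R A v)" using \<kappa>[OF v] unfolding eig[OF v] m_def .
      then show ?thesis by (rule curvature_backward[OF _ False])
    qed
    then show "\<exists>k. \<forall>v\<in>T. A v = k *\<^sub>R v" by blast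
  qed
qed

lemma number_of_umbilics_graph: "number_of_umbilics M = number_of_umbilics (graph f) + 1"
proof -
  define B where "B = {y \<in> M - {p}. umbilic M y}"
  have in_surface: "q \<in> S" if "umbilic S q" for S q using that umbilic_def by blast
  have 1: "{q. umbilic M q} = insert p B"
    unfolding B_def using umbilic_p in_surface by auto
  have 2: "{q. umbilic (graph f) q} = \<phi> ` B"
  proof (intro set_eqI iffI)
    fix x assume "x \<in> {q. umbilic (graph f) q}"
    then have u: "umbilic (graph f) x" by simp
    then obtain y where "y \<in> M - {p}" "x = \<phi> y" using in_surface graph_f by blast
    then show "x \<in> \<phi> ` B" using u umbilic_graph_iff unfolding B_def by blast
  qed (use umbilic_graph_iff in \<open>auto simp: B_def\<close>)
  have inj: "inj_on \<phi> B"
    using \<phi>_diffeomorphism unfolding surface_diffeomorphism_def bij_betw_def B_def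
    by (auto intro: inj_on_subset)
  have "p \<notin> B" unfolding B_def by simp
  then show ?thesis
    unfolding number_of_umbilics_def 1 2 using finite_image_iff[OF inj] card_image[OF inj]
    by (auto simp: one_enat_def)
qed

end

section \<open>Behaviour at infinity\<close>

lemma norm_polar: "norm (polar r \<theta>) = \<bar>r\<bar>"
proof -
  have "polar r \<theta> \<bullet> polar r \<theta> = (r * cos \<theta>) * (r * cos \<theta>) + (r * sin \<theta>) * (r * sin \<theta>)"
    unfolding polar_def inner_real2 by simp
  also have "\<dots> = r\<^sup>2 * ((cos \<theta>)\<^sup>2 + (sin \<theta>)\<^sup>2)" by algebra
  finally show ?thesis by (simp add: norm_eq_sqrt_inner)
qed

lemma uniform_limit_polar:
  fixes F :: "real^2 \<Rightarrow> real"
  assumes "(F \<longlongrightarrow> c) at_infinity"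
  shows "uniform_limit UNIV (\<lambda>r \<theta>. F (polar r \<theta>)) (\<lambda>\<theta>. c) at_top"
proof (rule uniform_limitI)
  fix e :: real assume "e > 0"
  then obtain b where b: "\<And>z. b \<le> norm z \<Longrightarrow> dist (F z) c < e"
    using assms unfolding tendsto_iff eventually_at_infinity by blast
  have "\<forall>\<theta>\<in>UNIV. dist (F (polar r \<theta>)) c < e" if "r \<ge> b" for r
    using b order_trans[OF that abs_ge_self] by (simp add: norm_polar)
  then show "\<forall>\<^sub>F r in at_top. \<forall>\<theta>\<in>UNIV. dist (F (polar r \<theta>)) c < e"
    using eventually_ge_at_top by (rule eventually_mono[rotated])
qed

context umbilic_surface
begin

text \<open>Write \<open>y - p = r u\<close> with \<open>\<parallel>u\<parallel> = 1\<close> and \<open>n y - n p = r (k u + a)\<close> with \<open>a \<longrightarrow> 0\<close>, so that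
  \<open>pt y = r ((1 + t k) u + t a)\<close>. The inner products of \<open>pt y\<close> with itself, with \<open>n p\<close> and with
  \<open>n y\<close> are then, up to \<open>o(r\<^sup>2)\<close>, equal to \<open>(1 + t k)\<^sup>2 r\<^sup>2\<close>, \<open>- k (1 + t k) / 2 r\<^sup>2\<close> and
  \<open>k (1 + t k) / 2 r\<^sup>2\<close>. The first order terms of \<open>reflect (pt y) (n y) - n p\<close> cancel.\<close>

lemma expansion_at_umbilic:
  obtains c where
    "((\<lambda>y. - (pt y \<bullet> n p) / (pt y \<bullet> pt y)) \<longlongrightarrow> c) (at p within M)"
    "((\<lambda>y. norm (reflect (pt y) (n y) - n p) / norm (y - p)) \<longlongrightarrow> 0) (at p within M)"
proof -
  obtain k where k: "k \<ge> 0" "((\<lambda>y. n y - k *\<^sub>R y) has_derivative (\<lambda>_. 0)) (at p within M)"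
    using umbilic_normal_expansion[OF umbilic_p] by blast
  define u where "u y = sgn (y - p)" for y
  define a where "a y = (n y - n p - k *\<^sub>R (y - p)) /\<^sub>R norm (y - p)" for y
  define b where "b y = (n p \<bullet> (y - p) + k / 2 * (norm (y - p))\<^sup>2) / (norm (y - p))\<^sup>2" for y
  define s where "s y = u y \<bullet> a y" for y
  define A where "A y = a y \<bullet> a y" for y
  let ?F = "at p within M"
  have b0: "(b \<longlongrightarrow> 0) ?F"
    unfolding b_def by (rule umbilic_height_expansion[OF p_in_M k(2)])
  have na0: "((\<lambda>y. norm (a y)) \<longlongrightarrow> 0) ?F"
  proof -
    have "((\<lambda>y. norm ((n y - k *\<^sub>R y) - (n p - k *\<^sub>R p) - 0) / norm (y - p)) \<longlongrightarrow> 0) ?F"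
      using k(2) unfolding has_derivative_iff_norm by blast
    moreover have "norm ((n y - k *\<^sub>R y) - (n p - k *\<^sub>R p) - 0) / norm (y - p) = norm (a y)" for y
    proof -
      have "(n y - k *\<^sub>R y) - (n p - k *\<^sub>R p) - 0 = n y - n p - k *\<^sub>R (y - p)"
        by (simp add: algebra_simps)
      then show ?thesis unfolding a_def by (simp only: norm_scaleR norm_inverse abs_inverse
            abs_norm_cancel divide_inverse mult.commute)
    qed
    ultimately show ?thesis by simp
  qed
  have s0: "(s \<longlongrightarrow> 0) ?F"
  proof (rule Lim_null_comparison[OF always_eventually na0], intro allI)
    fix y
    have "norm (u y) \<le> 1" unfolding u_def by (simp add: norm_sgn)
    then have "norm (u y) * norm (a y) \<le> 1 * norm (a y)" by (rule mult_right_mono) simp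
    then show "norm (s y) \<le> norm (a y)"
      unfolding s_def using Cauchy_Schwarz_ineq2[of "u y" "a y"] by simp
  qed
  have A0: "(A \<longlongrightarrow> 0) ?F"
    using tendsto_mult[OF na0 na0] unfolding A_def by (simp add: dot_square_norm power2_eq_square)
  define \<beta>1 where "\<beta>1 y = (1 + t * k)\<^sup>2 + 2 * (1 + t * k) * t * s y + t\<^sup>2 * A y" for y
  define \<beta>2 where "\<beta>2 y = b y - k / 2 - t * (k\<^sup>2 + 2 * k * s y + A y) / 2" for y
  define \<beta>3 where "\<beta>3 y = b y + k / 2 + s y + t * (k\<^sup>2 + 2 * k * s y + A y) / 2" for y
  define q where "q y = \<beta>3 y / \<beta>1 y" for y
  have tk: "1 + t * k > 0" using k(1) t_pos by (simp add: add_pos_nonneg)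
  have l1: "(\<beta>1 \<longlongrightarrow> (1 + t * k)\<^sup>2) ?F"
    unfolding \<beta>1_def by (rule tendsto_eq_intros s0 A0 refl | simp)+
  have l2: "(\<beta>2 \<longlongrightarrow> - (k * (1 + t * k) / 2)) ?F"
    unfolding \<beta>2_def
    by (rule tendsto_eq_intros s0 A0 b0 refl | simp)+ (simp add: field_simps power2_eq_square)
  have l3: "(\<beta>3 \<longlongrightarrow> k * (1 + t * k) / 2) ?F"
    unfolding \<beta>3_def
    by (rule tendsto_eq_intros s0 A0 b0 refl | simp)+ (simp add: field_simps power2_eq_square)
  have nz: "(1 + t * k)\<^sup>2 \<noteq> 0" using tk by simp
  have lq: "(q \<longlongrightarrow> k / (2 * (1 + t * k))) ?F"
  proof -
    have "(q \<longlongrightarrow> (k * (1 + t * k) / 2) / (1 + t * k)\<^sup>2) ?F"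
      unfolding q_def by (rule tendsto_divide[OF l3 l1 nz])
    moreover have "(k * (1 + t * k) / 2) / (1 + t * k)\<^sup>2 = k / (2 * (1 + t * k))"
      using tk by (simp add: power2_eq_square)
    ultimately show ?thesis by simp
  qed
  have e: "pt y \<bullet> pt y = (norm (y - p))\<^sup>2 * \<beta>1 y" "pt y \<bullet> n p = (norm (y - p))\<^sup>2 * \<beta>2 y"
    "n y \<bullet> pt y = (norm (y - p))\<^sup>2 * \<beta>3 y"
    "reflect (pt y) (n y) - n p = norm (y - p) *\<^sub>R ((k - 2 * q y * (1 + t * k)) *\<^sub>R u y + (1 - 2 * q y * t) *\<^sub>R a y)"
    if y: "y \<in> M" "y \<noteq> p" for y
  proof -
    define r where "r = norm (y - p)"
    have r: "r > 0" unfolding r_def using y(2) by simp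
    have w: "y - p = r *\<^sub>R u y" unfolding r_def u_def using y(2) by (simp add: sgn_div_norm)
    have uu: "u y \<bullet> u y = 1" unfolding u_def using y(2) by (simp add: dot_square_norm norm_sgn)
    have d: "n y - n p = r *\<^sub>R (k *\<^sub>R u y + a y)"
    proof -
      have "r *\<^sub>R a y = n y - n p - k *\<^sub>R (y - p)" unfolding a_def r_def using y(2) by simp
      then show ?thesis unfolding w by (simp add: algebra_simps)
    qed
    have x: "pt y = r *\<^sub>R ((1 + t * k) *\<^sub>R u y + t *\<^sub>R a y)"
      unfolding pt_def d w by (simp add: algebra_simps)
    have kk: "(k *\<^sub>R u y + a y) \<bullet> (k *\<^sub>R u y + a y) = k\<^sup>2 + 2 * k * s y + A y"
      unfolding s_def A_def using uu
      by (simp add: inner_add_left inner_add_right inner_commute power2_eq_square)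
    have "(n y - n p) \<bullet> (n y - n p) = 2 * (1 - n y \<bullet> n p)"
      using y(1) p_in_M by (simp add: inner_diff_left inner_diff_right inner_commute)
    then have c: "1 - n y \<bullet> n p = r\<^sup>2 * (k\<^sup>2 + 2 * k * s y + A y) / 2"
      unfolding d using kk by (simp add: power2_eq_square)
    have h: "n p \<bullet> (y - p) = r\<^sup>2 * (b y - k / 2)"
      unfolding b_def r_def using y(2) by (simp add: field_simps)
    have nw: "n y \<bullet> (y - p) = r\<^sup>2 * (b y - k / 2) + r\<^sup>2 * (k + s y)"
    proof -
      have "n y \<bullet> (y - p) = n p \<bullet> (y - p) + (n y - n p) \<bullet> (y - p)" by (simp add: inner_diff_left)
      also have "(n y - n p) \<bullet> (y - p) = r\<^sup>2 * (k + s y)"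
        unfolding d w s_def using uu by (simp add: inner_add_left inner_commute power2_eq_square algebra_simps)
      finally show ?thesis unfolding h .
    qed
    have e1: "pt y \<bullet> pt y = r\<^sup>2 * \<beta>1 y"
      unfolding x \<beta>1_def s_def A_def using uu
      by (simp add: inner_add_left inner_add_right inner_commute power2_eq_square algebra_simps)
    have e2: "pt y \<bullet> n p = r\<^sup>2 * \<beta>2 y"
      unfolding pt_inner_np[OF y(1)] h c \<beta>2_def by (simp add: algebra_simps)
    have e3: "n y \<bullet> pt y = r\<^sup>2 * \<beta>3 y"
      unfolding n_inner_pt[OF y(1)] nw c \<beta>3_def by (simp add: algebra_simps)
    show "pt y \<bullet> pt y = (norm (y - p))\<^sup>2 * \<beta>1 y" "pt y \<bullet> n p = (norm (y - p))\<^sup>2 * \<beta>2 y"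
      "n y \<bullet> pt y = (norm (y - p))\<^sup>2 * \<beta>3 y"
      using e1 e2 e3 unfolding r_def .
    have "2 * (n y \<bullet> pt y) / (pt y \<bullet> pt y) = 2 * q y"
      unfolding e1 e3 q_def using r by simp
    then have "reflect (pt y) (n y) - n p = (n y - n p) - (2 * q y) *\<^sub>R pt y"
      unfolding reflect_def by simp
    also have "\<dots> = r *\<^sub>R ((k - 2 * q y * (1 + t * k)) *\<^sub>R u y + (1 - 2 * q y * t) *\<^sub>R a y)"
      unfolding d x by (simp add: algebra_simps)
    finally show "reflect (pt y) (n y) - n p = norm (y - p) *\<^sub>R ((k - 2 * q y * (1 + t * k)) *\<^sub>R u y + (1 - 2 * q y * t) *\<^sub>R a y)"
      unfolding r_def .
  qed
  have ev: "\<forall>\<^sub>F y in ?F. y \<in> M \<and> y \<noteq> p" by (auto simp: eventually_at_filter)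
  have "((\<lambda>y. - \<beta>2 y / \<beta>1 y) \<longlongrightarrow> - (- (k * (1 + t * k) / 2)) / (1 + t * k)\<^sup>2) ?F"
    by (rule tendsto_divide[OF tendsto_minus[OF l2] l1 nz])
  then have 1: "((\<lambda>y. - (pt y \<bullet> n p) / (pt y \<bullet> pt y)) \<longlongrightarrow> - (- (k * (1 + t * k) / 2)) / (1 + t * k)\<^sup>2) ?F"
  proof (rule Lim_transform_eventually)
    show "\<forall>\<^sub>F y in ?F. - \<beta>2 y / \<beta>1 y = - (pt y \<bullet> n p) / (pt y \<bullet> pt y)"
      using ev by eventually_elim (simp add: e)
  qed
  have "((\<lambda>y. \<bar>k - 2 * q y * (1 + t * k)\<bar> + \<bar>1 - 2 * q y * t\<bar> * norm (a y)) \<longlongrightarrow>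
      \<bar>k - 2 * (k / (2 * (1 + t * k))) * (1 + t * k)\<bar> + \<bar>1 - 2 * (k / (2 * (1 + t * k))) * t\<bar> * 0) ?F"
    by (intro tendsto_intros lq na0)
  moreover have "k - 2 * (k / (2 * (1 + t * k))) * (1 + t * k) = 0" using tk by (simp add: field_simps)
  ultimately have m0: "((\<lambda>y. \<bar>k - 2 * q y * (1 + t * k)\<bar> + \<bar>1 - 2 * q y * t\<bar> * norm (a y)) \<longlongrightarrow> 0) ?F"
    by (simp only: abs_zero mult_zero_right add_0_right)
  have 2: "((\<lambda>y. norm (reflect (pt y) (n y) - n p) / norm (y - p)) \<longlongrightarrow> 0) ?F"
  proof (rule Lim_null_comparison[OF _ m0])
    show "\<forall>\<^sub>F y in ?F. norm (norm (reflect (pt y) (n y) - n p) / norm (y - p))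
        \<le> \<bar>k - 2 * q y * (1 + t * k)\<bar> + \<bar>1 - 2 * q y * t\<bar> * norm (a y)"
      using ev
    proof eventually_elim
      case (elim y)
      have "norm (u y) = 1" unfolding u_def using elim by (simp add: norm_sgn)
      then have "norm ((k - 2 * q y * (1 + t * k)) *\<^sub>R u y + (1 - 2 * q y * t) *\<^sub>R a y)
          \<le> \<bar>k - 2 * q y * (1 + t * k)\<bar> + \<bar>1 - 2 * q y * t\<bar> * norm (a y)"
        using norm_triangle_ineq[of "(k - 2 * q y * (1 + t * k)) *\<^sub>R u y" "(1 - 2 * q y * t) *\<^sub>R a y"] by simp
      moreover have "norm (norm (reflect (pt y) (n y) - n p) / norm (y - p))
          = norm ((k - 2 * q y * (1 + t * k)) *\<^sub>R u y + (1 - 2 * q y * t) *\<^sub>R a y)"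
        unfolding e(4)[OF elim[THEN conjunct1] elim[THEN conjunct2]] using elim by simp
      ultimately show ?case by simp
    qed
  qed
  show ?thesis using that 1 2 by blast
qed

text \<open>These bounds make \<open>h z\<close> tend to \<open>p\<close> as \<open>z\<close> tends to infinity, with \<open>\<parallel>z\<parallel> \<parallel>h z - p\<parallel> \<le> 1\<close>.\<close>

lemma norm_h_le: "norm (h z - p) \<le> norm (pt (h z))" "norm z \<le> inverse (norm (pt (h z)))"
proof -
  show "norm (h z - p) \<le> norm (pt (h z))" using norm_pt_ge h_in by blast
  have "norm z \<le> norm (\<phi> (h z))" using norm_proj_le[of "\<phi> (h z)"] by simp
  then show "norm z \<le> inverse (norm (pt (h z)))" by (simp add: norm_\<phi>)
qed

lemma h_at_infinity: "filterlim h (at p within M) at_infinity"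
  unfolding filterlim_at
proof
  show "\<forall>\<^sub>F z in at_infinity. h z \<in> M \<and> h z \<noteq> p" using h_in by simp
  have le: "norm (h z - p) \<le> inverse (norm z)" if "z \<noteq> 0" for z
  proof -
    have "norm (pt (h z)) > 0" using pt_nonzero[of "h z"] h_in[of z] by simp
    then have "norm (pt (h z)) \<le> inverse (norm z)"
      using norm_h_le(2)[of z] that by (simp add: field_simps)
    then show ?thesis using norm_h_le(1)[of z] by linarith
  qed
  have lim: "((\<lambda>z::real^2. inverse (norm z)) \<longlongrightarrow> 0) at_infinity"
    by (rule tendsto_inverse_0_at_top[OF filterlim_norm_at_top])
  have "\<forall>\<^sub>F z in at_infinity. norm (h z - p) \<le> inverse (norm z)"
    unfolding eventually_at_infinity
  proof (intro exI[of _ 1] allI impI)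
    fix z :: "real^2" assume "1 \<le> norm z"
    then show "norm (h z - p) \<le> inverse (norm z)" by (intro le) auto
  qed
  then have "((\<lambda>z. h z - p) \<longlongrightarrow> 0) at_infinity"
    by (rule Lim_null_comparison[OF _ lim])
  then show "(h \<longlongrightarrow> p) at_infinity" by (simp add: LIM_zero_iff)
qed

lemma asymptotically_constant_f: "asymptotically_constant f"
proof -
  obtain c where
    c: "((\<lambda>y. - (pt y \<bullet> n p) / (pt y \<bullet> pt y)) \<longlongrightarrow> c) (at p within M)" and
    r: "((\<lambda>y. norm (reflect (pt y) (n y) - n p) / norm (y - p)) \<longlongrightarrow> 0) (at p within M)"
    using expansion_at_umbilic by blast
  have "((\<lambda>z. - (pt (h z) \<bullet> n p) / (pt (h z) \<bullet> pt (h z))) \<longlongrightarrow> c) at_infinity"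
    by (rule filterlim_compose[OF c h_at_infinity])
  then have f: "(f \<longlongrightarrow> c) at_infinity" unfolding f_def[abs_def] \<phi>_nth_3 .
  define \<rho> where "\<rho> y = norm (reflect (pt y) (n y) - n p) / norm (y - p)" for y
  have \<rho>: "((\<lambda>z. \<rho> (h z)) \<longlongrightarrow> 0) at_infinity"
    unfolding \<rho>_def by (rule filterlim_compose[OF r h_at_infinity])
  have hp: "((\<lambda>z. norm (h z - p)) \<longlongrightarrow> 0) at_infinity"
    using h_at_infinity unfolding filterlim_at by (simp add: tendsto_norm_zero_iff LIM_zero_iff)
  have refl: "norm (reflect (pt (h z)) (n (h z)) - n p) = \<rho> (h z) * norm (h z - p)" for z
    unfolding \<rho>_def using h_in[of z] by simp
  have n3: "((\<lambda>z. \<nu> (h z) $ 3) \<longlongrightarrow> -1) at_infinity"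
  proof -
    have lim: "((\<lambda>z. \<rho> (h z) * norm (h z - p)) \<longlongrightarrow> 0) at_infinity"
      using tendsto_mult[OF \<rho> hp] by simp
    have le: "norm (\<nu> (h z) $ 3 - - 1) \<le> \<rho> (h z) * norm (h z - p)" for z
    proof -
      have "\<nu> (h z) $ 3 - - 1 = - ((reflect (pt (h z)) (n (h z)) - n p) \<bullet> n p)"
        unfolding \<nu>_nth_3 using p_in_M by (simp add: inner_diff_left)
      then show ?thesis
        using Cauchy_Schwarz_ineq2[of "reflect (pt (h z)) (n (h z)) - n p" "n p"] p_in_M refl[of z] by simp
    qed
    have "((\<lambda>z. \<nu> (h z) $ 3 - - 1) \<longlongrightarrow> 0) at_infinity"
      by (rule Lim_null_comparison[OF always_eventually lim]) (intro allI le)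
    then show ?thesis by (simp only: LIM_zero_iff)
  qed
  \<comment> \<open>The horizontal part of \<open>\<nu>\<close> is \<open>o(\<parallel>h z - p\<parallel>)\<close>, hence \<open>o(1 / \<parallel>z\<parallel>)\<close>, while the vertical part tends to \<open>-1\<close>.\<close>
  have le: "norm (norm z * norm (gradient f z)) \<le> \<rho> (h z) * inverse \<bar>\<nu> (h z) $ 3\<bar>" for z
  proof -
    have y: "h z \<in> M" "h z \<noteq> p" using h_in[of z] by auto
    have "proj (\<nu> (h z)) = proj (Q (reflect (pt (h z)) (n (h z)) - n p))"
    proof -
      have "Q (reflect (pt (h z)) (n (h z)) - n p) = \<nu> (h z) + axis 3 1"
        unfolding \<nu>_def Q_np[symmetric] by (simp add: linear_simps(2)[OF bounded_linear_Q] linear_simps(4)[OF bounded_linear_Q])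
      moreover have "proj (axis 3 1) = 0" by (simp add: vec_eq_iff forall_2 axis_def)
      ultimately show ?thesis by (simp add: linear_simps(1)[OF bounded_linear_proj])
    qed
    then have "norm (proj (\<nu> (h z))) \<le> \<rho> (h z) * norm (h z - p)"
      using norm_proj_le[of "Q (reflect (pt (h z)) (n (h z)) - n p)"] refl[of z] by simp
    moreover have "norm z * norm (h z - p) \<le> 1"
    proof -
      have "norm z * norm (h z - p) \<le> inverse (norm (pt (h z))) * norm (pt (h z))"
        using norm_h_le[of z] by (intro mult_mono) auto
      then show ?thesis using pt_nonzero[OF y] by simp
    qed
    moreover have "\<rho> (h z) \<ge> 0" unfolding \<rho>_def by simp
    ultimately have "norm z * norm (proj (\<nu> (h z))) \<le> \<rho> (h z)"
      by (smt (verit) mult.assoc mult.commute mult_left_le mult_left_mono norm_ge_zero)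
    then have "norm z * norm (proj (\<nu> (h z))) * inverse \<bar>\<nu> (h z) $ 3\<bar> \<le> \<rho> (h z) * inverse \<bar>\<nu> (h z) $ 3\<bar>"
      by (rule mult_right_mono) simp
    then show ?thesis unfolding gradient_f grad_f_def by (simp add: mult.assoc mult.commute)
  qed
  have "((\<lambda>z. \<rho> (h z) * inverse \<bar>\<nu> (h z) $ 3\<bar>) \<longlongrightarrow> 0 * inverse \<bar>-1\<bar>) at_infinity"
    by (intro tendsto_intros \<rho> n3) simp
  then have lim: "((\<lambda>z. \<rho> (h z) * inverse \<bar>\<nu> (h z) $ 3\<bar>) \<longlongrightarrow> 0) at_infinity" by simp
  have g: "((\<lambda>z. norm z * norm (gradient f z)) \<longlongrightarrow> 0) at_infinity"
    by (rule Lim_null_comparison[OF always_eventually lim]) (intro allI le)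
  have "uniform_limit UNIV (\<lambda>r \<theta>. norm (polar r \<theta>) * norm (gradient f (polar r \<theta>))) (\<lambda>\<theta>. 0) at_top"
    by (rule uniform_limit_polar[OF g])
  moreover have "\<forall>\<^sub>F r in at_top. \<forall>\<theta>\<in>UNIV. norm (polar r \<theta>) * norm (gradient f (polar r \<theta>)) = r * norm (gradient f (polar r \<theta>))"
    using eventually_ge_at_top[of "0::real"] by eventually_elim (simp add: norm_polar)
  ultimately have "uniform_limit UNIV (\<lambda>r \<theta>. r * norm (gradient f (polar r \<theta>))) (\<lambda>\<theta>. 0) at_top"
    by (rule uniform_limit_cong[THEN iffD1, rotated 2]) simp
  then show ?thesis
    unfolding asymptotically_constant_def using uniform_limit_polar[OF f] by blast
qed

end

section \<open>Removing an umbilic\<close>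

theorem theorem1p1:
  fixes M :: "(real^3) set" and p :: "real^3"
  assumes "C2_surface M" and "closed_convex_surface M" and "umbilic M p"
  shows "\<exists>(f :: real^2 \<Rightarrow> real) (\<phi> :: real^3 \<Rightarrow> real^3).
           C2_on UNIV f \<and> asymptotically_constant f \<and>
           surface_diffeomorphism (M - {p}) (graph f) \<phi> \<and>
           preserves_principal_directions (M - {p}) (graph f) \<phi> \<and>
           number_of_umbilics M = number_of_umbilics (graph f) + 1"
proof -
  obtain K where K: "compact K" "convex K" "interior K \<noteq> {}" "M = frontier K"
    using assms(2) unfolding closed_convex_surface_def by blast
  interpret convex_surface K M using K assms(1) by unfold_locales
  have p: "p \<in> M" using assms(3) umbilic_def by blast
  obtain B where B: "\<And>y. y \<in> K \<Longrightarrow> norm (y - p) \<le> B"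
  proof -
    have "bounded ((\<lambda>y. y - p) ` K)" using K(1) by (simp add: bounded_translation_minus compact_imp_bounded)
    then show ?thesis using that unfolding bounded_iff by blast
  qed
  define t where "t = max B 1"
  have "t > 0" unfolding t_def by simp
  have diam: "(y - p) \<bullet> (y - p) \<le> 2 * t\<^sup>2" if "y \<in> K" for y
  proof -
    have "(norm (y - p))\<^sup>2 \<le> t\<^sup>2"
      using B[OF that] unfolding t_def by (intro power_mono) auto
    then show ?thesis
      using zero_le_power2[of t] unfolding power2_norm_eq_inner by linarith
  qed
  have "norm (- n p) = norm (axis 3 1 :: real^3)" using p by (simp add: norm_eq_sqrt_inner inner_axis_axis)
  then obtain Q :: "real^3 \<Rightarrow> real^3" where Q: "orthogonal_transformation Q" "Q (- n p) = axis 3 1"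
    by (rule orthogonal_transformation_exists)
  interpret umbilic_surface K M p t Q
    by unfold_locales (fact assms(3) \<open>t > 0\<close> diam Q)+
  show ?thesis
    using C2_f asymptotically_constant_f \<phi>_diffeomorphism \<phi>_preserves_principal_directions
      number_of_umbilics_graph by blast
qed

end
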